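(* Let $k\in\mathbb{Z}_{\ge1}$ and let $\mu\in M_+(\overline{\mathbb{D}})$, $\mu\neq0$. The operator $M_z$ of multiplication by the coordinate function on $\mathscr{D}_{\mu,k}$ is a Dirichlet type operator of order $k$. Moreover, $M_z$ is a $(k+1)$-isometry if and only if $\mu$ is supported on $\mathbb{T}$.
   Context: $\mathbb{D}$ is the open unit disc, $\mathbb{T}$ the unit circle, $\overline{\mathbb{D}}=\mathbb{D}\cup\mathbb{T}$, $\operatorname{Hol}(\mathbb{D})$ the holomorphic functions on $\mathbb{D}$, $dA=\frac1\pi dx\,dy$, $H^2$ the Hardy space. $M_+(\overline{\mathbb{D}})$ is the set of finite non-negative Borel measures on $\overline{\mathbb{D}}$. For $z\ne\zeta$, $$G_k(z,\zeta)=|\zeta-z|^{2(k-1)}\log\left|\frac{1-z\overline\zeta}{\zeta-z}\right|^2+\sum_{l=1}^{k-1}\frac{(-1)^l}{l}|\zeta-z|^{2(k-1-l)}(1-|\zeta|^2)^l(1-|z|^2)^l .$$ For $\mu\in M_+(\overline{\mathbb{D}})$ put $\mu_1=\mu|_{\mathbb{D}}$, $\mu_2=\mu|_{\mathbb{T}}$ and $$U_{\mu,k}(z)=\frac{1}{((k-1)!)^2}\int_{\mathbb{D}}\frac{(-1)^{k+1}G_k(z,\zeta)}{(1-|\zeta|^2)^k}\,d\mu_1(\zeta)+\frac{1}{k!(k-1)!}\int_{\mathbb{T}}\frac{(1-|z|^2)^k}{|z-\zeta|^2}\,d\mu_2(\zeta),$$ $$D_{\mu,k}(f)=\int_{\mathbb{D}}|f^{(k)}|^2U_{\mu,k}\,dA,\qquad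 \mathscr{D}_{\mu,k}=\{f\in\operatorname{Hol}(\mathbb{D}):D_{\mu,k}(f)<\infty\}.$$ For $\mu\ne0$ one has $\mathscr{D}_{\mu,k}\subset H^2$, and $\mathscr{D}_{\mu,k}$ is a Hilbert space with norm $\|f\|^2_{\mathscr{D}_{\mu,k}}=\|f\|_{H^2}^2+D_{\mu,k}(f)$, on which $M_z$ is bounded. For a bounded operator $T$ on a Hilbert space, $B_n(T)=\sum_{j=0}^n(-1)^j\binom njT^{*j}T^j$. $T$ is a Dirichlet type operator of order $k$ if $(-1)^kB_n(T)\ge0$ for all $n\ge k$; $T$ is an $n$-isometry if $B_n(T)=0$. *)

theory Defs
  imports "HOL-Complex_Analysis.Complex_Analysis"
begin

section \<open>Operators on Hilbert spaces of complex-valued functions\<close>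

text \<open>
  A space of functions is given by its carrier \<open>H\<close> (with pointwise operations) and its norm \<open>N\<close>.
  The inner product, linear in the first argument, is recovered from the norm by polarization.
\<close>

definition inner_of :: "(('a \<Rightarrow> complex) \<Rightarrow> real) \<Rightarrow> ('a \<Rightarrow> complex) \<Rightarrow> ('a \<Rightarrow> complex) \<Rightarrow> complex" where
  "inner_of N f g =
     (\<Sum>j<4. \<i> ^ j * complex_of_real ((N (\<lambda>x. f x + \<i> ^ j * g x))\<^sup>2)) / 4"

definition hilbert_function_space :: "('a \<Rightarrow> complex) set \<Rightarrow> (('a \<Rightarrow> complex) \<Rightarrow> real) \<Rightarrow> bool" where
  "hilbert_function_space H N \<longleftrightarrow>
     (\<lambda>x. 0) \<in> H \<and>
     (\<forall>f\<in>H. \<forall>g\<in>H. (\<lambda>x. f x + g x) \<in> H) \<and>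
     (\<forall>c. \<forall>f\<in>H. (\<lambda>x. c * f x) \<in> H) \<and>
     (\<forall>f\<in>H. 0 \<le> N f) \<and>
     (\<forall>f\<in>H. inner_of N f f = complex_of_real ((N f)\<^sup>2)) \<and>
     (\<forall>f\<in>H. N f = 0 \<longrightarrow> f = (\<lambda>x. 0)) \<and>
     (\<forall>f\<in>H. \<forall>g\<in>H. \<forall>h\<in>H.
        inner_of N (\<lambda>x. f x + g x) h = inner_of N f h + inner_of N g h) \<and>
     (\<forall>c. \<forall>f\<in>H. \<forall>g\<in>H. inner_of N (\<lambda>x. c * f x) g = c * inner_of N f g) \<and>
     (\<forall>f\<in>H. \<forall>g\<in>H. inner_of N g f = cnj (inner_of N f g)) \<and>
     (\<forall>X :: nat \<Rightarrow> 'a \<Rightarrow> complex.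
        (\<forall>n. X n \<in> H) \<and>
        (\<forall>e>0. \<exists>M. \<forall>m\<ge>M. \<forall>n\<ge>M. N (\<lambda>x. X m x - X n x) < e) \<longrightarrow>
        (\<exists>f\<in>H. (\<lambda>n. N (\<lambda>x. X n x - f x)) \<longlonglongrightarrow> 0))"

definition bounded_operator_on ::
  "('a \<Rightarrow> complex) set \<Rightarrow> (('a \<Rightarrow> complex) \<Rightarrow> real) \<Rightarrow> (('a \<Rightarrow> complex) \<Rightarrow> ('a \<Rightarrow> complex)) \<Rightarrow> bool" where
  "bounded_operator_on H N T \<longleftrightarrow>
     (\<forall>f\<in>H. T f \<in> H) \<and>
     (\<forall>f\<in>H. \<forall>g\<in>H. T (\<lambda>x. f x + g x) = (\<lambda>x. T f x + T g x)) \<and>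
     (\<forall>c. \<forall>f\<in>H. T (\<lambda>x. c * f x) = (\<lambda>x. c * T f x)) \<and>
     (\<exists>C. \<forall>f\<in>H. N (T f) \<le> C * N f)"

definition adjoint_on ::
  "('a \<Rightarrow> complex) set \<Rightarrow> (('a \<Rightarrow> complex) \<Rightarrow> real) \<Rightarrow> (('a \<Rightarrow> complex) \<Rightarrow> ('a \<Rightarrow> complex))
     \<Rightarrow> ('a \<Rightarrow> complex) \<Rightarrow> ('a \<Rightarrow> complex)" where
  "adjoint_on H N T g = (THE h. h \<in> H \<and> (\<forall>f\<in>H. inner_of N (T f) g = inner_of N f h))"

definition B_op ::
  "('a \<Rightarrow> complex) set \<Rightarrow> (('a \<Rightarrow> complex) \<Rightarrow> real) \<Rightarrow> nat \<Rightarrow> (('a \<Rightarrow> complex) \<Rightarrow> ('a \<Rightarrow> complex))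
     \<Rightarrow> ('a \<Rightarrow> complex) \<Rightarrow> ('a \<Rightarrow> complex)" where
  "B_op H N n T f =
     (\<lambda>x. \<Sum>j\<le>n. (-1) ^ j * of_nat (n choose j) * (adjoint_on H N T ^^ j) ((T ^^ j) f) x)"

definition positive_operator_on ::
  "('a \<Rightarrow> complex) set \<Rightarrow> (('a \<Rightarrow> complex) \<Rightarrow> real) \<Rightarrow> (('a \<Rightarrow> complex) \<Rightarrow> ('a \<Rightarrow> complex)) \<Rightarrow> bool" where
  "positive_operator_on H N A \<longleftrightarrow> (\<forall>f\<in>H. inner_of N (A f) f \<in> \<real>\<^sub>\<ge>\<^sub>0)"

text \<open>
  Both notions below are defined for bounded operators on Hilbert spaces only, so this is part of
  each predicate; it also guarantees that \<open>adjoint_on\<close> is the genuine Hilbert space adjoint.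
\<close>

definition dirichlet_type_operator ::
  "('a \<Rightarrow> complex) set \<Rightarrow> (('a \<Rightarrow> complex) \<Rightarrow> real) \<Rightarrow> nat \<Rightarrow> (('a \<Rightarrow> complex) \<Rightarrow> ('a \<Rightarrow> complex)) \<Rightarrow> bool" where
  "dirichlet_type_operator H N k T \<longleftrightarrow>
     hilbert_function_space H N \<and> bounded_operator_on H N T \<and>
     (\<forall>n\<ge>k. positive_operator_on H N (\<lambda>f x. (-1) ^ k * B_op H N n T f x))"

definition n_isometry ::
  "('a \<Rightarrow> complex) set \<Rightarrow> (('a \<Rightarrow> complex) \<Rightarrow> real) \<Rightarrow> nat \<Rightarrow> (('a \<Rightarrow> complex) \<Rightarrow> ('a \<Rightarrow> complex)) \<Rightarrow> bool" where
  "n_isometry H N n T \<longleftrightarrow>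
     hilbert_function_space H N \<and> bounded_operator_on H N T \<and>
     (\<forall>f\<in>H. B_op H N n T f = (\<lambda>x. 0))"


section \<open>The spaces of Dirichlet type of order \<open>k\<close>\<close>

abbreviation unit_disc :: "complex set" where "unit_disc \<equiv> ball 0 1"
abbreviation unit_circle :: "complex set" where "unit_circle \<equiv> sphere 0 1"
abbreviation closed_unit_disc :: "complex set" where "closed_unit_disc \<equiv> cball 0 1"

definition finite_borel_measures_on :: "complex set \<Rightarrow> complex measure set" where
  "finite_borel_measures_on S = {\<mu>. finite_measure \<mu> \<and> sets \<mu> = sets (restrict_space borel S)}"

definition supported_on :: "'a measure \<Rightarrow> 'a set \<Rightarrow> bool" where
  "supported_on \<mu> A \<longleftrightarrow> emeasure \<mu> (space \<mu> - A) = 0"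

definition area_measure :: "complex measure" where
  "area_measure = scale_measure (ennreal (1 / pi)) lborel"

text \<open>
  Only \<open>z \<noteq> \<zeta>\<close> is meaningful. The value that Isabelle's total functions assign on the diagonal is
  immaterial: it can affect \<open>U_pot \<mu> k z\<close> only if \<open>z\<close> is an atom of \<open>\<mu>\<close>, hence only for
  countably many \<open>z\<close>.
\<close>

definition G_ker :: "nat \<Rightarrow> complex \<Rightarrow> complex \<Rightarrow> real" where
  "G_ker k z \<zeta> =
     cmod (\<zeta> - z) ^ (2 * (k - 1)) * ln ((cmod ((1 - z * cnj \<zeta>) / (\<zeta> - z)))\<^sup>2)
     + (\<Sum>l = 1..k - 1. (-1) ^ l / real l * cmod (\<zeta> - z) ^ (2 * (k - 1 - l))
          * (1 - (cmod \<zeta>)\<^sup>2) ^ l * (1 - (cmod z)\<^sup>2) ^ l)"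

text \<open>
  Both integrands are non-negative for \<open>z\<close> in the disc: with \<open>a = |\<zeta> - z|\<^sup>2\<close> and
  \<open>b = (1 - |\<zeta>|\<^sup>2) (1 - |z|\<^sup>2)\<close> one has \<open>|1 - z cnj \<zeta>|\<^sup>2 = a + b\<close>, so \<open>G_ker k z \<zeta>\<close> is \<open>a ^ (k - 1)\<close> times the
  remainder of \<open>ln (1 + b / a)\<close> after \<open>k - 1\<close> Taylor terms, which has the sign of \<open>(-1) ^ (k + 1)\<close>.
  So the integrals may be taken in \<open>[0, \<infinity>]\<close>.
\<close>

definition U_pot :: "complex measure \<Rightarrow> nat \<Rightarrow> complex \<Rightarrow> ennreal" where
  "U_pot \<mu> k z =
     ennreal (1 / (fact (k - 1))\<^sup>2) *
       (\<integral>\<^sup>+\<zeta>\<in>unit_disc. ennreal ((-1) ^ (k + 1) * G_ker k z \<zeta> / (1 - (cmod \<zeta>)\<^sup>2) ^ k) \<partial>\<mu>)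
     + ennreal (1 / (fact k * fact (k - 1))) *
       (\<integral>\<^sup>+\<zeta>\<in>unit_circle. ennreal ((1 - (cmod z)\<^sup>2) ^ k / (cmod (z - \<zeta>))\<^sup>2) \<partial>\<mu>)"

definition D_int :: "complex measure \<Rightarrow> nat \<Rightarrow> (complex \<Rightarrow> complex) \<Rightarrow> ennreal" where
  "D_int \<mu> k f =
     (\<integral>\<^sup>+z\<in>unit_disc. ennreal ((cmod ((deriv ^^ k) f z))\<^sup>2) * U_pot \<mu> k z \<partial>area_measure)"

text \<open>
  A function on the disc is represented by its extension by \<open>0\<close> to the plane, so that
  functions that agree on the disc are equal.
\<close>

definition dirichlet_space :: "complex measure \<Rightarrow> nat \<Rightarrow> (complex \<Rightarrow> complex) set" where
  "dirichlet_space \<mu> k =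
     {f. f holomorphic_on unit_disc \<and> (\<forall>z. z \<notin> unit_disc \<longrightarrow> f z = 0) \<and> D_int \<mu> k f < \<infinity>}"

definition hardy_norm_sq :: "(complex \<Rightarrow> complex) \<Rightarrow> ennreal" where
  "hardy_norm_sq f =
     (SUP r\<in>{0..<1}. ennreal (1 / (2 * pi)) *
        (\<integral>\<^sup>+t\<in>{0..2 * pi}. ennreal ((cmod (f (complex_of_real r * cis t)))\<^sup>2) \<partial>lborel))"

definition dirichlet_norm :: "complex measure \<Rightarrow> nat \<Rightarrow> (complex \<Rightarrow> complex) \<Rightarrow> real" where
  "dirichlet_norm \<mu> k f = sqrt (enn2real (hardy_norm_sq f + D_int \<mu> k f))"

definition M_z :: "(complex \<Rightarrow> complex) \<Rightarrow> (complex \<Rightarrow> complex)" where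
  "M_z f = (\<lambda>z. z * f z)"

end

theory Submission
  imports Defs
begin

text \<open>
  Write \<open>D\<^sub>\<zeta> f\<close> for the energy \<open>D_int\<close> of the unit point mass at \<open>\<zeta>\<close> in the closed disc
  (\<open>local_dirichlet \<zeta> k f\<close> below). By Tonelli the energy of \<open>\<mu>\<close> is the integral of \<open>D\<^sub>\<zeta> f\<close> over
  \<open>\<mu>\<close>, so everything rests on one formula for \<open>D\<^sub>\<zeta> f\<close>, the same inside the disc and on the circle.
  Let \<open>a\<^sub>n\<close> be the Taylor coefficients of \<open>f\<close> and let \<open>u\<close> solve \<open>a\<^sub>n = u\<^sub>n - \<zeta> u\<^sub>n\<^sub>+\<^sub>1\<close>; formally
  \<open>u\<^sub>0 = f \<zeta>\<close>, and \<open>u\<^sub>n\<^sub>+\<^sub>1\<close> are the Taylor coefficients of the quotient \<open>(f - f \<zeta>) / (z - \<zeta>)\<close>. Then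
  \<open>D\<^sub>\<zeta> f\<close> is the sum of \<open>(n choose (k - 1)) |u\<^sub>n\<^sub>+\<^sub>1|\<^sup>2\<close>, and finiteness of \<open>D\<^sub>\<zeta> f\<close> is equivalent to
  the existence of a \<open>u\<close> for which this sum is finite (\<open>tail_sequence_exists\<close>, \<open>local_dirichlet_tail\<close>).

  Multiplication of \<open>f\<close> by \<open>z\<close> shifts \<open>u\<close> by one place and puts \<open>\<zeta> u\<^sub>0\<close> in front. Let \<open>d\<^sub>0 = |u\<^sub>0|\<^sup>2\<close> and,
  for \<open>p \<ge> 1\<close>, let \<open>d\<^sub>p\<close> be the sum of \<open>(n choose (p - 1)) |u\<^sub>n\<^sub>+\<^sub>1|\<^sup>2\<close>. Pascal's rule says that the shift
  turns \<open>d\<^sub>p\<^sub>+\<^sub>1\<close> into \<open>d\<^sub>p\<^sub>+\<^sub>1 + d\<^sub>p\<close>, while \<open>d\<^sub>0\<close> is multiplied by \<open>|\<zeta>|\<^sup>2\<close>. Taking alternating binomial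
  sums \<open>k\<close> times descends from \<open>d\<^sub>k = D\<^sub>\<zeta> f\<close> to \<open>d\<^sub>0\<close>, and for \<open>N \<ge> k\<close> the sum of
  \<open>(-1)\<^sup>j (N choose j) D\<^sub>\<zeta> (z\<^sup>j f)\<close> over \<open>j \<le> N\<close> equals \<open>(-1)\<^sup>k (1 - |\<zeta>|\<^sup>2)\<^sup>N\<^sup>-\<^sup>k |u\<^sub>0|\<^sup>2\<close>
  (\<open>local_dirichlet_alternating_sum\<close>). The Hardy norm contributes nothing to such a sum, because
  \<open>M_z\<close> is isometric for it. Integration over \<open>\<mu>\<close> gives the sign of the defect operators, and for
  \<open>N = k + 1\<close> the factor \<open>1 - |\<zeta>|\<^sup>2\<close> vanishes on the circle; the test function \<open>f = 1\<close>, for which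
  \<open>u\<^sub>0 = 1\<close>, shows that mass inside the disc is detected.

  The formula for \<open>D\<^sub>\<zeta> f\<close> is obtained as follows. The logarithmic kernel has a convergent expansion
  with positive terms, each a radial weight times \<open>1 / |1 - cnj \<zeta> z|\<^sup>2\<^sup>i\<^sup>+\<^sup>2\<close>
  (\<open>potential_kernel_eq_local_kernel\<close>). Hence \<open>D\<^sub>\<zeta> f\<close> is a series of weighted area integrals of
  squared moduli of holomorphic functions, and these are diagonal in the Taylor coefficients
  (\<open>bergman_parseval\<close>). For \<open>|\<zeta>| = 1\<close> a single term survives and a discrete telescoping identity
  finishes the proof (\<open>telescoping_square_identity\<close>). For \<open>|\<zeta>| < 1\<close> the Moebius involution that
  exchanges \<open>0\<close> and \<open>\<zeta>\<close> makes all terms simultaneously diagonal (\<open>local_dirichlet_moebius\<close>).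

  The functional analysis is standard. The space embeds into the direct sum of \<open>\<ell>\<^sup>2\<close> and an \<open>L\<^sup>2\<close> space
  by Taylor coefficients and \<open>k\<close>-th derivatives, which gives the inner product; completeness follows
  from Fatou's lemma, since the Hardy norm controls locally uniform convergence; adjoints exist by
  the Riesz representation theorem; and the defect operators are determined by their quadratic forms.
\<close>

section \<open>Change of variables for holomorphic maps\<close>

definition complex_of_vec :: "real^2 \<Rightarrow> complex" where
  "complex_of_vec v = Complex (v $ 1) (v $ 2)"

definition vec_of_complex :: "complex \<Rightarrow> real^2" where
  "vec_of_complex z = vector [Re z, Im z]"

lemma complex_of_vec_of_complex [simp]: "complex_of_vec (vec_of_complex z) = z"
  by (simp add: complex_of_vec_def vec_of_complex_def)

lemma vec_of_complex_of_vec [simp]: "vec_of_complex (complex_of_vec v) = v"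
  by (simp add: complex_of_vec_def vec_of_complex_def vec_eq_iff forall_2)

lemma bounded_linear_complex_of_vec: "bounded_linear complex_of_vec"
proof (rule linear_conv_bounded_linear[THEN iffD1])
  show "linear complex_of_vec"
    by (rule linearI) (auto simp: complex_of_vec_def complex_eq_iff)
qed

lemma bounded_linear_vec_of_complex: "bounded_linear vec_of_complex"
proof (rule linear_conv_bounded_linear[THEN iffD1])
  show "linear vec_of_complex"
    by (rule linearI) (auto simp: vec_of_complex_def vec_eq_iff forall_2)
qed

lemma measurable_complex_of_vec [measurable]: "complex_of_vec \<in> borel \<rightarrow>\<^sub>M borel"
  by (intro borel_measurable_continuous_onI linear_continuous_on bounded_linear_complex_of_vec)

text \<open>
  Transports Lebesgue measure from \<open>real^2\<close>, the setting of Jacobian determinants, to the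
  complex plane.
\<close>

lemma lborel_complex_eq_distr: "(lborel :: complex measure) = distr lborel borel complex_of_vec"
proof (rule lborel_eqI)
  fix l u :: complex
  assume le: "\<And>b. b \<in> Basis \<Longrightarrow> l \<bullet> b \<le> u \<bullet> b"
  have 1: "Re l \<le> Re u" "Im l \<le> Im u"
    using le[of 1] le[of \<i>] by (auto simp: Basis_complex_def)
  have eq: "complex_of_vec -` box l u = box (vec_of_complex l) (vec_of_complex u)"
    by (auto simp: box_def Basis_complex_def complex_of_vec_def vec_of_complex_def
        Basis_vec_def inner_axis forall_2)
  have *: "v \<in> Basis \<Longrightarrow> vec_of_complex l \<bullet> v \<le> vec_of_complex u \<bullet> v" for v
    using 1 by (auto simp: Basis_vec_def inner_axis vec_of_complex_def forall_2 UNIV_2)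
  have B: "(Basis :: (real^2) set) = {axis 1 1, axis 2 1}"
    by (auto simp: Basis_vec_def UNIV_2)
  have ne: "axis (1::2) (1::real) \<noteq> axis 2 1"
    by (simp add: axis_eq_axis)
  have "emeasure (distr lborel borel complex_of_vec) (box l u)
     = emeasure lborel (box (vec_of_complex l) (vec_of_complex u))"
    by (subst emeasure_distr) (auto simp: eq)
  also have "\<dots> = (\<Prod>b\<in>Basis. (vec_of_complex u - vec_of_complex l) \<bullet> b)"
    using * by (simp add: emeasure_lborel_box)
  also have "(\<Prod>b\<in>Basis. (vec_of_complex u - vec_of_complex l) \<bullet> b) = (\<Prod>b\<in>Basis. (u - l) \<bullet> b)"
    unfolding B Basis_complex_def using ne
    by (simp add: inner_axis vec_of_complex_def inner_complex_def)
  finally show "emeasure (distr lborel borel complex_of_vec) (box l u)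
     = ennreal (\<Prod>b\<in>Basis. (u - l) \<bullet> b)" .
qed simp

text \<open>
  Truncation to bounded sets with bounded Jacobian makes both sides finite; there the formula is
  \<open>has_measure_differentiable_image\<close>. Monotone convergence removes the truncation.
\<close>

lemma emeasure_differentiable_image:
  fixes g :: "real^'n::{finite,wellorder} \<Rightarrow> real^'n::_"
  assumes S: "S \<in> sets borel"
    and der: "\<And>x. x \<in> S \<Longrightarrow> (g has_derivative g' x) (at x within S)"
    and inj: "inj_on g S"
    and J: "(\<lambda>x. indicator S x * \<bar>det (matrix (g' x))\<bar>) \<in> borel_measurable borel"
  shows "emeasure lebesgue (g ` S) = (\<integral>\<^sup>+x\<in>S. ennreal \<bar>det (matrix (g' x))\<bar> \<partial>lborel)"
proof -
  define j where "j = (\<lambda>x. indicator S x * \<bar>det (matrix (g' x))\<bar>)"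
  have [measurable]: "j \<in> borel_measurable borel" using J unfolding j_def .
  have [measurable]: "S \<in> sets borel" by (rule S)
  (* On these pieces both the domain and the Jacobian are bounded, so all quantities are finite. *)
  define A where "A n = {x\<in>S. norm x \<le> real n \<and> j x \<le> real n}" for n :: nat
  have [measurable]: "A n \<in> sets borel" for n
    unfolding A_def using S by measurable
  have AS: "A n \<subseteq> S" for n by (auto simp: A_def)
  have UA: "(\<Union>n. A n) = S"
  proof -
    have "\<exists>n. x \<in> A n" if "x \<in> S" for x
    proof -
      obtain n where "max (norm x) (j x) \<le> real n" using real_arch_simple by blast
      thus ?thesis using that by (auto simp: A_def)
    qed
    thus ?thesis using AS by blast
  qed
  have incA: "incseq A"
    by (auto simp: A_def incseq_def intro: order_trans)
  have step: "g ` A n \<in> lmeasurable \<and> emeasure lebesgue (g ` A n) = (\<integral>\<^sup>+x. ennreal (j x) * indicator (A n) x \<partial>lborel)" for n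
  proof -
    let ?I = "\<integral>\<^sup>+x. ennreal (j x) * indicator (A n) x \<partial>lborel"
    have "?I \<le> (\<integral>\<^sup>+x. ennreal (real n) * indicator (cball (0::real^'n::{finite,wellorder}) (real n)) x \<partial>lborel)"
      by (rule nn_integral_mono) (auto simp: A_def indicator_def ennreal_leI split: if_splits)
    also have "\<dots> = ennreal (real n) * emeasure lborel (cball (0::real^'n::{finite,wellorder}) (real n))"
      by (simp add: nn_integral_cmult_indicator)
    also have "\<dots> < \<infinity>"
      using emeasure_bounded_finite[OF bounded_cball, of "0::real^'n::{finite,wellorder}" "real n"] by (simp add: ennreal_mult_less_top)
    finally have fin: "?I < \<infinity>" .
    then obtain r where r: "?I = ennreal r" "r \<ge> 0" by (metis ennreal_cases infinity_ennreal_def less_irrefl)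
    have "(\<integral>\<^sup>+x. ennreal (j x * indicator (A n) x) \<partial>lborel) = ennreal r"
      unfolding r(1)[symmetric] by (intro nn_integral_cong) (auto simp: indicator_def)
    hence "((\<lambda>x. j x * indicator (A n) x) has_integral r) UNIV"
      by (intro nn_integral_has_integral) (measurable, use r in \<open>auto simp: j_def\<close>)
    hence "((\<lambda>x. \<bar>det (matrix (g' x))\<bar>) has_integral r) (A n)"
      using AS[of n] by (subst has_integral_restrict_UNIV[symmetric], elim has_integral_eq[rotated])
        (auto simp: j_def indicator_def)
    moreover have "(g ` A n \<in> lmeasurable \<and> measure lebesgue (g ` A n) = r) \<longleftrightarrow> ((\<lambda>x. \<bar>det (matrix (g' x))\<bar>) has_integral r) (A n)"
    proof (rule has_measure_differentiable_image)
      show "A n \<in> sets lebesgue" by simp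
      show "(g has_derivative g' x) (at x within A n)" if "x \<in> A n" for x
        using der[of x] that AS[of n] has_derivative_subset by blast
      show "inj_on g (A n)" using inj AS inj_on_subset by blast
    qed
    ultimately have "g ` A n \<in> lmeasurable" "measure lebesgue (g ` A n) = r" by auto
    thus ?thesis using r(1) by (simp add: emeasure_eq_measure2)
  qed
  have "g ` S = (\<Union>n. g ` A n)" using UA by blast
  hence "emeasure lebesgue (g ` S) = (SUP n. emeasure lebesgue (g ` A n))"
    using step incA by (subst SUP_emeasure_incseq)
      (auto simp: incseq_def image_mono fmeasurableD)
  also have "\<dots> = (SUP n. \<integral>\<^sup>+x. ennreal (j x) * indicator (A n) x \<partial>lborel)"
    using step by simp
  also have "\<dots> = (\<integral>\<^sup>+x. (SUP n. ennreal (j x) * indicator (A n) x) \<partial>lborel)"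
  proof (rule nn_integral_monotone_convergence_SUP[symmetric])
    show "incseq (\<lambda>n x. ennreal (j x) * indicator (A n) x)"
      using incA by (auto simp: incseq_def le_fun_def indicator_def)
  qed simp
  also have "\<dots> = (\<integral>\<^sup>+x\<in>S. ennreal \<bar>det (matrix (g' x))\<bar> \<partial>lborel)"
  proof (rule nn_integral_cong)
    fix x
    show "(SUP n. ennreal (j x) * indicator (A n) x) = ennreal \<bar>det (matrix (g' x))\<bar> * indicator S x"
    proof (cases "x \<in> S")
      case True
      then obtain n where n: "x \<in> A n" using UA by blast
      have "(SUP n. ennreal (j x) * indicator (A n) x) = ennreal (j x)"
      proof (rule antisym)
        show "(SUP n. ennreal (j x) * indicator (A n) x) \<le> ennreal (j x)"
          by (rule SUP_least) (auto simp: indicator_def)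
        show "ennreal (j x) \<le> (SUP n. ennreal (j x) * indicator (A n) x)"
          using n by (intro SUP_upper2[of n]) auto
      qed
      thus ?thesis using True by (simp add: j_def)
    next
      case False
      hence "x \<notin> A n" for n using AS by blast
      thus ?thesis using False by simp
    qed
  qed
  finally show ?thesis .
qed

lemma det_matrix_complex_mult:
  "det (matrix (\<lambda>v. vec_of_complex (c * complex_of_vec v))) = (cmod c)\<^sup>2"
  unfolding cmod_power2
  by (simp add: det_2 matrix_def vec_of_complex_def complex_of_vec_def axis_def power2_eq_square)

text \<open>
  Multiplication by \<open>deriv \<phi> z\<close> has real Jacobian determinant \<open>(cmod (deriv \<phi> z))\<^sup>2\<close>. Lebesgue measure
  on the image and the push-forward of the Jacobian density therefore agree on all Borel sets, by
  \<open>emeasure_differentiable_image\<close>.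
\<close>

theorem nn_integral_holomorphic_substitution:
  fixes \<phi> :: "complex \<Rightarrow> complex" and H :: "complex \<Rightarrow> ennreal"
  assumes S: "open S" and hol: "\<phi> holomorphic_on S" and inj: "inj_on \<phi> S"
    and H [measurable]: "H \<in> borel_measurable borel"
  shows "(\<integral>\<^sup>+w\<in>\<phi> ` S. H w \<partial>lborel) = (\<integral>\<^sup>+z\<in>S. H (\<phi> z) * ennreal ((cmod (deriv \<phi> z))\<^sup>2) \<partial>lborel)"
proof -
  have [measurable]: "S \<in> sets borel" using S by simp
  have opI: "open (\<phi> ` S)"
    using open_mapping_thm3[OF hol S inj] .
  hence [measurable]: "\<phi> ` S \<in> sets borel" by simp
  define \<psi> where "\<psi> z = (if z \<in> S then \<phi> z else 0)" for z
  define J where "J z = indicator S z * (cmod (deriv \<phi> z))\<^sup>2" for z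
  have "continuous_on S \<phi>" by (rule holomorphic_on_imp_continuous_on[OF hol])
  hence [measurable]: "\<psi> \<in> borel_measurable borel"
    unfolding \<psi>_def by (intro borel_measurable_continuous_on_if) (auto)
  have "continuous_on S (\<lambda>z. (cmod (deriv \<phi> z))\<^sup>2)"
    by (intro continuous_intros holomorphic_on_imp_continuous_on holomorphic_deriv hol S)
  hence "(\<lambda>z. if z \<in> S then (cmod (deriv \<phi> z))\<^sup>2 else 0) \<in> borel_measurable borel"
    by (intro borel_measurable_continuous_on_if) auto
  also have "(\<lambda>z. if z \<in> S then (cmod (deriv \<phi> z))\<^sup>2 else 0) = J"
    by (auto simp: J_def fun_eq_iff)
  finally have [measurable]: "J \<in> borel_measurable borel" .
  define M1 where "M1 = density lborel (indicator (\<phi> ` S) :: complex \<Rightarrow> ennreal)"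
  define M2 where "M2 = distr (density lborel (\<lambda>z. ennreal (J z))) borel \<psi>"
  have "M1 = M2"
  proof (rule measure_eqI)
    show "sets M1 = sets M2" by (simp add: M1_def M2_def)
    fix B assume "B \<in> sets M1"
    hence B [measurable]: "B \<in> sets borel" by (simp add: M1_def)
    define A where "A = complex_of_vec -` (S \<inter> \<psi> -` B)"
    have [measurable]: "S \<inter> \<psi> -` B \<in> sets borel"
      by (metis (no_types, lifting) B Int_UNIV_right Int_commute \<open>S \<in> sets borel\<close> \<open>\<psi> \<in> borel_measurable borel\<close> measurable_sets_borel sets.Int)
    have Ab [measurable]: "A \<in> sets borel"
      unfolding A_def using measurable_sets_borel[OF measurable_complex_of_vec \<open>S \<inter> \<psi> -` B \<in> sets borel\<close>] by simp
    define g where "g = (\<lambda>v. vec_of_complex (\<phi> (complex_of_vec v)))"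
    define g' where "g' = (\<lambda>v w. vec_of_complex (deriv \<phi> (complex_of_vec v) * complex_of_vec w))"
    have det: "det (matrix (g' v)) = (cmod (deriv \<phi> (complex_of_vec v)))\<^sup>2" for v
      unfolding g'_def by (rule det_matrix_complex_mult)
    have gA: "g ` A = complex_of_vec -` (\<phi> ` S \<inter> B)"
    proof (intro equalityI subsetI)
      fix v assume "v \<in> g ` A"
      thus "v \<in> complex_of_vec -` (\<phi> ` S \<inter> B)"
        by (auto simp: g_def A_def \<psi>_def)
    next
      fix v assume "v \<in> complex_of_vec -` (\<phi> ` S \<inter> B)"
      then obtain z where z: "z \<in> S" "complex_of_vec v = \<phi> z" "\<phi> z \<in> B" by auto
      hence "v = g (vec_of_complex z)" "vec_of_complex z \<in> A"
        by (auto simp: g_def A_def \<psi>_def simp flip: z(2))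
      thus "v \<in> g ` A" by blast
    qed
    have "emeasure M1 B = emeasure lborel (\<phi> ` S \<inter> B)"
      unfolding M1_def by (simp add: emeasure_density flip: indicator_inter_arith)
    also have "\<dots> = emeasure lborel (complex_of_vec -` (\<phi> ` S \<inter> B))"
      by (subst lborel_complex_eq_distr, subst emeasure_distr) auto
    also have "\<dots> = emeasure lebesgue (g ` A)"
      unfolding gA using measurable_sets_borel[OF measurable_complex_of_vec, of "\<phi> ` S \<inter> B"] by simp
    also have "\<dots> = (\<integral>\<^sup>+v\<in>A. ennreal \<bar>det (matrix (g' v))\<bar> \<partial>lborel)"
    proof (rule emeasure_differentiable_image)
      show "A \<in> sets borel" by (rule Ab)
      show "inj_on g A"
        using inj unfolding g_def A_def inj_on_def
        by (metis IntD1 complex_of_vec_of_complex vec_of_complex_of_vec vimageE)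
      show "(g has_derivative g' v) (at v within A)" if "v \<in> A" for v
      proof -
        have "complex_of_vec v \<in> S" using that by (auto simp: A_def)
        hence "(\<phi> has_field_derivative deriv \<phi> (complex_of_vec v)) (at (complex_of_vec v))"
          using hol S holomorphic_derivI by blast
        hence d: "(\<phi> has_derivative (*) (deriv \<phi> (complex_of_vec v))) (at (complex_of_vec v))"
          by (simp add: has_field_derivative_def)
        have "(complex_of_vec has_derivative complex_of_vec) (at v)"
          by (rule bounded_linear_imp_has_derivative[OF bounded_linear_complex_of_vec])
        from has_derivative_compose[OF this d]
        have "((\<lambda>v. \<phi> (complex_of_vec v)) has_derivative (\<lambda>w. deriv \<phi> (complex_of_vec v) * complex_of_vec w)) (at v)" .
        from bounded_linear.has_derivative[OF bounded_linear_vec_of_complex this]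
        have "(g has_derivative g' v) (at v)" unfolding g_def g'_def .
        thus ?thesis by (rule has_derivative_at_withinI)
      qed
      have "(\<lambda>v. indicator A v * J (complex_of_vec v)) \<in> borel_measurable borel" by measurable
      also have "(\<lambda>v. indicator A v * J (complex_of_vec v)) = (\<lambda>v. indicator A v * \<bar>det (matrix (g' v))\<bar>)"
        by (auto simp: fun_eq_iff det J_def A_def indicator_def)
      finally show "(\<lambda>v. indicator A v * \<bar>det (matrix (g' v))\<bar>) \<in> borel_measurable borel" .
    qed
    also have "\<dots> = (\<integral>\<^sup>+v. ennreal (J (complex_of_vec v)) * indicator (\<psi> -` B) (complex_of_vec v) \<partial>lborel)"
      by (intro nn_integral_cong) (auto simp: det J_def A_def indicator_def)
    also have "\<dots> = (\<integral>\<^sup>+z. ennreal (J z) * indicator (\<psi> -` B) z \<partial>(lborel :: complex measure))"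
    proof -
      have [measurable]: "\<psi> -` B \<in> sets borel"
        by (rule measurable_sets_borel[OF _ B]) simp
      show ?thesis
        by (subst lborel_complex_eq_distr, subst nn_integral_distr) auto
    qed
    also have "\<dots> = emeasure M2 B"
      unfolding M2_def using measurable_sets_borel[of \<psi> borel B] B
      by (subst emeasure_distr) (auto simp: emeasure_density)
    finally show "emeasure M1 B = emeasure M2 B" .
  qed
  hence "(\<integral>\<^sup>+w. H w \<partial>M1) = (\<integral>\<^sup>+w. H w \<partial>M2)" by simp
  also have "(\<integral>\<^sup>+w. H w \<partial>M1) = (\<integral>\<^sup>+w\<in>\<phi> ` S. H w \<partial>lborel)"
    unfolding M1_def by (subst nn_integral_density) (auto simp: mult.commute)
  also have "(\<integral>\<^sup>+w. H w \<partial>M2) = (\<integral>\<^sup>+z. ennreal (J z) * H (\<psi> z) \<partial>lborel)"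
    unfolding M2_def by (subst nn_integral_distr) (auto simp: nn_integral_density)
  also have "\<dots> = (\<integral>\<^sup>+z\<in>S. H (\<phi> z) * ennreal ((cmod (deriv \<phi> z))\<^sup>2) \<partial>lborel)"
    by (intro nn_integral_cong) (auto simp: J_def \<psi>_def indicator_def mult.commute)
  finally show ?thesis .
qed

section \<open>Taylor coefficients, Fourier series on circles and the Hardy norm\<close>

lemma has_integral_cis_of_int:
  "((\<lambda>t. cis (of_int j * t)) has_integral (if j = 0 then complex_of_real (2 * pi) else 0)) {0..2 * pi}"
proof (cases "j = 0")
  case True
  show ?thesis
    using True has_integral_const_real[of "1::complex" 0 "2*pi"] by (simp add: scaleR_conv_of_real)
next
  case False
  define A where "A t = cis (of_int j * t) / (\<i> * of_int j)" for t
  have "((\<lambda>t. cis (of_int j * t)) has_integral (A (2 * pi) - A 0)) {0..2 * pi}"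
  proof (rule fundamental_theorem_of_calculus)
    fix t :: real
    have "((\<lambda>t. exp (\<i> * of_int j * complex_of_real t) / (\<i> * of_int j)) has_vector_derivative
             exp (\<i> * of_int j * complex_of_real t)) (at t within {0..2 * pi})"
      using False by (auto intro!: derivative_eq_intros has_vector_derivative_real_field simp: field_simps)
    thus "(A has_vector_derivative cis (of_int j * t)) (at t within {0..2 * pi})"
      unfolding A_def cis_conv_exp by (simp add: mult.assoc)
  qed simp
  moreover have "A (2 * pi) = A 0"
    using cis_multiple_2pi[of "of_int j"] by (simp add: A_def mult.commute mult.left_commute)
  ultimately show ?thesis using False by simp
qed

lemma has_integral_trig_polynomial_norm_sq:
  "((\<lambda>t. (cmod (\<Sum>n<N. c n * cis (real n * t)))\<^sup>2) has_integral (2 * pi * (\<Sum>n<N. (cmod (c n))\<^sup>2))) {0..2 * pi}"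
proof -
  have exp: "(\<Sum>n<N. c n * cis (real n * t)) * cnj (\<Sum>n<N. c n * cis (real n * t))
     = (\<Sum>m<N. \<Sum>n<N. c m * cnj (c n) * cis (of_int (int m - int n) * t))" for t
    by (simp add: sum_product cis_cnj cis_mult algebra_simps flip: cis_mult)
       (simp add: cis_mult algebra_simps)
  have "((\<lambda>t. \<Sum>m<N. \<Sum>n<N. c m * cnj (c n) * cis (of_int (int m - int n) * t)) has_integral
          (\<Sum>m<N. \<Sum>n<N. c m * cnj (c n) * (if int m - int n = 0 then complex_of_real (2 * pi) else 0))) {0..2 * pi}"
    by (intro has_integral_sum has_integral_mult_right has_integral_cis_of_int) auto
  also have "(\<Sum>m<N. \<Sum>n<N. c m * cnj (c n) * (if int m - int n = 0 then complex_of_real (2 * pi) else 0))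
     = (\<Sum>m<N. c m * cnj (c m) * complex_of_real (2 * pi))"
    by (intro sum.cong refl) (simp add: if_distrib cong: if_cong)
  also have "\<dots> = complex_of_real (2 * pi * (\<Sum>n<N. (cmod (c n))\<^sup>2))"
    by (simp add: sum_distrib_left mult.commute complex_norm_square[symmetric] flip: complex_norm_square)
  finally have "((\<lambda>t. (\<Sum>n<N. c n * cis (real n * t)) * cnj (\<Sum>n<N. c n * cis (real n * t))) has_integral
       complex_of_real (2 * pi * (\<Sum>n<N. (cmod (c n))\<^sup>2))) {0..2 * pi}"
    unfolding exp .
  from has_integral_linear[OF this bounded_linear_Re]
  show ?thesis
    by (simp add: o_def complex_norm_square[symmetric] del: cnj_sum flip: complex_norm_square)
qed

lemma summable_norm_imp_summable_norm_sq:
  fixes c :: "nat \<Rightarrow> 'a::real_normed_vector"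
  assumes "summable (\<lambda>n. norm (c n))"
  shows "summable (\<lambda>n. (norm (c n))\<^sup>2)"
proof -
  have "(\<lambda>n. norm (c n)) \<longlonglongrightarrow> 0" by (rule summable_LIMSEQ_zero[OF assms])
  hence "eventually (\<lambda>n. norm (c n) < 1) sequentially"
    by (rule order_tendstoD) simp
  hence "eventually (\<lambda>n. norm ((norm (c n))\<^sup>2) \<le> norm (c n)) sequentially"
    by eventually_elim (simp add: power2_eq_square mult_left_le)
  thus ?thesis using assms by (rule summable_comparison_test_ev)
qed

text \<open>
  Absolute convergence provides a constant that dominates all partial sums, so the orthogonality
  relations pass to the limit by dominated convergence.
\<close>

lemma nn_integral_circle_parseval:
  assumes c: "summable (\<lambda>n. cmod (c n))"
  shows "(\<integral>\<^sup>+t\<in>{0..2 * pi}. ennreal ((cmod (\<Sum>n. c n * cis (real n * t)))\<^sup>2) \<partial>lborel)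
       = ennreal (2 * pi) * (\<Sum>n. ennreal ((cmod (c n))\<^sup>2))"
proof -
  define g where "g N t = (cmod (\<Sum>n<N. c n * cis (real n * t)))\<^sup>2" for N t
  define G where "G t = (cmod (\<Sum>n. c n * cis (real n * t)))\<^sup>2" for t
  have s2: "summable (\<lambda>n. (cmod (c n))\<^sup>2)" by (rule summable_norm_imp_summable_norm_sq[OF c])
  have int: "(g N has_integral (2 * pi * (\<Sum>n<N. (cmod (c n))\<^sup>2))) {0..2 * pi}" for N
    unfolding g_def by (rule has_integral_trig_polynomial_norm_sq)
  have sm: "summable (\<lambda>n. c n * cis (real n * t))" for t
    by (rule summable_norm_cancel) (simp add: norm_mult c)
  have conv: "(\<lambda>N. g N t) \<longlonglongrightarrow> G t" for t
    unfolding g_def G_def by (intro tendsto_intros summable_LIMSEQ sm)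
  have bd: "norm (g N t) \<le> (\<Sum>n. cmod (c n))\<^sup>2" for N t
  proof -
    have "cmod (\<Sum>n<N. c n * cis (real n * t)) \<le> (\<Sum>n<N. cmod (c n))"
      by (rule order_trans[OF norm_sum]) (simp add: norm_mult)
    also have "\<dots> \<le> (\<Sum>n. cmod (c n))" by (rule sum_le_suminf[OF c]) auto
    finally show ?thesis by (simp add: g_def power_mono)
  qed
  have "G integrable_on {0..2 * pi}" and lim: "(\<lambda>N. integral {0..2 * pi} (g N)) \<longlonglongrightarrow> integral {0..2 * pi} G"
    using dominated_convergence[of g "{0..2 * pi}" "\<lambda>_. (\<Sum>n. cmod (c n))\<^sup>2" G] int bd conv
    by auto
  moreover have "integral {0..2 * pi} G = 2 * pi * (\<Sum>n. (cmod (c n))\<^sup>2)"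
  proof (rule LIMSEQ_unique[OF lim])
    have "(\<lambda>N. 2 * pi * (\<Sum>n<N. (cmod (c n))\<^sup>2)) \<longlonglongrightarrow> 2 * pi * (\<Sum>n. (cmod (c n))\<^sup>2)"
      by (intro tendsto_intros summable_LIMSEQ s2)
    moreover have "integral {0..2 * pi} (g N) = 2 * pi * (\<Sum>n<N. (cmod (c n))\<^sup>2)" for N
      by (rule integral_unique[OF int])
    ultimately show "(\<lambda>N. integral {0..2 * pi} (g N)) \<longlonglongrightarrow> 2 * pi * (\<Sum>n. (cmod (c n))\<^sup>2)"
      by (simp only:)
  qed
  ultimately have "(G has_integral (2 * pi * (\<Sum>n. (cmod (c n))\<^sup>2))) {0..2 * pi}"
    by (simp add: has_integral_iff)
  from nn_integral_has_integral_lebesgue[OF _ this]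
  have "(\<integral>\<^sup>+t. ennreal (indicator {0..2 * pi} t * G t) \<partial>lborel) = ennreal (2 * pi * (\<Sum>n. (cmod (c n))\<^sup>2))"
    by (simp add: G_def)
  also have "\<dots> = ennreal (2 * pi) * (\<Sum>n. ennreal ((cmod (c n))\<^sup>2))"
    by (subst ennreal_mult) (auto simp: suminf_nonneg s2 suminf_ennreal2)
  finally show ?thesis
    by (simp add: G_def indicator_mult_ennreal mult.commute)
qed

abbreviation taylor_coeff :: "(complex \<Rightarrow> complex) \<Rightarrow> nat \<Rightarrow> complex" where
  "taylor_coeff f n \<equiv> fps_nth (fps_expansion f 0) n"

lemma taylor_sums:
  assumes "f holomorphic_on unit_disc" "z \<in> unit_disc"
  shows "(\<lambda>n. taylor_coeff f n * z ^ n) sums f z"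
  using holomorphic_power_series[OF assms] by (simp add: fps_expansion_def)

lemma summable_norm_taylor:
  assumes "f holomorphic_on unit_disc" "cmod z < 1"
  shows "summable (\<lambda>n. cmod (taylor_coeff f n * z ^ n))"
proof -
  define r where "r = (1 + cmod z) / 2"
  have r: "cmod z < r" "r < 1" "0 < r"
    using assms(2) norm_ge_zero[of z] by (auto simp: r_def field_simps add_pos_nonneg simp del: norm_ge_zero)
  have "summable (\<lambda>n. taylor_coeff f n * complex_of_real r ^ n)"
    using taylor_sums[OF assms(1), of "complex_of_real r"] r by (auto simp: sums_iff)
  from powser_insidea[OF this, of z] r show ?thesis by simp
qed

text \<open>
  On the circle of radius \<open>r\<close> Parseval's identity gives a power series in \<open>r\<^sup>2\<close> with non-negative
  coefficients, whose supremum over \<open>r < 1\<close> is the sum of the coefficients.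
\<close>

lemma hardy_norm_sq_eq_suminf:
  assumes f: "f holomorphic_on unit_disc"
  shows "hardy_norm_sq f = (\<Sum>n. ennreal ((cmod (taylor_coeff f n))\<^sup>2))"
proof -
  let ?a = "taylor_coeff f"
  have circ: "ennreal (1 / (2 * pi)) * (\<integral>\<^sup>+t\<in>{0..2 * pi}. ennreal ((cmod (f (complex_of_real r * cis t)))\<^sup>2) \<partial>lborel)
     = (\<Sum>n. ennreal ((cmod (?a n))\<^sup>2 * r ^ (2 * n)))" if r: "r \<in> {0..<1}" for r
  proof -
    have sm: "summable (\<lambda>n. cmod (?a n * complex_of_real r ^ n))"
      using summable_norm_taylor[OF f, of "complex_of_real r"] r by auto
    have fe: "f (complex_of_real r * cis t) = (\<Sum>n. ?a n * complex_of_real r ^ n * cis (real n * t))" for t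
      using taylor_sums[OF f, of "complex_of_real r * cis t"] r
      by (simp add: sums_iff power_mult_distrib norm_mult Complex.DeMoivre mult.assoc)
    have "ennreal (1 / (2 * pi)) * (\<integral>\<^sup>+t\<in>{0..2 * pi}. ennreal ((cmod (f (complex_of_real r * cis t)))\<^sup>2) \<partial>lborel)
       = ennreal (1 / (2 * pi)) * (ennreal (2 * pi) * (\<Sum>n. ennreal ((cmod (?a n * complex_of_real r ^ n))\<^sup>2)))"
      unfolding fe nn_integral_circle_parseval[OF sm] by simp
    also have "\<dots> = (\<Sum>n. ennreal ((cmod (?a n * complex_of_real r ^ n))\<^sup>2))"
      by (subst mult.assoc[symmetric], subst ennreal_mult[symmetric]) auto
    also have "\<dots> = (\<Sum>n. ennreal ((cmod (?a n))\<^sup>2 * r ^ (2 * n)))"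
      using r by (simp add: norm_mult norm_power power_mult_distrib power_mult mult.commute flip: power_mult)
    finally show ?thesis .
  qed
  have "hardy_norm_sq f = (SUP r\<in>{0..<1}. \<Sum>n. ennreal ((cmod (?a n))\<^sup>2 * r ^ (2 * n)))"
    unfolding hardy_norm_sq_def by (intro SUP_cong circ refl)
  also have "\<dots> = (\<Sum>n. ennreal ((cmod (?a n))\<^sup>2))"
  proof (rule antisym)
    show "(SUP r\<in>{0..<1}. \<Sum>n. ennreal ((cmod (?a n))\<^sup>2 * r ^ (2 * n))) \<le> (\<Sum>n. ennreal ((cmod (?a n))\<^sup>2))"
      by (intro SUP_least suminf_le ennreal_leI) (auto simp: mult_left_le power_le_one)
    show "(\<Sum>n. ennreal ((cmod (?a n))\<^sup>2)) \<le> (SUP r\<in>{0..<1}. \<Sum>n. ennreal ((cmod (?a n))\<^sup>2 * r ^ (2 * n)))"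
      unfolding suminf_eq_SUP[of "\<lambda>n. ennreal ((cmod (?a n))\<^sup>2)"]
    proof (rule SUP_least)
      fix N
      define r where "r = (\<lambda>i::nat. 1 - inverse (real (Suc i)))"
      have r01: "r i \<in> {0..<1}" for i by (auto simp: r_def field_simps)
      have "r \<longlonglongrightarrow> 1 - 0" unfolding r_def by (intro tendsto_intros LIMSEQ_inverse_real_of_nat)
      hence "(\<lambda>i. \<Sum>n<N. ennreal ((cmod (?a n))\<^sup>2 * r i ^ (2 * n))) \<longlonglongrightarrow> (\<Sum>n<N. ennreal ((cmod (?a n))\<^sup>2 * (1 - 0) ^ (2 * n)))"
        by (intro tendsto_intros)
      moreover have "(\<Sum>n<N. ennreal ((cmod (?a n))\<^sup>2 * r i ^ (2 * n))) \<le> (SUP r\<in>{0..<1}. \<Sum>n. ennreal ((cmod (?a n))\<^sup>2 * r ^ (2 * n)))" for i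
        by (rule order_trans[OF _ SUP_upper[OF r01[of i]]]) (intro sum_le_suminf, auto)
      ultimately show "(\<Sum>n<N. ennreal ((cmod (?a n))\<^sup>2)) \<le> (SUP r\<in>{0..<1}. \<Sum>n. ennreal ((cmod (?a n))\<^sup>2 * r ^ (2 * n)))"
        by (intro LIMSEQ_le_const2) auto
    qed
  qed
  finally show ?thesis .
qed

lemma taylor_has_fps_expansion:
  "f holomorphic_on unit_disc \<Longrightarrow> f has_fps_expansion fps_expansion f 0"
  by (rule has_fps_expansion_fps_expansion[of unit_disc]) auto

lemma taylor_fps_mult:
  assumes "f holomorphic_on unit_disc" "g holomorphic_on unit_disc"
  shows "fps_expansion (\<lambda>z. f z * g z) 0 = fps_expansion f 0 * fps_expansion g 0"
  by (intro fps_expansion_eqI has_fps_expansion_mult taylor_has_fps_expansion assms)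

lemma taylor_coeff_higher_deriv:
  "taylor_coeff ((deriv ^^ k) f) n = of_real (fact (n + k) / fact n) * taylor_coeff f (n + k)"
  by (simp add: fps_expansion_def funpow_add)

lemma holomorphic_on_affine: "(\<lambda>z. c + d * z :: complex) holomorphic_on A"
  by (intro holomorphic_intros)

lemma taylor_fps_linear: "fps_expansion (\<lambda>z. c + d * z) 0 = fps_const c + fps_const d * fps_X"
  by (intro fps_expansion_eqI fps_expansion_intros)

lemma taylor_fps_cong:
  assumes "\<And>z. z \<in> unit_disc \<Longrightarrow> f z = g z"
  shows "fps_expansion f 0 = fps_expansion g 0"
proof (rule fps_expansion_cong)
  have "eventually (\<lambda>z. z \<in> unit_disc) (nhds (0::complex))"
    by (rule eventually_nhds_in_open) auto
  thus "eventually (\<lambda>z. f z = g z) (nhds 0)" by eventually_elim (rule assms)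
qed

section \<open>Weighted area integrals of holomorphic functions\<close>

lemma sets_unit_disc [measurable]: "unit_disc \<in> sets borel"
  by simp

lemma sets_area_measure [simp, measurable_cong]: "sets area_measure = sets borel"
  by (simp add: area_measure_def)

lemma space_area_measure [simp]: "space area_measure = UNIV"
  by (simp add: area_measure_def space_scale_measure)

lemma nn_integral_area_measure:
  assumes "h \<in> borel_measurable borel"
  shows "(\<integral>\<^sup>+z. h z \<partial>area_measure) = ennreal (1 / pi) * (\<integral>\<^sup>+z. h z \<partial>lborel)"
  unfolding area_measure_def using assms by (subst nn_integral_scale_measure) auto

lemma emeasure_area_measure: "emeasure area_measure A = ennreal (1 / pi) * emeasure lborel A"
  by (simp add: area_measure_def)

lemma sigma_finite_area_measure: "sigma_finite_measure area_measure"
proof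
  have "countable (range (\<lambda>n. cball (0::complex) (real n)))" by simp
  moreover have "emeasure area_measure (cball 0 (real n)) \<noteq> \<infinity>" for n
    using emeasure_bounded_finite[OF bounded_cball, of "0::complex" "real n"]
    by (simp add: emeasure_area_measure ennreal_mult_eq_top_iff)
  moreover have "\<Union> (range (\<lambda>n. cball (0::complex) (real n))) = UNIV"
  proof -
    have "\<exists>n. z \<in> cball 0 (real n)" for z :: complex
      using real_arch_simple[of "norm z"] by auto
    thus ?thesis by blast
  qed
  ultimately show "\<exists>A. countable A \<and> A \<subseteq> sets area_measure \<and> \<Union> A = space area_measure \<and> (\<forall>a\<in>A. emeasure area_measure a \<noteq> \<infinity>)"
    by (intro exI[of _ "range (\<lambda>n. cball (0::complex) (real n))"]) auto
qed

lemma emeasure_area_ball: "r \<ge> 0 \<Longrightarrow> emeasure area_measure (ball 0 r) = ennreal (r\<^sup>2)"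
  by (simp add: emeasure_area_measure emeasure_ball unit_ball_vol_2 flip: ennreal_mult)

lemma emeasure_area_cball: "r \<ge> 0 \<Longrightarrow> emeasure area_measure (cball 0 r) = ennreal (r\<^sup>2)"
  by (simp add: emeasure_area_measure emeasure_cball unit_ball_vol_2 flip: ennreal_mult)

text \<open>
  For normalized area on the disc, \<open>(cmod z)\<^sup>2\<close> is uniformly distributed on the unit interval, because a
  disc of radius \<open>r\<close> has normalized area \<open>r\<^sup>2\<close>.
\<close>

lemma nn_integral_disc_radial:
  assumes h [measurable]: "h \<in> borel_measurable borel"
  shows "(\<integral>\<^sup>+z\<in>unit_disc. h ((cmod z)\<^sup>2) \<partial>area_measure) = (\<integral>\<^sup>+t\<in>{0..1}. h t \<partial>lborel)"
proof -
  define M where "M = distr (density area_measure (indicator unit_disc :: complex \<Rightarrow> ennreal)) borel (\<lambda>z. (cmod z)\<^sup>2)"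
  define N where "N = density lborel (indicator {0..1::real} :: real \<Rightarrow> ennreal)"
  have M: "emeasure M {x<..} = emeasure area_measure (unit_disc \<inter> {z. x < (cmod z)\<^sup>2})" for x
  proof -
    have "emeasure M {x<..} = emeasure (density area_measure (indicator unit_disc)) {z. x < (cmod z)\<^sup>2}"
      unfolding M_def by (subst emeasure_distr) (auto simp: vimage_def)
    also have "\<dots> = emeasure area_measure (unit_disc \<inter> {z. x < (cmod z)\<^sup>2})"
      by (subst emeasure_density) (auto simp flip: indicator_inter_arith)
    finally show ?thesis .
  qed
  have N: "emeasure N {x<..} = emeasure lborel ({0..1} \<inter> {x<..})" for x
    unfolding N_def by (subst emeasure_density) (auto simp flip: indicator_inter_arith)
  have "M = N"
  proof (rule measure_eqI_lessThan)
    show "sets M = sets borel" "sets N = sets borel" by (simp_all add: M_def N_def)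
    have fin: "emeasure area_measure unit_disc = 1"
      using emeasure_area_ball[of 1] by simp
    fix x :: real
    have "emeasure M {x<..} \<le> 1"
      unfolding M fin[symmetric] by (intro emeasure_mono) auto
    thus "emeasure M {x<..} < \<infinity>"
      by (metis ennreal_one_less_top infinity_ennreal_def order_le_less_trans)
    consider "x < 0" | "0 \<le> x" "x < 1" | "1 \<le> x" by linarith
    thus "emeasure M {x<..} = emeasure N {x<..}"
    proof cases
      case 1
      hence "unit_disc \<inter> {z. x < (cmod z)\<^sup>2} = unit_disc" "{0..1} \<inter> {x<..} = {0..1}"
        by (auto intro: less_le_trans)
      thus ?thesis unfolding M N by (simp add: fin)
    next
      case 2
      have sq: "(cmod z)\<^sup>2 \<le> x \<longleftrightarrow> cmod z \<le> sqrt x" for z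
        using 2 by (metis abs_norm_cancel real_sqrt_abs real_sqrt_le_iff)
      have sq': "x < (cmod z)\<^sup>2 \<longleftrightarrow> sqrt x < cmod z" for z
        using sq[of z] by linarith
      have s1: "sqrt x < 1" using 2 by simp
      have "unit_disc \<inter> {z. x < (cmod z)\<^sup>2} = unit_disc - cball 0 (sqrt x)"
        by (auto simp: sq')
      moreover have "emeasure area_measure (unit_disc - cball 0 (sqrt x)) = 1 - ennreal x"
        using 2 le_less_trans[OF _ s1] by (subst emeasure_Diff) (auto simp: fin emeasure_area_cball)
      moreover have "{0..1} \<inter> {x<..} = {x<..1}" using 2 by auto
      ultimately show ?thesis unfolding M N using 2
        by (simp add: ennreal_minus flip: ennreal_1)
    next
      case 3
      have "unit_disc \<inter> {z. x < (cmod z)\<^sup>2} = {}"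
      proof -
        have "(cmod z)\<^sup>2 \<le> 1" if "cmod z < 1" for z
          using that by (simp add: power_le_one)
        thus ?thesis using 3 by force
      qed
      moreover have "{0..1} \<inter> {x<..} = {}" using 3 by auto
      ultimately show ?thesis unfolding M N by simp
    qed
  qed
  hence "(\<integral>\<^sup>+t. h t \<partial>M) = (\<integral>\<^sup>+t. h t \<partial>N)" by simp
  thus ?thesis unfolding M_def N_def
    by (subst (asm) nn_integral_distr, simp, simp, subst (asm) nn_integral_density, simp, simp)
       (subst (asm) nn_integral_density, auto simp: mult.commute)
qed

lemma nn_integral_beta_fact:
  "(\<integral>\<^sup>+t\<in>{0..1::real}. ennreal (t ^ n * (1 - t) ^ q) \<partial>lborel) = ennreal (fact n * fact q / fact (n + q + 1))"
proof -
  have "((\<lambda>t. t powr (real (Suc n) - 1) * (1 - t) powr (real (Suc q) - 1)) has_integral Beta (real (Suc n)) (real (Suc q))) {0<..<1}"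
    using has_integral_Beta_real[of "real (Suc n)" "real (Suc q)"] by (simp add: has_integral_Icc_iff_Ioo)
  hence "((\<lambda>t. t ^ n * (1 - t) ^ q) has_integral Beta (real (Suc n)) (real (Suc q))) {0<..<1}"
    by (rule has_integral_eq[rotated]) (auto simp: powr_realpow)
  also have "Beta (real (Suc n)) (real (Suc q)) = fact n * fact q / fact (n + q + 1)"
    using Gamma_fact[of n, where 'a=real] Gamma_fact[of q, where 'a=real] Gamma_fact[of "n+q+1", where 'a=real]
    by (simp add: Beta_def add_ac)
  finally have "((\<lambda>t. t ^ n * (1 - t) ^ q) has_integral (fact n * fact q / fact (n + q + 1))) {0..1::real}"
    by (simp add: has_integral_Icc_iff_Ioo)
  from nn_integral_has_integral_lebesgue[OF _ this]
  show ?thesis by (simp add: indicator_mult_ennreal mult.commute)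
qed

text \<open>
  The squared norm of a weighted Bergman space, without its usual normalization.
\<close>

definition bergman :: "nat \<Rightarrow> (complex \<Rightarrow> complex) \<Rightarrow> ennreal" where
  "bergman q F = (\<integral>\<^sup>+z\<in>unit_disc. ennreal ((cmod (F z))\<^sup>2 * (1 - (cmod z)\<^sup>2) ^ q) \<partial>area_measure)"

lemma borel_measurable_on_disc:
  fixes F :: "complex \<Rightarrow> 'a::real_normed_vector"
  assumes "continuous_on unit_disc F"
  shows "(\<lambda>z. if z \<in> unit_disc then F z else 0) \<in> borel_measurable borel"
  by (intro borel_measurable_continuous_on_if assms) auto

lemma nn_integral_disc_rotate:
  assumes [measurable]: "H \<in> borel_measurable borel"
  shows "(\<integral>\<^sup>+z\<in>unit_disc. H (cis t * z) \<partial>area_measure) = (\<integral>\<^sup>+z\<in>unit_disc. H z \<partial>area_measure)"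
proof -
  have img: "(\<lambda>z. cis t * z) ` unit_disc = unit_disc"
  proof (intro equalityI subsetI)
    fix w assume "w \<in> unit_disc"
    hence "w = cis t * (cis (-t) * w)" "cis (-t) * w \<in> unit_disc"
      by (auto simp: norm_mult cis_mult simp flip: mult.assoc)
    thus "w \<in> (\<lambda>z. cis t * z) ` unit_disc" by blast
  qed (auto simp: norm_mult)
  have d: "deriv (\<lambda>z. cis t * z) z = cis t" for z
    by (rule DERIV_imp_deriv) (auto intro!: derivative_eq_intros)
  have "(\<integral>\<^sup>+w\<in>(\<lambda>z. cis t * z) ` unit_disc. H w \<partial>lborel)
      = (\<integral>\<^sup>+z\<in>unit_disc. H (cis t * z) * ennreal ((cmod (deriv (\<lambda>z. cis t * z) z))\<^sup>2) \<partial>lborel)"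
    by (rule nn_integral_holomorphic_substitution) (auto intro!: holomorphic_intros inj_onI)
  moreover have "(\<lambda>z. H (cis t * z) * indicator unit_disc z) \<in> borel_measurable borel" by measurable
  ultimately show ?thesis unfolding img d by (simp add: nn_integral_area_measure)
qed

text \<open>
  Averaging the integrand over all rotations of the disc turns the angular integral into the one of
  \<open>nn_integral_circle_parseval\<close>; the radial moments that remain are Beta integrals.
\<close>

theorem bergman_parseval:
  assumes F: "F holomorphic_on unit_disc"
  shows "bergman q F = (\<Sum>n. ennreal (fact n * fact q / fact (n + q + 1) * (cmod (taylor_coeff F n))\<^sup>2))"
proof -
  let ?a = "taylor_coeff F"
  define F' where "F' z = (if z \<in> unit_disc then F z else 0)" for z
  have [measurable]: "F' \<in> borel_measurable borel"
    unfolding F'_def by (intro borel_measurable_on_disc holomorphic_on_imp_continuous_on F)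
  interpret A: sigma_finite_measure area_measure by (rule sigma_finite_area_measure)
  interpret P: pair_sigma_finite area_measure "lborel :: real measure"
    by unfold_locales
  define W where "W z = ennreal ((1 - (cmod z)\<^sup>2) ^ q) * indicator unit_disc z" for z
  have [measurable]: "W \<in> borel_measurable borel" unfolding W_def by measurable
  have circ: "(\<integral>\<^sup>+t\<in>{0..2 * pi}. ennreal ((cmod (F' (cis t * z)))\<^sup>2) \<partial>lborel)
     = ennreal (2 * pi) * (\<Sum>n. ennreal ((cmod (?a n))\<^sup>2 * ((cmod z)\<^sup>2) ^ n))" if z: "z \<in> unit_disc" for z
  proof -
    have sm: "summable (\<lambda>n. cmod (?a n * z ^ n))"
      using summable_norm_taylor[OF F] z by auto
    have "F' (cis t * z) = (\<Sum>n. ?a n * z ^ n * cis (real n * t))" for t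
      using taylor_sums[OF F, of "cis t * z"] z
      by (simp add: F'_def sums_iff power_mult_distrib norm_mult Complex.DeMoivre mult_ac)
    hence "(\<integral>\<^sup>+t\<in>{0..2 * pi}. ennreal ((cmod (F' (cis t * z)))\<^sup>2) \<partial>lborel)
        = (\<integral>\<^sup>+t\<in>{0..2 * pi}. ennreal ((cmod (\<Sum>n. ?a n * z ^ n * cis (real n * t)))\<^sup>2) \<partial>lborel)"
      by (simp only:)
    also have "\<dots> = ennreal (2 * pi) * (\<Sum>n. ennreal ((cmod (?a n * z ^ n))\<^sup>2))"
      by (rule nn_integral_circle_parseval[OF sm])
    finally show ?thesis
      by (simp add: norm_mult norm_power power_mult_distrib mult.commute flip: power_mult)
  qed
  have "ennreal (2 * pi) * bergman q F = (\<integral>\<^sup>+t\<in>{0..2 * pi}. (\<integral>\<^sup>+z. ennreal ((cmod (F' z))\<^sup>2) * W z \<partial>area_measure) \<partial>lborel)"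
  proof -
    have "bergman q F = (\<integral>\<^sup>+z. ennreal ((cmod (F' z))\<^sup>2) * W z \<partial>area_measure)"
      unfolding bergman_def by (intro nn_integral_cong)
        (auto simp: W_def F'_def indicator_def ennreal_mult power_le_one)
    thus ?thesis by (subst nn_integral_cmult_indicator) (auto simp: mult.commute)
  qed
  also have "\<dots> = (\<integral>\<^sup>+t. (\<integral>\<^sup>+z. ennreal ((cmod (F' (cis t * z)))\<^sup>2) * W z * indicator {0..2 * pi} t \<partial>area_measure) \<partial>lborel)"
  proof (intro nn_integral_cong)
    fix t :: real
    have "(\<integral>\<^sup>+z. ennreal ((cmod (F' z))\<^sup>2) * W z \<partial>area_measure) = (\<integral>\<^sup>+z\<in>unit_disc. (ennreal ((cmod (F' z))\<^sup>2) * W z) \<partial>area_measure)"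
      by (intro nn_integral_cong) (auto simp: W_def indicator_def)
    also have "\<dots> = (\<integral>\<^sup>+z\<in>unit_disc. (ennreal ((cmod (F' (cis t * z)))\<^sup>2) * W (cis t * z)) \<partial>area_measure)"
      by (rule nn_integral_disc_rotate[symmetric]) measurable
    also have "\<dots> = (\<integral>\<^sup>+z. ennreal ((cmod (F' (cis t * z)))\<^sup>2) * W z \<partial>area_measure)"
      by (intro nn_integral_cong) (auto simp: W_def indicator_def norm_mult)
    finally show "(\<integral>\<^sup>+z. ennreal ((cmod (F' z))\<^sup>2) * W z \<partial>area_measure) * indicator {0..2 * pi} t
       = (\<integral>\<^sup>+z. ennreal ((cmod (F' (cis t * z)))\<^sup>2) * W z * indicator {0..2 * pi} t \<partial>area_measure)"
      by (subst nn_integral_multc) auto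
  qed
  also have "\<dots> = (\<integral>\<^sup>+z. (\<integral>\<^sup>+t. ennreal ((cmod (F' (cis t * z)))\<^sup>2) * W z * indicator {0..2 * pi} t \<partial>lborel) \<partial>area_measure)"
  proof (rule P.Fubini'[of "\<lambda>z t. ennreal ((cmod (F' (cis t * z)))\<^sup>2) * W z * indicator {0..2 * pi} t"])
    have [measurable]: "cis \<in> borel_measurable borel"
      by (intro borel_measurable_continuous_onI continuous_intros)
    show "(\<lambda>(z, t). ennreal ((cmod (F' (cis t * z)))\<^sup>2) * W z * indicator {0..2 * pi} t) \<in> borel_measurable (area_measure \<Otimes>\<^sub>M lborel)"
      by measurable
  qed
  also have "\<dots> = (\<integral>\<^sup>+z. (\<Sum>n. ennreal (2 * pi) * ennreal ((cmod (?a n))\<^sup>2) * (ennreal (((cmod z)\<^sup>2) ^ n * (1 - (cmod z)\<^sup>2) ^ q) * indicator unit_disc z)) \<partial>area_measure)"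
  proof (intro nn_integral_cong)
    fix z :: complex
    have [measurable]: "cis \<in> borel_measurable borel"
      by (intro borel_measurable_continuous_onI continuous_intros)
    have "(\<integral>\<^sup>+t. ennreal ((cmod (F' (cis t * z)))\<^sup>2) * W z * indicator {0..2 * pi} t \<partial>lborel)
      = W z * (\<integral>\<^sup>+t\<in>{0..2 * pi}. ennreal ((cmod (F' (cis t * z)))\<^sup>2) \<partial>lborel)"
      by (subst nn_integral_cmult[symmetric]) (auto simp: mult_ac)
    also have "\<dots> = (\<Sum>n. ennreal (2 * pi) * ennreal ((cmod (?a n))\<^sup>2) * (ennreal (((cmod z)\<^sup>2) ^ n * (1 - (cmod z)\<^sup>2) ^ q) * indicator unit_disc z))"
    proof (cases "z \<in> unit_disc")
      case True
      hence "(cmod z)\<^sup>2 \<le> 1" by (simp add: power_le_one)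
      hence e: "ennreal (((cmod z)\<^sup>2) ^ n * (1 - (cmod z)\<^sup>2) ^ q) = ennreal (((cmod z)\<^sup>2) ^ n) * ennreal ((1 - (cmod z)\<^sup>2) ^ q)" for n
        by (intro ennreal_mult) auto
      have e': "ennreal ((cmod (?a n))\<^sup>2 * ((cmod z)\<^sup>2) ^ n) = ennreal ((cmod (?a n))\<^sup>2) * ennreal (((cmod z)\<^sup>2) ^ n)" for n
        by (intro ennreal_mult) auto
      show ?thesis using True
        unfolding circ[OF True] W_def e e'
        by (simp add: ennreal_suminf_cmult[symmetric] ac_simps del: ennreal_suminf_cmult)
    qed (simp add: W_def)
    finally show "(\<integral>\<^sup>+t. ennreal ((cmod (F' (cis t * z)))\<^sup>2) * W z * indicator {0..2 * pi} t \<partial>lborel)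
      = (\<Sum>n. ennreal (2 * pi) * ennreal ((cmod (?a n))\<^sup>2) * (ennreal (((cmod z)\<^sup>2) ^ n * (1 - (cmod z)\<^sup>2) ^ q) * indicator unit_disc z))" .
  qed
  also have "\<dots> = (\<Sum>n. ennreal (2 * pi) * ennreal ((cmod (?a n))\<^sup>2) * (\<integral>\<^sup>+z\<in>unit_disc. ennreal (((cmod z)\<^sup>2) ^ n * (1 - (cmod z)\<^sup>2) ^ q) \<partial>area_measure))"
    by (subst nn_integral_suminf) (auto simp: nn_integral_cmult)
  also have "\<dots> = (\<Sum>n. ennreal (2 * pi) * ennreal ((cmod (?a n))\<^sup>2) * ennreal (fact n * fact q / fact (n + q + 1)))"
    by (subst nn_integral_disc_radial[where h = "\<lambda>t. ennreal (t ^ _ * (1 - t) ^ q)"]) (auto simp: nn_integral_beta_fact)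
  also have "\<dots> = ennreal (2 * pi) * (\<Sum>n. ennreal (fact n * fact q / fact (n + q + 1) * (cmod (?a n))\<^sup>2))"
  proof -
    have "ennreal ((cmod (?a n))\<^sup>2) * ennreal (fact n * fact q / fact (n + q + 1))
        = ennreal (fact n * fact q / fact (n + q + 1) * (cmod (?a n))\<^sup>2)" for n
      by (subst ennreal_mult'[symmetric]) (simp_all only: mult.commute zero_le_power2)
    thus ?thesis by (simp only: mult.assoc ennreal_suminf_cmult)
  qed
  finally show ?thesis
    by (subst (asm) ennreal_mult_cancel_left) auto
qed

section \<open>The potential as a superposition of local kernels\<close>

text \<open>
  The right hand side is \<open>a ^ m\<close> times the remainder of \<open>ln (1 + b / a)\<close> after \<open>m\<close> Taylor terms, up to
  sign. Expanding in powers of \<open>b / (a + b)\<close> rather than \<open>b / a\<close> gives convergence for all \<open>a > 0\<close> and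
  positive terms. Both sides satisfy \<open>R (m + 1) = - a R m + b ^ (m + 1) / (m + 1)\<close>; for the series this
  follows from \<open>- a = b - (a + b)\<close> and from the fact that the Beta coefficients
  \<open>\<beta> m i = m! i! / (m + 1 + i)!\<close> satisfy \<open>\<beta> m i - \<beta> m (i + 1) = \<beta> (m + 1) i\<close>.
\<close>

lemma log_remainder_series:
  fixes a b :: real
  assumes a: "a > 0" and b: "b \<ge> 0"
  shows "(\<lambda>i. fact m * fact i / fact (Suc m + i) * b ^ (Suc m + i) / (a + b) ^ Suc i) sums
           ((-1) ^ m * (a ^ m * ln (1 + b / a) + (\<Sum>l = 1..m. (-1) ^ l / real l * a ^ (m - l) * b ^ l)))"
proof (induction m)
  case 0
  define y where "y = b / (a + b)"
  have y: "0 \<le> y" "y < 1" using a b by (auto simp: y_def)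
  have "(\<lambda>n. - ((- (- y)) ^ n) / real n) sums ln (1 + - y)"
    using y by (intro ln_series') auto
  hence "(\<lambda>n. y ^ n / real n) sums - ln (1 - y)"
    using sums_minus by fastforce
  hence "(\<lambda>n. y ^ Suc n / real (Suc n)) sums - ln (1 - y)"
    using sums_Suc_iff[of "\<lambda>n. y ^ n / real n" "- ln (1 - y)"] by simp
  moreover have "- ln (1 - y) = ln (1 + b / a)"
  proof -
    have "1 - y = inverse (1 + b / a)" using a b by (simp add: y_def field_simps)
    thus ?thesis using a b by (simp add: ln_inverse)
  qed
  moreover have "y ^ Suc i / real (Suc i) = fact 0 * fact i / fact (Suc 0 + i) * b ^ (Suc 0 + i) / (a + b) ^ Suc i" for i
  proof -
    have "fact 0 * fact i / fact (Suc 0 + i) = 1 / real (Suc i)" by simp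
    thus ?thesis by (simp add: y_def power_divide del: fact_Suc power_Suc of_nat_Suc)
  qed
  ultimately show ?case by simp
next
  case (Suc m)
  define c where "c = a + b"
  have c: "c > 0" using a b by (simp add: c_def)
  define t where "t m i = fact m * fact i / fact (Suc m + i) * b ^ (Suc m + i) / c ^ Suc i" for m i
  define R where "R m = (-1) ^ m * (a ^ m * ln (1 + b / a) + (\<Sum>l = 1..m. (-1) ^ l / real l * a ^ (m - l) * b ^ l))" for m
  have S: "t m sums R m" using Suc.IH unfolding t_def R_def c_def .
  have rec: "t (Suc m) i = b * t m i - c * t m (Suc i)" for i
  proof -
    have f1: "fact (Suc (Suc m) + i) = (real m + real i + 2) * (fact (Suc m + i) :: real)"
      by (simp add: algebra_simps)
    have beta: "fact (Suc m) * fact i / fact (Suc (Suc m) + i)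
       = fact m * fact i / fact (Suc m + i) - (fact m * fact (Suc i) / fact (Suc m + Suc i) :: real)"
      unfolding add_Suc_right[of "Suc m"] add_Suc[of "Suc m", symmetric] f1
      by (simp add: divide_simps del: fact_Suc) (simp add: algebra_simps)
    have "t (Suc m) i = (fact (Suc m) * fact i / fact (Suc (Suc m) + i)) * (b ^ (Suc (Suc m) + i) / c ^ Suc i)"
      by (simp add: t_def)
    also have "\<dots> = (fact m * fact i / fact (Suc m + i)) * (b ^ (Suc (Suc m) + i) / c ^ Suc i)
         - (fact m * fact (Suc i) / fact (Suc m + Suc i)) * (b ^ (Suc (Suc m) + i) / c ^ Suc i)"
      unfolding beta by (simp only: left_diff_distrib)
    also have "(fact m * fact i / fact (Suc m + i)) * (b ^ (Suc (Suc m) + i) / c ^ Suc i) = b * t m i"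
      by (simp add: t_def)
    also have "(fact m * fact (Suc i) / fact (Suc m + Suc i)) * (b ^ (Suc (Suc m) + i) / c ^ Suc i) = c * t m (Suc i)"
      using c by (simp add: t_def del: fact_Suc)
    finally show ?thesis .
  qed
  have "(\<lambda>i. t m (Suc i)) sums (R m - t m 0)"
    using S by (subst sums_Suc_iff) simp
  hence "(\<lambda>i. b * t m i - c * t m (Suc i)) sums (b * R m - c * (R m - t m 0))"
    by (intro sums_diff sums_mult S)
  also have "(\<lambda>i. b * t m i - c * t m (Suc i)) = t (Suc m)"
    by (rule ext) (simp only: rec)
  also have "b * R m - c * (R m - t m 0) = - a * R m + b ^ Suc m / real (Suc m)"
  proof -
    have "(fact m :: real) / fact (Suc m) = 1 / real (Suc m)" by simp
    hence t0: "c * t m 0 = b ^ Suc m / real (Suc m)"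
      using c by (simp add: t_def del: power_Suc fact_Suc of_nat_Suc)
    show ?thesis
      unfolding right_diff_distrib t0 by (simp add: c_def algebra_simps)
  qed
  also have "\<dots> = R (Suc m)"
  proof -
    have "(\<Sum>l = 1..Suc m. (-1) ^ l / real l * a ^ (Suc m - l) * b ^ l)
      = a * (\<Sum>l = 1..m. (-1) ^ l / real l * a ^ (m - l) * b ^ l) + (-1) ^ Suc m / real (Suc m) * b ^ Suc m"
      by (simp add: sum_distrib_left Suc_diff_le mult_ac)
    hence "R (Suc m) = (-1) ^ Suc m * (a * (a ^ m * ln (1 + b / a) + (\<Sum>l = 1..m. (-1) ^ l / real l * a ^ (m - l) * b ^ l))
        + (-1) ^ Suc m / real (Suc m) * b ^ Suc m)"
      unfolding R_def by (simp add: algebra_simps)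
    also have "\<dots> = - a * R m + ((-1) ^ Suc m * (-1) ^ Suc m) * (b ^ Suc m / real (Suc m))"
      unfolding R_def by (simp add: algebra_simps)
    also have "(-1::real) ^ Suc m * (-1) ^ Suc m = 1"
      by (simp flip: power_mult_distrib)
    finally show ?thesis by simp
  qed
  finally show ?case unfolding t_def R_def c_def .
qed

text \<open>
  Each term is a radial weight in \<open>z\<close> times the squared modulus of a function holomorphic in \<open>z\<close>, so
  its integral against \<open>(cmod ((deriv ^^ k) f z))\<^sup>2\<close> can be read off from Taylor coefficients. For \<open>\<zeta>\<close>
  on the circle the factor \<open>0 ^ i\<close> leaves only the term \<open>i = 0\<close>.
\<close>

definition kernel_term :: "nat \<Rightarrow> complex \<Rightarrow> complex \<Rightarrow> nat \<Rightarrow> real" where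
  "kernel_term k z \<zeta> i = fact i / (fact (k - 1) * fact (k + i)) * (1 - (cmod \<zeta>)\<^sup>2) ^ i
     * ((1 - (cmod z)\<^sup>2) ^ (k + i) / (cmod (1 - cnj \<zeta> * z)) ^ (2 * Suc i))"

definition local_kernel :: "nat \<Rightarrow> complex \<Rightarrow> complex \<Rightarrow> ennreal" where
  "local_kernel k z \<zeta> = (\<Sum>i. ennreal (kernel_term k z \<zeta> i))"

text \<open>
  The integrand of \<open>U_pot\<close>, with the integrals over the disc and over the circle merged into one.
\<close>

definition potential_kernel :: "nat \<Rightarrow> complex \<Rightarrow> complex \<Rightarrow> ennreal" where
  "potential_kernel k z \<zeta> =
     ennreal (1 / (fact (k - 1))\<^sup>2) *
       (ennreal ((-1) ^ (k + 1) * G_ker k z \<zeta> / (1 - (cmod \<zeta>)\<^sup>2) ^ k) * indicator unit_disc \<zeta>)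
     + ennreal (1 / (fact k * fact (k - 1))) *
       (ennreal ((1 - (cmod z)\<^sup>2) ^ k / (cmod (z - \<zeta>))\<^sup>2) * indicator unit_circle \<zeta>)"

lemma one_minus_cnj_mult_nonzero:
  assumes "cmod \<zeta> \<le> 1" "cmod z < 1"
  shows "1 - cnj \<zeta> * z \<noteq> 0"
proof
  assume "1 - cnj \<zeta> * z = 0"
  hence "cmod \<zeta> * cmod z = 1" by (metis complex_mod_cnj eq_iff_diff_eq_0 norm_mult norm_one)
  moreover have "cmod \<zeta> * cmod z \<le> cmod z" using assms by (simp add: mult_left_le_one_le)
  ultimately show False using assms by simp
qed

lemma norm_sq_one_minus_cnj_mult:
  "(cmod (1 - cnj \<zeta> * z))\<^sup>2 = (cmod (\<zeta> - z))\<^sup>2 + (1 - (cmod \<zeta>)\<^sup>2) * (1 - (cmod z)\<^sup>2)"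
  unfolding cmod_power2 by (simp add: algebra_simps power2_eq_square)

lemma kernel_term_nonneg: "cmod z < 1 \<Longrightarrow> cmod \<zeta> \<le> 1 \<Longrightarrow> 0 \<le> kernel_term k z \<zeta> i"
  by (simp add: kernel_term_def power_le_one)

text \<open>
  With \<open>a = (cmod (\<zeta> - z))\<^sup>2\<close> and \<open>b = (1 - (cmod \<zeta>)\<^sup>2) * (1 - (cmod z)\<^sup>2)\<close> one has
  \<open>a + b = (cmod (1 - cnj \<zeta> * z))\<^sup>2\<close>, so \<open>log_remainder_series\<close> expands \<open>G_ker\<close>. It contains the factor
  \<open>b ^ k\<close>, and division by \<open>(1 - (cmod \<zeta>)\<^sup>2) ^ k\<close> leaves a kernel that makes sense up to the circle,
  where it reduces to the Poisson-type kernel in the definition of \<open>U_pot\<close>.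
\<close>

lemma potential_kernel_eq_local_kernel:
  assumes k: "k \<ge> 1" and z: "cmod z < 1" and \<zeta>: "cmod \<zeta> \<le> 1" and ne: "z \<noteq> \<zeta>"
  shows "potential_kernel k z \<zeta> = local_kernel k z \<zeta>"
proof (cases "cmod \<zeta> < 1")
  case True
  obtain m where m: "k = Suc m" using k by (cases k) auto
  define a where "a = (cmod (\<zeta> - z))\<^sup>2"
  define T where "T = 1 - (cmod \<zeta>)\<^sup>2"
  define s where "s = 1 - (cmod z)\<^sup>2"
  have a: "a > 0" using ne by (simp add: a_def)
  have T: "T > 0" using True by (simp add: T_def power_less_one_iff abs_square_less_1)
  have s: "s > 0" using z by (simp add: s_def power_less_one_iff abs_square_less_1)
  have ab: "(cmod (1 - cnj \<zeta> * z))\<^sup>2 = a + T * s"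
    by (simp add: norm_sq_one_minus_cnj_mult a_def T_def s_def)
  have G: "(-1) ^ (k + 1) * G_ker k z \<zeta> = (-1) ^ m * (a ^ m * ln (1 + T * s / a) + (\<Sum>l = 1..m. (-1) ^ l / real l * a ^ (m - l) * (T * s) ^ l))"
  proof -
    have "(cmod ((1 - z * cnj \<zeta>) / (\<zeta> - z)))\<^sup>2 = 1 + T * s / a"
      using a ab by (simp add: norm_divide power_divide a_def mult.commute field_simps)
    thus ?thesis unfolding G_ker_def m
      by (simp add: a_def[symmetric] T_def[symmetric] s_def[symmetric] power_mult power_mult_distrib mult.assoc)
  qed
  have "(\<lambda>i. fact m * fact i / fact (Suc m + i) * (T * s) ^ (Suc m + i) / (a + T * s) ^ Suc i) sums ((-1) ^ (k + 1) * G_ker k z \<zeta>)"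
    unfolding G using a T s by (intro log_remainder_series) auto
  hence "(\<lambda>i. 1 / ((fact m)\<^sup>2 * T ^ k) * (fact m * fact i / fact (Suc m + i) * (T * s) ^ (Suc m + i) / (a + T * s) ^ Suc i))
     sums (1 / ((fact m)\<^sup>2 * T ^ k) * ((-1) ^ (k + 1) * G_ker k z \<zeta>))"
    by (rule sums_mult)
  also have "(\<lambda>i. 1 / ((fact m)\<^sup>2 * T ^ k) * (fact m * fact i / fact (Suc m + i) * (T * s) ^ (Suc m + i) / (a + T * s) ^ Suc i))
     = kernel_term k z \<zeta>"
  proof
    fix i
    show "1 / ((fact m)\<^sup>2 * T ^ k) * (fact m * fact i / fact (Suc m + i) * (T * s) ^ (Suc m + i) / (a + T * s) ^ Suc i)
        = kernel_term k z \<zeta> i"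
      using T unfolding kernel_term_def power_mult ab T_def[symmetric] s_def[symmetric]
      by (simp add: m power_mult_distrib power_add power2_eq_square mult_ac del: fact_Suc)
  qed
  finally have sums: "kernel_term k z \<zeta> sums (1 / ((fact m)\<^sup>2 * T ^ k) * ((-1) ^ (k + 1) * G_ker k z \<zeta>))" .
  have "local_kernel k z \<zeta> = ennreal (1 / ((fact m)\<^sup>2 * T ^ k) * ((-1) ^ (k + 1) * G_ker k z \<zeta>))"
    unfolding local_kernel_def using sums kernel_term_nonneg[OF z \<zeta>]
    by (subst suminf_ennreal2) (auto simp: sums_iff)
  also have "\<dots> = ennreal (1 / (fact m)\<^sup>2) * ennreal ((-1) ^ (k + 1) * G_ker k z \<zeta> / T ^ k)"
    by (subst ennreal_mult'[symmetric]) auto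
  also have "\<dots> = potential_kernel k z \<zeta>"
    using True by (simp add: potential_kernel_def m T_def)
  finally show ?thesis ..
next
  case False
  hence c: "cmod \<zeta> = 1" using \<zeta> by simp
  obtain m where m: "k = Suc m" using k by (cases k) auto
  have "local_kernel k z \<zeta> = (\<Sum>i\<in>{0}. ennreal (kernel_term k z \<zeta> i))"
    unfolding local_kernel_def by (rule suminf_finite) (auto simp: kernel_term_def c power_0_left)
  also have "\<dots> = ennreal (1 / (fact k * fact (k - 1))) * ennreal ((1 - (cmod z)\<^sup>2) ^ k / (cmod (z - \<zeta>))\<^sup>2)"
    using norm_sq_one_minus_cnj_mult[of \<zeta> z]
    by (simp add: kernel_term_def c norm_minus_commute mult.commute flip: ennreal_mult')
  also have "\<dots> = potential_kernel k z \<zeta>"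
    using c by (simp add: potential_kernel_def)
  finally show ?thesis ..
qed

text \<open>
  The energy \<open>D_int\<close> for the unit point mass at \<open>\<zeta>\<close>.
\<close>

definition local_dirichlet :: "complex \<Rightarrow> nat \<Rightarrow> (complex \<Rightarrow> complex) \<Rightarrow> ennreal" where
  "local_dirichlet \<zeta> k f =
     (\<integral>\<^sup>+z\<in>unit_disc. ennreal ((cmod ((deriv ^^ k) f z))\<^sup>2) * local_kernel k z \<zeta> \<partial>area_measure)"

lemma measurable_cnj [measurable]: "cnj \<in> borel_measurable borel"
  by (intro borel_measurable_continuous_onI continuous_intros)

lemma measurable_local_kernel [measurable]:
  "(\<lambda>(z, \<zeta>). local_kernel k z \<zeta>) \<in> borel_measurable (borel \<Otimes>\<^sub>M borel)"
  unfolding local_kernel_def kernel_term_def by measurable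

lemma sets_unit_circle [measurable]: "unit_circle \<in> sets borel"
  by simp

lemma measurable_G_ker [measurable]:
  "(\<lambda>(z, \<zeta>). G_ker k z \<zeta>) \<in> borel_measurable (borel \<Otimes>\<^sub>M borel)"
  unfolding G_ker_def by measurable

lemma measurable_potential_kernel [measurable]:
  "(\<lambda>(z, \<zeta>). potential_kernel k z \<zeta>) \<in> borel_measurable (borel \<Otimes>\<^sub>M borel)"
  unfolding potential_kernel_def by measurable

lemma higher_deriv_holomorphic_disc:
  "f holomorphic_on unit_disc \<Longrightarrow> (deriv ^^ k) f holomorphic_on unit_disc"
  by (rule holomorphic_higher_deriv) auto

context
  fixes \<mu> :: "complex measure"
  assumes \<mu>: "\<mu> \<in> finite_borel_measures_on closed_unit_disc"
begin

lemma finite_measure_of_borel: "finite_measure \<mu>"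
  using \<mu> by (simp add: finite_borel_measures_on_def)

lemma space_finite_borel_measure: "space \<mu> = closed_unit_disc"
proof -
  have "sets \<mu> = sets (restrict_space borel closed_unit_disc)"
    using \<mu> by (simp add: finite_borel_measures_on_def)
  from sets_eq_imp_space_eq[OF this] show ?thesis by (simp add: space_restrict_space)
qed

lemma borel_measurable_of_borel: "f \<in> borel_measurable borel \<Longrightarrow> f \<in> borel_measurable \<mu>"
proof -
  assume f: "f \<in> borel_measurable borel"
  have "sets \<mu> = sets (restrict_space borel closed_unit_disc)"
    using \<mu> by (simp add: finite_borel_measures_on_def)
  thus "f \<in> borel_measurable \<mu>"
    using measurable_restrict_space1[OF f, of closed_unit_disc] measurable_cong_sets by blast
qed

lemma U_pot_eq:
  "U_pot \<mu> k z = (\<integral>\<^sup>+\<zeta>. potential_kernel k z \<zeta> \<partial>\<mu>)"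
proof -
  have [measurable]: "(\<lambda>x. x) \<in> \<mu> \<rightarrow>\<^sub>M borel" by (rule borel_measurable_of_borel) simp
  have 1: "(\<lambda>\<zeta>. ennreal ((-1) ^ (k + 1) * G_ker k z \<zeta> / (1 - (cmod \<zeta>)\<^sup>2) ^ k) * indicator unit_disc \<zeta>) \<in> borel_measurable \<mu>"
    by (rule borel_measurable_of_borel) measurable
  have 2: "(\<lambda>\<zeta>. ennreal ((1 - (cmod z)\<^sup>2) ^ k / (cmod (z - \<zeta>))\<^sup>2) * indicator unit_circle \<zeta>) \<in> borel_measurable \<mu>"
    by (rule borel_measurable_of_borel) measurable
  show ?thesis
    unfolding U_pot_def potential_kernel_def using 1 2
    by (subst nn_integral_add) (auto simp: nn_integral_cmult)
qed

lemma measurable_U_pot: "U_pot \<mu> k \<in> borel_measurable borel"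
proof -
  interpret finite_measure \<mu> by (rule finite_measure_of_borel)
  have [measurable]: "(\<lambda>x. x) \<in> \<mu> \<rightarrow>\<^sub>M borel" by (rule borel_measurable_of_borel) simp
  have "(\<lambda>p. (\<lambda>(z, \<zeta>). potential_kernel k z \<zeta>) (fst p, (\<lambda>x. x) (snd p))) \<in> borel_measurable (borel \<Otimes>\<^sub>M \<mu>)"
    by measurable
  hence "(\<lambda>(z, \<zeta>). potential_kernel k z \<zeta>) \<in> borel_measurable (borel \<Otimes>\<^sub>M \<mu>)"
    by (simp add: case_prod_beta')
  thus ?thesis unfolding U_pot_eq[abs_def]
    by (rule borel_measurable_nn_integral)
qed

text \<open>
  For fixed \<open>\<zeta>\<close> the kernels \<open>potential_kernel\<close> and \<open>local_kernel\<close> differ at most at \<open>z = \<zeta>\<close>, which is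
  negligible for area but perhaps not for \<open>\<mu>\<close>. So the order of integration is exchanged first, and the
  kernel is replaced afterwards, inside the integral over \<open>z\<close>.
\<close>

lemma D_int_eq_nn_integral_local_dirichlet:
  assumes k: "k \<ge> 1" and f: "f holomorphic_on unit_disc"
  shows "D_int \<mu> k f = (\<integral>\<^sup>+\<zeta>. local_dirichlet \<zeta> k f \<partial>\<mu>)"
    and "(\<lambda>\<zeta>. local_dirichlet \<zeta> k f) \<in> borel_measurable \<mu>"
proof -
  interpret finite_measure \<mu> by (rule finite_measure_of_borel)
  interpret A: sigma_finite_measure area_measure by (rule sigma_finite_area_measure)
  interpret P: pair_sigma_finite \<mu> area_measure by unfold_locales
  have m [measurable]: "(\<lambda>x. x) \<in> \<mu> \<rightarrow>\<^sub>M borel" by (rule borel_measurable_of_borel) simp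
  define w where "w z = ennreal ((cmod (if z \<in> unit_disc then (deriv ^^ k) f z else 0))\<^sup>2)" for z
  have [measurable]: "(\<lambda>z. if z \<in> unit_disc then (deriv ^^ k) f z else 0) \<in> borel_measurable borel"
    by (intro borel_measurable_on_disc holomorphic_on_imp_continuous_on higher_deriv_holomorphic_disc f)
  have [measurable]: "w \<in> borel_measurable borel" unfolding w_def by measurable
  have "(\<lambda>p. w (snd p) * (\<lambda>(z, \<zeta>). potential_kernel k z \<zeta>) (snd p, (\<lambda>x. x) (fst p))) \<in> borel_measurable (\<mu> \<Otimes>\<^sub>M area_measure)"
    by measurable
  hence mp: "(\<lambda>(\<zeta>, z). w z * potential_kernel k z \<zeta>) \<in> borel_measurable (\<mu> \<Otimes>\<^sub>M area_measure)"
    by (simp add: case_prod_beta')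
  have "(\<lambda>p. w (snd p) * (\<lambda>(z, \<zeta>). local_kernel k z \<zeta>) (snd p, (\<lambda>x. x) (fst p))) \<in> borel_measurable (\<mu> \<Otimes>\<^sub>M area_measure)"
    by measurable
  hence ml: "(\<lambda>(\<zeta>, z). w z * local_kernel k z \<zeta>) \<in> borel_measurable (\<mu> \<Otimes>\<^sub>M area_measure)"
    by (simp add: case_prod_beta')
  have loc: "local_dirichlet \<zeta> k f = (\<integral>\<^sup>+z. w z * local_kernel k z \<zeta> \<partial>area_measure)" for \<zeta>
    unfolding local_dirichlet_def by (intro nn_integral_cong) (auto simp: w_def indicator_def)
  have "(\<lambda>\<zeta>. \<integral>\<^sup>+z. w z * local_kernel k z \<zeta> \<partial>area_measure) \<in> borel_measurable \<mu>"
    using ml by (rule A.borel_measurable_nn_integral)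
  thus "(\<lambda>\<zeta>. local_dirichlet \<zeta> k f) \<in> borel_measurable \<mu>"
    unfolding loc .
  have mz: "(\<lambda>\<zeta>. potential_kernel k z \<zeta>) \<in> borel_measurable \<mu>" for z
  proof -
    have "(\<lambda>\<zeta>. (\<lambda>(z, \<zeta>). potential_kernel k z \<zeta>) (z, (\<lambda>x. x) \<zeta>)) \<in> borel_measurable \<mu>"
      by measurable
    thus ?thesis by simp
  qed
  have "D_int \<mu> k f = (\<integral>\<^sup>+z. w z * U_pot \<mu> k z \<partial>area_measure)"
    unfolding D_int_def by (intro nn_integral_cong) (auto simp: w_def indicator_def)
  also have "\<dots> = (\<integral>\<^sup>+z. (\<integral>\<^sup>+\<zeta>. w z * potential_kernel k z \<zeta> \<partial>\<mu>) \<partial>area_measure)"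
    unfolding U_pot_eq by (subst nn_integral_cmult[OF mz]) auto
  also have "\<dots> = (\<integral>\<^sup>+\<zeta>. (\<integral>\<^sup>+z. w z * potential_kernel k z \<zeta> \<partial>area_measure) \<partial>\<mu>)"
    using mp by (rule P.Fubini')
  also have "\<dots> = (\<integral>\<^sup>+\<zeta>. local_dirichlet \<zeta> k f \<partial>\<mu>)"
  proof (intro nn_integral_cong)
    fix \<zeta> assume "\<zeta> \<in> space \<mu>"
    hence \<zeta>: "cmod \<zeta> \<le> 1" by (simp add: space_finite_borel_measure)
    show "(\<integral>\<^sup>+z. w z * potential_kernel k z \<zeta> \<partial>area_measure) = local_dirichlet \<zeta> k f"
      unfolding loc
    proof (rule nn_integral_cong_AE)
      have "AE z in lborel. z \<noteq> \<zeta>" by (rule AE_lborel_singleton)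
      hence "AE z in area_measure. z \<noteq> \<zeta>"
        by (subst AE_iff_measurable[OF _ refl]; (subst (asm) AE_iff_measurable[OF _ refl])?)
          (auto simp: emeasure_area_measure)
      thus "AE z in area_measure. w z * potential_kernel k z \<zeta> = w z * local_kernel k z \<zeta>"
        by eventually_elim (auto simp: w_def potential_kernel_eq_local_kernel[OF k _ \<zeta>])
    qed
  qed
  finally show "D_int \<mu> k f = (\<integral>\<^sup>+\<zeta>. local_dirichlet \<zeta> k f \<partial>\<mu>)" .
qed

end

lemma local_dirichlet_eq_suminf_bergman:
  assumes \<zeta>: "cmod \<zeta> \<le> 1" and f: "f holomorphic_on unit_disc"
  shows "local_dirichlet \<zeta> k f = (\<Sum>i. ennreal (fact i / (fact (k - 1) * fact (k + i)) * (1 - (cmod \<zeta>)\<^sup>2) ^ i) *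
     bergman (k + i) (\<lambda>z. (deriv ^^ k) f z / (1 - cnj \<zeta> * z) ^ Suc i))"
proof -
  define F where "F i z = (if z \<in> unit_disc then (deriv ^^ k) f z / (1 - cnj \<zeta> * z) ^ Suc i else 0)" for i z
  have nz: "1 - cnj \<zeta> * z \<noteq> 0" if "z \<in> unit_disc" for z
    using one_minus_cnj_mult_nonzero[OF \<zeta>] that by simp
  have m [measurable]: "F i \<in> borel_measurable borel" for i
    unfolding F_def using nz
    by (intro borel_measurable_on_disc holomorphic_on_imp_continuous_on holomorphic_intros higher_deriv_holomorphic_disc f) auto
  have "local_dirichlet \<zeta> k f = (\<integral>\<^sup>+z. (\<Sum>i. ennreal (fact i / (fact (k - 1) * fact (k + i)) * (1 - (cmod \<zeta>)\<^sup>2) ^ i) *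
      (ennreal ((cmod (F i z))\<^sup>2 * (1 - (cmod z)\<^sup>2) ^ (k + i)) * indicator unit_disc z)) \<partial>area_measure)"
    unfolding local_dirichlet_def local_kernel_def
  proof (intro nn_integral_cong)
    fix z :: complex
    show "ennreal ((cmod ((deriv ^^ k) f z))\<^sup>2) * (\<Sum>i. ennreal (kernel_term k z \<zeta> i)) * indicator unit_disc z =
      (\<Sum>i. ennreal (fact i / (fact (k - 1) * fact (k + i)) * (1 - (cmod \<zeta>)\<^sup>2) ^ i) *
      (ennreal ((cmod (F i z))\<^sup>2 * (1 - (cmod z)\<^sup>2) ^ (k + i)) * indicator unit_disc z))"
    proof (cases "z \<in> unit_disc")
      case True
      have "ennreal ((cmod ((deriv ^^ k) f z))\<^sup>2) * ennreal (kernel_term k z \<zeta> i) =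
         ennreal (fact i / (fact (k - 1) * fact (k + i)) * (1 - (cmod \<zeta>)\<^sup>2) ^ i) *
         ennreal ((cmod (F i z))\<^sup>2 * (1 - (cmod z)\<^sup>2) ^ (k + i))" for i
      proof -
        have e: "(cmod ((deriv ^^ k) f z))\<^sup>2 * kernel_term k z \<zeta> i =
          (fact i / (fact (k - 1) * fact (k + i)) * (1 - (cmod \<zeta>)\<^sup>2) ^ i) * ((cmod (F i z))\<^sup>2 * (1 - (cmod z)\<^sup>2) ^ (k + i))"
        proof -
          have p: "cmod (1 - cnj \<zeta> * z) ^ (2 * Suc i) = (cmod (1 - cnj \<zeta> * z) ^ Suc i)\<^sup>2"
            by (simp only: mult.commute[of 2] power_mult)
          show ?thesis
            unfolding kernel_term_def p using True
            by (simp add: F_def norm_divide norm_power power_divide del: power_Suc)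
        qed
        show ?thesis
          using \<zeta> True kernel_term_nonneg[of z \<zeta> k i]
          by (subst (1 2) ennreal_mult[symmetric]) (auto simp: e power_le_one)
      qed
      thus ?thesis using True by (simp add: ennreal_suminf_cmult[symmetric] del: ennreal_suminf_cmult)
    qed simp
  qed
  also have "\<dots> = (\<Sum>i. ennreal (fact i / (fact (k - 1) * fact (k + i)) * (1 - (cmod \<zeta>)\<^sup>2) ^ i) *
     (\<integral>\<^sup>+z\<in>unit_disc. ennreal ((cmod (F i z))\<^sup>2 * (1 - (cmod z)\<^sup>2) ^ (k + i)) \<partial>area_measure))"
    by (subst nn_integral_suminf) (auto simp: nn_integral_cmult)
  also have "(\<lambda>i. \<integral>\<^sup>+z\<in>unit_disc. ennreal ((cmod (F i z))\<^sup>2 * (1 - (cmod z)\<^sup>2) ^ (k + i)) \<partial>area_measure)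
     = (\<lambda>i. bergman (k + i) (\<lambda>z. (deriv ^^ k) f z / (1 - cnj \<zeta> * z) ^ Suc i))"
    unfolding bergman_def by (intro ext nn_integral_cong) (auto simp: F_def indicator_def)
  finally show ?thesis by meson
qed

section \<open>Point masses on the circle\<close>

lemma cmod_add_sq: "(cmod (a + b))\<^sup>2 = (cmod a)\<^sup>2 + (cmod b)\<^sup>2 + 2 * Re (a * cnj b)"
  unfolding cmod_power2 by (simp add: algebra_simps power2_eq_square)

lemma cmod_add_sq_le: "(cmod (a + b))\<^sup>2 \<le> 2 * (cmod a)\<^sup>2 + 2 * (cmod b)\<^sup>2"
  using power_mono[OF norm_triangle_ineq[of a b], of 2] sum_squares_bound[of "cmod a" "cmod b"]
  by (simp add: power2_sum)

text \<open>
  Summation by parts: the increments of the rising weights \<open>(n + k)! / n!\<close> are the binomial weights.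
\<close>

lemma weighted_difference_eq:
  fixes v :: "nat \<Rightarrow> complex"
  assumes k: "k = Suc r"
  shows "(\<Sum>m\<le>n. of_real (fact (m + k) / fact m) * (v (m + k) - v (Suc (m + k))))
     = (\<Sum>m\<le>n. of_real (fact k * real ((m + r) choose r)) * v (m + k)) - of_real (fact (n + k) / fact n) * v (Suc (n + k))"
proof (induction n)
  case 0
  show ?case by (simp add: k algebra_simps)
next
  case (Suc n)
  have c: "fact k * real ((Suc n + r) choose r) = fact (Suc n + k) / fact (Suc n) - fact (n + k) / (fact n :: real)"
  proof -
    have e: "Suc n + r = n + k" by (simp add: k)
    have ch: "real ((n + k) choose r) = fact (n + k) / (fact r * fact (Suc n))"
      using binomial_fact[of r "n + k", where 'a=real] by (simp add: k)
    have f: "fact (Suc n) = (real n + 1) * fact n" "fact (Suc n + k) = (real n + real k + 1) * fact (n + k)"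
        "fact k = real k * (fact r :: real)"
      by (simp_all add: k)
    have "real k * F * (B / (F * ((real n + 1) * A))) = (real n + real k + 1) * B / ((real n + 1) * A) - B / A"
      if "A > 0" "F > 0" for A B F :: real
      using that by (simp add: divide_simps) (simp add: algebra_simps)
    from this[of "fact n" "fact r" "fact (n + k)"] show ?thesis
      unfolding e ch unfolding f by simp
  qed
  have gen: "(T - Q * y) + P * (y - w) = (T + (P - Q) * y) - P * w" for T P Q y w :: complex
    by (simp add: algebra_simps)
  show ?case
    unfolding sum.atMost_Suc Suc.IH c of_real_diff by (simp only: add_Suc gen)
qed

text \<open>
  By \<open>weighted_difference_eq\<close>, \<open>s J\<close> is \<open>t J\<close> minus a multiple of the next entry of \<open>v\<close>, and
  \<open>t (Suc J)\<close> is \<open>t J\<close> plus a multiple of the same entry. The two coefficients are such that the mixed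
  terms of \<open>(cmod (s J))\<^sup>2\<close> and of \<open>(cmod (t (Suc J)))\<^sup>2\<close> cancel and the coefficient of
  \<open>(cmod (t J))\<^sup>2\<close> telescopes.
\<close>

lemma telescoping_square_identity:
  fixes v :: "nat \<Rightarrow> complex"
  assumes k: "k = Suc r"
  defines "s \<equiv> (\<lambda>n. \<Sum>m\<le>n. of_real (fact (m + k) / fact m) * (v (m + k) - v (Suc (m + k))))"
    and "t \<equiv> (\<lambda>n. \<Sum>m\<le>n. of_real (fact k * real ((m + r) choose r)) * v (m + k))"
  shows "(\<Sum>n<J. fact n / (fact r * fact (Suc (n + k))) * (cmod (s n))\<^sup>2)
      + fact J / (fact k * fact (J + k)) * (cmod (t J))\<^sup>2
     = (\<Sum>n\<le>J. real ((n + r) choose r) * (cmod (v (n + k)))\<^sup>2)"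
proof (induction J)
  case 0
  have "t 0 = of_real (fact k) * v k" by (simp add: t_def)
  hence "(cmod (t 0))\<^sup>2 = (fact k)\<^sup>2 * (cmod (v k))\<^sup>2"
    by (simp only: norm_mult power_mult_distrib norm_of_real power2_abs)
  thus ?case by (simp add: power2_eq_square)
next
  case (Suc J)
  define A where "A = (fact J :: real)"
  define B where "B = (fact (J + k) :: real)"
  define F where "F = (fact r :: real)"
  define x where "x = v (Suc (J + k))"
  (* w, e and e' are the coefficients of |s J|^2, |t J|^2 and |t (Suc J)|^2;
     s J = t J - p x and t (Suc J) = t J + q x for the new entry x. *)
  define w where "w = A / (F * ((real (J + k) + 1) * B))"
  define p where "p = B / A"
  define e where "e = A / (real k * F * B)"
  define e' where "e' = (real J + 1) * A / (real k * F * ((real (J + k) + 1) * B))"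
  define C where "C = real ((Suc J + r) choose r)"
  define q where "q = real k * F * C"
  have pos: "A > 0" "B > 0" "F > 0" "real k > 0" by (auto simp: A_def B_def F_def k)
  have C: "C = B / (F * ((real J + 1) * A))"
  proof -
    have "real ((J + k) choose r) = fact (J + k) / (fact r * fact (Suc J))"
      using binomial_fact[of r "J + k", where 'a=real] by (simp add: k)
    thus ?thesis by (simp add: C_def A_def B_def F_def k add.commute)
  qed
  have fk: "fact k = real k * F" by (simp add: k F_def)
  have s: "s J = t J - of_real p * x"
    unfolding s_def t_def p_def x_def A_def B_def by (rule weighted_difference_eq[OF k])
  have t: "t (Suc J) = t J + of_real q * x"
    unfolding t_def q_def x_def C_def fk[symmetric] by simp
  have 1: "e' * q = w * p"
    using pos by (simp add: e'_def q_def w_def p_def C divide_simps)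
  have 2: "e' + w = e"
  proof -
    have "real J + 1 + real k = real (J + k) + 1" by simp
    thus ?thesis using pos by (simp add: e'_def w_def e_def divide_simps) (simp add: algebra_simps)
  qed
  have 3: "w * p\<^sup>2 + e' * q\<^sup>2 = C"
  proof -
    have "w * p\<^sup>2 + e' * q\<^sup>2 = w * p * (p + q)" using 1 by (simp add: power2_eq_square algebra_simps)
    also have "\<dots> = C"
      using pos unfolding C w_def p_def q_def by (simp add: divide_simps) (simp add: algebra_simps)
    finally show ?thesis .
  qed
  have ns: "(cmod (s J))\<^sup>2 = (cmod (t J))\<^sup>2 + p\<^sup>2 * (cmod x)\<^sup>2 - 2 * p * Re (t J * cnj x)"
    unfolding s using cmod_add_sq[of "t J" "- of_real p * x"] by (simp add: norm_mult power_mult_distrib algebra_simps)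
  have nt: "(cmod (t (Suc J)))\<^sup>2 = (cmod (t J))\<^sup>2 + q\<^sup>2 * (cmod x)\<^sup>2 + 2 * q * Re (t J * cnj x)"
    unfolding t using cmod_add_sq[of "t J" "of_real q * x"] by (simp add: norm_mult power_mult_distrib algebra_simps)
  have "w * (cmod (s J))\<^sup>2 + e' * (cmod (t (Suc J)))\<^sup>2
     = (e' + w) * (cmod (t J))\<^sup>2 + (w * p\<^sup>2 + e' * q\<^sup>2) * (cmod x)\<^sup>2 + 2 * Re (t J * cnj x) * (e' * q - w * p)"
    unfolding ns nt by (simp add: algebra_simps)
  also have "\<dots> = e * (cmod (t J))\<^sup>2 + C * (cmod x)\<^sup>2"
    unfolding 1 2 3 by simp
  finally have step: "w * (cmod (s J))\<^sup>2 + e' * (cmod (t (Suc J)))\<^sup>2 = e * (cmod (t J))\<^sup>2 + C * (cmod x)\<^sup>2" .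
  have w': "fact J / (fact r * fact (Suc (J + k))) = w"
    by (simp add: w_def A_def F_def B_def add_ac)
  have e'': "fact (Suc J) / (fact k * fact (Suc J + k)) = e'"
    by (simp add: e'_def fk A_def B_def add_ac)
  have e3: "fact J / (fact k * fact (J + k)) = e"
    by (simp add: e_def fk A_def B_def)
  show ?case
    using Suc.IH step
    unfolding sum.lessThan_Suc sum.atMost_Suc w' e'' e3 by (simp add: C_def x_def)
qed

text \<open>
  By Cauchy-Schwarz the indices beyond \<open>M\<close> contribute at most the tail of the convergent series; the
  contribution of the first \<open>M\<close> indices disappears because the total weight tends to infinity.
\<close>

lemma weighted_mean_sq_tendsto_0:
  fixes y :: "nat \<Rightarrow> complex" and c :: "nat \<Rightarrow> real"
  assumes c: "\<And>n. c n \<ge> 1" and sm: "summable (\<lambda>n. c n * (cmod (y n))\<^sup>2)"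
  shows "(\<lambda>J. (cmod (\<Sum>m\<le>J. of_real (c m) * y m))\<^sup>2 / (\<Sum>m\<le>J. c m)) \<longlonglongrightarrow> 0"
proof (rule LIMSEQ_I)
  fix \<epsilon> :: real assume \<epsilon>: "\<epsilon> > 0"
  define W where "W J = (\<Sum>m\<le>J. c m)" for J
  have c0: "c n \<ge> 0" for n using c[of n] by simp
  have Wge: "W J \<ge> real J" for J
  proof -
    have "(\<Sum>m\<le>J. 1) \<le> W J" unfolding W_def by (intro sum_mono c)
    thus ?thesis by simp
  qed
  have Wpos: "W J > 0" for J
  proof -
    have "(\<Sum>m\<le>J. 1) \<le> W J" unfolding W_def by (intro sum_mono c)
    thus ?thesis by simp
  qed
  obtain M where M: "\<And>m n. m \<ge> M \<Longrightarrow> norm (\<Sum>i=m..<n. c i * (cmod (y i))\<^sup>2) < \<epsilon> / 8"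
    using sm[unfolded summable_Cauchy, rule_format, of "\<epsilon> / 8"] \<epsilon> by auto
  define H where "H = (cmod (\<Sum>m<M. of_real (c m) * y m))\<^sup>2"
  obtain J0 where J0: "real J0 > 4 * H / \<epsilon>" using reals_Archimedean2 by blast
  show "\<exists>no. \<forall>J\<ge>no. norm ((cmod (\<Sum>m\<le>J. of_real (c m) * y m))\<^sup>2 / (\<Sum>m\<le>J. c m) - 0) < \<epsilon>"
  proof (intro exI allI impI)
    fix J assume J: "J \<ge> max J0 M"
    have split: "(\<Sum>m\<le>J. of_real (c m) * y m) = (\<Sum>m<M. of_real (c m) * y m) + (\<Sum>m=M..J. of_real (c m) * y m)"
      using J by (subst sum.union_disjoint[symmetric]) (auto intro!: sum.cong)
    have "(cmod (\<Sum>m=M..J. of_real (c m) * y m))\<^sup>2 \<le> (\<Sum>m=M..J. sqrt (c m) * (sqrt (c m) * cmod (y m)))\<^sup>2"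
      using c0 by (intro power_mono order_trans[OF norm_sum] sum_mono) (auto simp: norm_mult mult.assoc[symmetric])
    also have "\<dots> \<le> (\<Sum>m=M..J. (sqrt (c m))\<^sup>2) * (\<Sum>m=M..J. (sqrt (c m) * cmod (y m))\<^sup>2)"
      by (rule Cauchy_Schwarz_ineq_sum)
    also have "\<dots> = (\<Sum>m=M..J. c m) * (\<Sum>m=M..<Suc J. c m * (cmod (y m))\<^sup>2)"
      using c0 by (simp add: power_mult_distrib atLeastLessThanSuc_atLeastAtMost)
    also have "\<dots> \<le> W J * (\<epsilon> / 8)"
    proof (intro mult_mono)
      show "(\<Sum>m=M..J. c m) \<le> W J" unfolding W_def using c0 by (intro sum_mono2) auto
      show "(\<Sum>m=M..<Suc J. c m * (cmod (y m))\<^sup>2) \<le> \<epsilon> / 8" using M[of M "Suc J"] by auto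
      show "0 \<le> (\<Sum>m=M..<Suc J. c m * (cmod (y m))\<^sup>2)" using c0 by (intro sum_nonneg) auto
      show "0 \<le> W J" using Wpos[of J] by simp
    qed
    finally have tail: "(cmod (\<Sum>m=M..J. of_real (c m) * y m))\<^sup>2 \<le> W J * (\<epsilon> / 8)" .
    have "(cmod (\<Sum>m\<le>J. of_real (c m) * y m))\<^sup>2 \<le> 2 * H + 2 * (W J * (\<epsilon> / 8))"
    proof -
      from cmod_add_sq_le[of "\<Sum>m<M. of_real (c m) * y m" "\<Sum>m=M..J. of_real (c m) * y m"] tail
      show ?thesis unfolding split H_def by linarith
    qed
    also have "2 * H < W J * \<epsilon> / 2"
    proof -
      have "4 * H / \<epsilon> < real J0" by (rule J0)
      also have "\<dots> \<le> W J" using J Wge[of J] by (meson max.boundedE of_nat_le_iff order_trans)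
      finally show ?thesis using \<epsilon> by (simp add: field_simps)
    qed
    finally have "(cmod (\<Sum>m\<le>J. of_real (c m) * y m))\<^sup>2 < W J * \<epsilon> / 2 + 2 * (W J * (\<epsilon> / 8))"
      by simp
    moreover have "0 < W J * \<epsilon>" using Wpos \<epsilon> by simp
    ultimately have "(cmod (\<Sum>m\<le>J. of_real (c m) * y m))\<^sup>2 < W J * \<epsilon>"
      by linarith
    thus "norm ((cmod (\<Sum>m\<le>J. of_real (c m) * y m))\<^sup>2 / (\<Sum>m\<le>J. c m) - 0) < \<epsilon>"
      using Wpos[of J] by (simp add: W_def[symmetric] field_simps)
  qed
qed

text \<open>
  Identifies the coefficient of \<open>(cmod (t J))\<^sup>2\<close> in \<open>telescoping_square_identity\<close> as the reciprocal of
  a total weight, so that this remainder is controlled by a weighted mean of \<open>v\<close>.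
\<close>

lemma hockey_stick_fact:
  assumes k: "k = Suc r"
  shows "fact J / (fact k * fact (J + k)) = 1 / ((fact k)\<^sup>2 * (\<Sum>m\<le>J. real ((m + r) choose r)))"
proof -
  have "(\<Sum>m\<le>J. (m + r) choose r) = (r + J + 1) choose (r + 1)"
    using choose_rising_sum(1)[of r J] by (simp add: add.commute)
  hence "(\<Sum>m\<le>J. real ((m + r) choose r)) = real ((J + k) choose k)"
    by (simp add: k add_ac flip: of_nat_sum)
  also have "\<dots> = fact (J + k) / (fact k * fact J)"
    using binomial_fact[of k "J + k", where 'a=real] by simp
  finally show ?thesis by (simp add: power2_eq_square)
qed

lemma binomial_ge_1: "1 \<le> real ((m + r) choose r)"
proof -
  have "(m + r) choose r > 0" by (intro zero_less_binomial) simp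
  thus ?thesis by linarith
qed

text \<open>
  The limit of \<open>telescoping_square_identity\<close>: its remainder tends to zero by
  \<open>weighted_mean_sq_tendsto_0\<close>.
\<close>

lemma weighted_difference_sums:
  fixes v :: "nat \<Rightarrow> complex"
  assumes k: "k = Suc r"
  defines "s \<equiv> (\<lambda>n. \<Sum>m\<le>n. of_real (fact (m + k) / fact m) * (v (m + k) - v (Suc (m + k))))"
  assumes sm: "summable (\<lambda>n. real ((n + r) choose r) * (cmod (v (n + k)))\<^sup>2)"
  shows "(\<lambda>n. fact n / (fact r * fact (Suc (n + k))) * (cmod (s n))\<^sup>2) sums
     (\<Sum>n. real ((n + r) choose r) * (cmod (v (n + k)))\<^sup>2)"
proof -
  define t where "t = (\<lambda>n. \<Sum>m\<le>n. of_real (fact k * real ((m + r) choose r)) * v (m + k))"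
  have id: "(\<Sum>n<J. fact n / (fact r * fact (Suc (n + k))) * (cmod (s n))\<^sup>2) =
     (\<Sum>n\<le>J. real ((n + r) choose r) * (cmod (v (n + k)))\<^sup>2) - fact J / (fact k * fact (J + k)) * (cmod (t J))\<^sup>2" for J
    using telescoping_square_identity[OF k, of v J] unfolding s_def t_def by simp
  have e: "fact J / (fact k * fact (J + k)) * (cmod (t J))\<^sup>2
     = (cmod (\<Sum>m\<le>J. of_real (real ((m + r) choose r)) * v (m + k)))\<^sup>2 / (\<Sum>m\<le>J. real ((m + r) choose r))" for J
  proof -
    have "t J = of_real (fact k) * (\<Sum>m\<le>J. of_real (real ((m + r) choose r)) * v (m + k))"
      unfolding t_def sum_distrib_left by (intro sum.cong refl) (simp add: mult.assoc)
    thus ?thesis unfolding hockey_stick_fact[OF k]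
      by (simp add: norm_mult power_mult_distrib del: of_real_fact of_real_of_nat_eq)
  qed
  have "(\<lambda>J. \<Sum>n\<le>J. real ((n + r) choose r) * (cmod (v (n + k)))\<^sup>2) \<longlonglongrightarrow> (\<Sum>n. real ((n + r) choose r) * (cmod (v (n + k)))\<^sup>2)"
    by (rule summable_LIMSEQ'[OF sm])
  moreover have "(\<lambda>J. fact J / (fact k * fact (J + k)) * (cmod (t J))\<^sup>2) \<longlonglongrightarrow> 0"
    unfolding e by (rule weighted_mean_sq_tendsto_0[OF binomial_ge_1 sm])
  ultimately have "(\<lambda>J. \<Sum>n<J. fact n / (fact r * fact (Suc (n + k))) * (cmod (s n))\<^sup>2) \<longlonglongrightarrow>
      (\<Sum>n. real ((n + r) choose r) * (cmod (v (n + k)))\<^sup>2) - 0"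
    unfolding id by (rule tendsto_diff)
  thus ?thesis by (simp add: sums_def)
qed

text \<open>
  Sequences with differences \<open>\<alpha>\<close> are unique up to a constant. For each \<open>J\<close> the constant \<open>c J\<close> that makes
  the weighted mean \<open>t J\<close> vanish removes the remainder from \<open>telescoping_square_identity\<close>, so that the
  partial sums up to \<open>J\<close> are bounded by the given series. The constants \<open>c J\<close> are bounded, and any
  limit point of them serves all \<open>J\<close> at once.
\<close>

lemma weighted_difference_antidifference:
  fixes \<alpha> :: "nat \<Rightarrow> complex"
  assumes k: "k = Suc r"
  assumes sm: "summable (\<lambda>n. fact n / (fact r * fact (Suc (n + k))) * (cmod (\<Sum>m\<le>n. of_real (fact (m + k) / fact m) * \<alpha> (m + k)))\<^sup>2)"
  shows "\<exists>v. (\<forall>n. \<alpha> n = v n - v (Suc n)) \<and> summable (\<lambda>n. real ((n + r) choose r) * (cmod (v (n + k)))\<^sup>2)"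
proof -
  define v0 where "v0 n = - (\<Sum>m<n. \<alpha> m)" for n
  define C where "C m = real ((m + r) choose r)" for m
  define D where "D = (\<Sum>n. fact n / (fact r * fact (Suc (n + k))) * (cmod (\<Sum>m\<le>n. of_real (fact (m + k) / fact m) * \<alpha> (m + k)))\<^sup>2)"
  have C1: "C m \<ge> 1" for m unfolding C_def by (rule binomial_ge_1)
  have C0: "C m \<ge> 0" for m using C1[of m] by simp
  define W where "W J = (\<Sum>m\<le>J. C m)" for J
  have Wpos: "W J > 0" for J
  proof -
    have "(\<Sum>m\<le>J. 1) \<le> W J" unfolding W_def by (intro sum_mono C1)
    thus ?thesis by simp
  qed
  (* Minus the weighted mean of v0, so that v0 + c J has weighted mean zero up to J. *)
  define c where "c J = - (\<Sum>m\<le>J. of_real (C m) * v0 (m + k)) / of_real (W J)" for J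
  have bound: "(\<Sum>n\<le>J. C n * (cmod (v0 (n + k) + c J))\<^sup>2) \<le> D" for J
  proof -
    define v where "v n = v0 n + c J" for n
    have vd: "v n - v (Suc n) = \<alpha> n" for n by (simp add: v_def v0_def)
    have "(\<Sum>m\<le>J. of_real (fact k * C m) * v (m + k)) = of_real (fact k) * ((\<Sum>m\<le>J. of_real (C m) * v0 (m + k)) + of_real (W J) * c J)"
      by (simp add: v_def W_def sum_distrib_left sum_distrib_right sum.distrib algebra_simps)
    also have "\<dots> = 0" using Wpos[of J] by (simp add: c_def)
    finally have t0: "(\<Sum>m\<le>J. of_real (fact k * C m) * v (m + k)) = 0" .
    have "(\<Sum>n\<le>J. C n * (cmod (v (n + k)))\<^sup>2)
       = (\<Sum>n<J. fact n / (fact r * fact (Suc (n + k))) * (cmod (\<Sum>m\<le>n. of_real (fact (m + k) / fact m) * \<alpha> (m + k)))\<^sup>2)"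
      using telescoping_square_identity[OF k, of v J] t0 unfolding vd C_def[symmetric] by simp
    also have "\<dots> \<le> D" unfolding D_def by (intro sum_le_suminf sm) auto
    finally show ?thesis by (simp add: v_def)
  qed
  have D0: "D \<ge> 0" unfolding D_def by (intro suminf_nonneg sm) auto
  have bc: "c J \<in> cball (- v0 k) (sqrt D)" for J
  proof -
    have "C 0 * (cmod (v0 (0 + k) + c J))\<^sup>2 \<le> (\<Sum>n\<le>J. C n * (cmod (v0 (n + k) + c J))\<^sup>2)"
      using C0 by (intro member_le_sum) auto
    hence "(cmod (v0 k + c J))\<^sup>2 \<le> D" using bound[of J] by (simp add: C_def)
    hence "cmod (v0 k + c J) \<le> sqrt D" by (rule real_le_rsqrt)
    moreover have "dist (- v0 k) (c J) = cmod (v0 k + c J)"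
      by (metis dist_norm norm_minus_commute diff_minus_eq_add add.commute)
    ultimately show ?thesis by simp
  qed
  have "seq_compact (cball (- v0 k) (sqrt D))"
    by (rule compact_imp_seq_compact) simp
  then obtain l h where h: "strict_mono h" "(c \<circ> h) \<longlonglongrightarrow> l"
    using bc unfolding seq_compact_def by metis
  define v where "v n = v0 n + l" for n
  have "summable (\<lambda>n. C n * (cmod (v (n + k)))\<^sup>2)"
  proof (rule bounded_imp_summable)
    show "0 \<le> C n * (cmod (v (n + k)))\<^sup>2" for n using C1[of n] by simp
    fix M
    have "(\<lambda>i. \<Sum>n\<le>M. C n * (cmod (v0 (n + k) + (c \<circ> h) i))\<^sup>2) \<longlonglongrightarrow> (\<Sum>n\<le>M. C n * (cmod (v0 (n + k) + l))\<^sup>2)"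
      by (intro tendsto_intros h)
    moreover have "\<forall>\<^sub>F i in sequentially. (\<Sum>n\<le>M. C n * (cmod (v0 (n + k) + (c \<circ> h) i))\<^sup>2) \<le> D"
    proof (rule eventually_mono[OF eventually_ge_at_top[of M]])
      fix i assume "i \<ge> M"
      hence "M \<le> h i" using seq_suble[OF h(1), of i] by simp
      hence "(\<Sum>n\<le>M. C n * (cmod (v0 (n + k) + c (h i)))\<^sup>2) \<le> (\<Sum>n\<le>h i. C n * (cmod (v0 (n + k) + c (h i)))\<^sup>2)"
        using C0 by (intro sum_mono2) auto
      also have "\<dots> \<le> D" by (rule bound)
      finally show "(\<Sum>n\<le>M. C n * (cmod (v0 (n + k) + (c \<circ> h) i))\<^sup>2) \<le> D" by simp
    qed
    ultimately show "(\<Sum>n\<le>M. C n * (cmod (v (n + k)))\<^sup>2) \<le> D"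
      unfolding v_def by (rule tendsto_upperbound) simp
  qed
  moreover have "\<alpha> n = v n - v (Suc n)" for n by (simp add: v_def v0_def)
  ultimately show ?thesis unfolding C_def by blast
qed

text \<open>
  On the circle only the term \<open>i = 0\<close> of the kernel is left, and the inner sums are, up to the
  unimodular factor \<open>\<zeta> ^ (n + k)\<close>, the Taylor coefficients of \<open>(deriv ^^ k) f z / (1 - cnj \<zeta> * z)\<close>.
\<close>

lemma local_dirichlet_circle_eq:
  assumes k: "k = Suc r" and \<zeta>: "cmod \<zeta> = 1" and f: "f holomorphic_on unit_disc"
  shows "local_dirichlet \<zeta> k f = (\<Sum>n. ennreal (fact n / (fact r * fact (Suc (n + k))) *
     (cmod (\<Sum>m\<le>n. of_real (fact (m + k) / fact m) * (\<zeta> ^ (m + k) * taylor_coeff f (m + k))))\<^sup>2))"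
proof -
  define F where "F z = (deriv ^^ k) f z / (1 - cnj \<zeta> * z)" for z
  have hF: "F holomorphic_on unit_disc"
    unfolding F_def using one_minus_cnj_mult_nonzero[of \<zeta>] \<zeta>
    by (intro holomorphic_intros higher_deriv_holomorphic_disc f) auto
  define d where "d n = of_real (fact (n + k) / fact n) * taylor_coeff f (n + k)" for n
  have zz: "\<zeta> * cnj \<zeta> = 1" using \<zeta> by (simp add: complex_norm_square[symmetric] flip: complex_norm_square)
  have "fps_expansion ((deriv ^^ k) f) 0 = fps_expansion (\<lambda>z. F z * (1 + (- cnj \<zeta>) * z)) 0"
    using one_minus_cnj_mult_nonzero[of \<zeta>] \<zeta> by (intro taylor_fps_cong) (auto simp: F_def)
  also have "\<dots> = fps_expansion F 0 * (fps_const 1 + fps_const (- cnj \<zeta>) * fps_X)"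
    by (simp only: taylor_fps_mult[OF hF holomorphic_on_affine] taylor_fps_linear)
  finally have "taylor_coeff ((deriv ^^ k) f) n = fps_nth (fps_expansion F 0 * (fps_const 1 + fps_const (- cnj \<zeta>) * fps_X)) n" for n
    by simp
  hence rec: "d n = taylor_coeff F n - (if n = 0 then 0 else cnj \<zeta> * taylor_coeff F (n - 1))" for n
    unfolding taylor_coeff_higher_deriv d_def[symmetric]
    by (simp add: distrib_left mult.assoc[symmetric])
  have s: "(\<Sum>m\<le>n. of_real (fact (m + k) / fact m) * (\<zeta> ^ (m + k) * taylor_coeff f (m + k))) = \<zeta> ^ (n + k) * taylor_coeff F n" for n
  proof (induction n)
    case 0
    show ?case using rec[of 0] by (simp add: d_def)
  next
    case (Suc n)
    have "\<zeta> ^ (Suc n + k) * taylor_coeff F (Suc n) = \<zeta> ^ (Suc n + k) * d (Suc n) + (\<zeta> * cnj \<zeta>) * (\<zeta> ^ (n + k) * taylor_coeff F n)"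
    proof -
      have "taylor_coeff F (Suc n) = d (Suc n) + cnj \<zeta> * taylor_coeff F n"
        using rec[of "Suc n"] by simp
      thus ?thesis by (simp only: power_Suc add_Suc distrib_left mult_ac)
    qed
    thus ?case unfolding sum.atMost_Suc Suc.IH zz by (simp add: d_def mult_ac)
  qed
  have "local_dirichlet \<zeta> k f = (\<Sum>i\<in>{0}. ennreal (fact i / (fact (k - 1) * fact (k + i)) * (1 - (cmod \<zeta>)\<^sup>2) ^ i) *
     bergman (k + i) (\<lambda>z. (deriv ^^ k) f z / (1 - cnj \<zeta> * z) ^ Suc i))"
    unfolding local_dirichlet_eq_suminf_bergman[OF eq_refl[OF \<zeta>] f]
    by (rule suminf_finite) (simp_all add: \<zeta> power_0_left)
  also have "\<dots> = ennreal (1 / (fact r * fact k)) * bergman k F"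
    by (simp add: k F_def[abs_def])
  also have "\<dots> = (\<Sum>n. ennreal (fact n / (fact r * fact (Suc (n + k))) * (cmod (taylor_coeff F n))\<^sup>2))"
    unfolding bergman_parseval[OF hF] ennreal_suminf_cmult[symmetric]
    by (intro suminf_cong, subst ennreal_mult[symmetric]) (auto simp: add_ac)
  finally show ?thesis unfolding s using \<zeta> by (simp add: norm_mult norm_power)
qed

section \<open>Moebius transformations of weighted area integrals\<close>

text \<open>
  The involution of the disc that exchanges \<open>0\<close> and \<open>\<zeta>\<close>.
\<close>

definition moebius :: "complex \<Rightarrow> complex \<Rightarrow> complex" where
  "moebius \<zeta> u = (\<zeta> - u) / (1 - cnj \<zeta> * u)"

lemma suminf_swap_ennreal:
  fixes f :: "nat \<Rightarrow> nat \<Rightarrow> ennreal"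
  shows "(\<Sum>i. \<Sum>n. f i n) = (\<Sum>n. \<Sum>i. f i n)"
proof -
  have "(\<Sum>n. \<Sum>i. f i n) = (\<integral>\<^sup>+n. (\<Sum>i. f i n) \<partial>count_space UNIV)"
    by (simp add: nn_integral_count_space_nat)
  also have "\<dots> = (\<Sum>i. \<integral>\<^sup>+n. f i n \<partial>count_space UNIV)"
    by (rule nn_integral_suminf) simp
  finally show ?thesis by (simp add: nn_integral_count_space_nat)
qed

text \<open>
  The terms are the differences of \<open>i! / (N (N + i)!)\<close>, which tends to zero.
\<close>

lemma sums_fact_ratio:
  assumes N: "N \<ge> 1"
  shows "(\<lambda>i. fact i / fact (N + i + 1)) sums (1 / (real N * fact N))"
proof -
  define h where "h i = fact i / (real N * fact (N + i))" for i :: nat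
  have "h i - h (Suc i) = fact i / fact (N + i + 1)" for i
  proof -
    define A where "A = (fact i :: real)"
    define B where "B = (fact (N + i) :: real)"
    have "A / (real N * B) - (real i + 1) * A / (real N * ((real N + real i + 1) * B)) = A / ((real N + real i + 1) * B)"
      if "B > 0" using that N by (simp add: divide_simps) (simp add: algebra_simps)
    thus ?thesis by (simp add: h_def A_def B_def add_ac)
  qed
  moreover have "h \<longlonglongrightarrow> 0"
  proof (rule tendsto_sandwich)
    show "eventually (\<lambda>i. 0 \<le> h i) sequentially" by (simp add: h_def)
    show "eventually (\<lambda>i. h i \<le> inverse (real (Suc i))) sequentially"
    proof (rule always_eventually, rule allI)
      fix i
      have "fact (Suc i) \<le> (fact (N + i) :: real)" using N by (intro fact_mono) auto
      also have "\<dots> \<le> real N * fact (N + i)" using N by simp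
      finally have "fact i / (real N * fact (N + i)) \<le> fact i / (fact (Suc i) :: real)"
        using N by (intro divide_left_mono) auto
      moreover have "(fact i :: real) / fact (Suc i) = inverse (real (Suc i))"
        by (simp add: inverse_eq_divide)
      ultimately show "h i \<le> inverse (real (Suc i))" by (simp only: h_def)
    qed
    show "(\<lambda>i. inverse (real (Suc i))) \<longlonglongrightarrow> 0" by (rule LIMSEQ_inverse_real_of_nat)
  qed auto
  hence "(\<lambda>i. h i - h (Suc i)) sums (h 0 - 0)" by (rule telescope_sums')
  ultimately show ?thesis by (simp add: h_def)
qed

context
  fixes \<zeta> :: complex
  assumes \<zeta>: "cmod \<zeta> < 1"
begin

lemma denominator_nonzero: "cmod u \<le> 1 \<Longrightarrow> 1 - cnj \<zeta> * u \<noteq> 0"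
  using one_minus_cnj_mult_nonzero[of "cnj u" "cnj \<zeta>"] \<zeta> by (simp add: mult.commute)

lemma one_minus_norm_sq_pos: "1 - (cmod \<zeta>)\<^sup>2 > 0"
  using \<zeta> by (simp add: abs_square_less_1)

lemma one_minus_cnj_moebius:
  "cmod u \<le> 1 \<Longrightarrow> 1 - cnj \<zeta> * moebius \<zeta> u = of_real (1 - (cmod \<zeta>)\<^sup>2) / (1 - cnj \<zeta> * u)"
  using denominator_nonzero[of u] complex_norm_square[of \<zeta>]
  by (simp add: moebius_def field_simps)

lemma moebius_minus: "cmod u \<le> 1 \<Longrightarrow> moebius \<zeta> u - \<zeta> = - u * of_real (1 - (cmod \<zeta>)\<^sup>2) / (1 - cnj \<zeta> * u)"
  using denominator_nonzero[of u] complex_norm_square[of \<zeta>]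
  by (simp add: moebius_def field_simps)

lemma norm_moebius:
  assumes "cmod u \<le> 1"
  shows "1 - (cmod (moebius \<zeta> u))\<^sup>2 = (1 - (cmod \<zeta>)\<^sup>2) * (1 - (cmod u)\<^sup>2) / (cmod (1 - cnj \<zeta> * u))\<^sup>2"
  using denominator_nonzero[OF assms] norm_sq_one_minus_cnj_mult[of \<zeta> u]
  by (simp add: moebius_def norm_divide power_divide field_simps)

lemma moebius_in_disc: "cmod u < 1 \<Longrightarrow> cmod (moebius \<zeta> u) < 1"
proof -
  assume u: "cmod u < 1"
  have "(1 - (cmod \<zeta>)\<^sup>2) * (1 - (cmod u)\<^sup>2) / (cmod (1 - cnj \<zeta> * u))\<^sup>2 > 0"
    using one_minus_norm_sq_pos u denominator_nonzero[of u] by (intro divide_pos_pos mult_pos_pos) (auto simp: abs_square_less_1)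
  hence "(cmod (moebius \<zeta> u))\<^sup>2 < 1" using norm_moebius[of u] u by simp
  thus ?thesis by (simp add: abs_square_less_1)
qed

lemma moebius_moebius: "cmod u < 1 \<Longrightarrow> moebius \<zeta> (moebius \<zeta> u) = u"
proof -
  assume u: "cmod u < 1"
  have nz: "1 - cnj \<zeta> * u \<noteq> 0" and T: "of_real (1 - (cmod \<zeta>)\<^sup>2) \<noteq> (0::complex)"
    using denominator_nonzero[of u] u one_minus_norm_sq_pos by (auto simp del: of_real_diff)
  have "moebius \<zeta> (moebius \<zeta> u) = - (moebius \<zeta> u - \<zeta>) / (1 - cnj \<zeta> * moebius \<zeta> u)"
    by (simp add: moebius_def)
  also have "\<dots> = u"
    using nz T u by (simp add: moebius_minus one_minus_cnj_moebius del: of_real_diff)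
  finally show ?thesis .
qed

lemma moebius_image: "moebius \<zeta> ` unit_disc = unit_disc"
proof (intro equalityI subsetI)
  fix w assume "w \<in> unit_disc"
  hence "w = moebius \<zeta> (moebius \<zeta> w)" "moebius \<zeta> w \<in> unit_disc"
    using moebius_moebius moebius_in_disc by auto
  thus "w \<in> moebius \<zeta> ` unit_disc" by blast
qed (use moebius_in_disc in auto)

lemma moebius_inj: "inj_on (moebius \<zeta>) unit_disc"
  by (rule inj_on_inverseI[of _ "moebius \<zeta>"]) (use moebius_moebius in auto)

lemma has_field_derivative_moebius:
  assumes "cmod u < 1"
  shows "(moebius \<zeta> has_field_derivative (- of_real (1 - (cmod \<zeta>)\<^sup>2) / (1 - cnj \<zeta> * u)\<^sup>2)) (at u)"
proof -
  have nz: "1 - cnj \<zeta> * u \<noteq> 0" using denominator_nonzero[of u] assms by simp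
  have "((\<lambda>u. (\<zeta> - u) / (1 - cnj \<zeta> * u)) has_field_derivative (- of_real (1 - (cmod \<zeta>)\<^sup>2) / (1 - cnj \<zeta> * u)\<^sup>2)) (at u)"
    using nz complex_norm_square[of \<zeta>]
    by (auto intro!: derivative_eq_intros simp: power2_eq_square field_simps)
  thus ?thesis by (simp add: moebius_def[abs_def])
qed

lemma moebius_holomorphic: "moebius \<zeta> holomorphic_on unit_disc"
  using denominator_nonzero unfolding moebius_def by (intro holomorphic_intros) auto

lemma holomorphic_compose_moebius:
  "F holomorphic_on unit_disc \<Longrightarrow> (\<lambda>u. F (moebius \<zeta> u)) holomorphic_on unit_disc"
  using holomorphic_on_compose_gen[OF moebius_holomorphic, of F unit_disc] moebius_image
  by (auto simp: o_def)

text \<open>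
  The weight and the Jacobian of the substitution produce powers of \<open>cmod (1 - cnj \<zeta> * u)\<close>, which can be
  absorbed into the holomorphic function.
\<close>

theorem bergman_moebius:
  assumes F: "F holomorphic_on unit_disc"
  shows "bergman q F = ennreal ((1 - (cmod \<zeta>)\<^sup>2) ^ (q + 2)) * bergman q (\<lambda>u. F (moebius \<zeta> u) / (1 - cnj \<zeta> * u) ^ (q + 2))"
proof -
  define T where "T = 1 - (cmod \<zeta>)\<^sup>2"
  have T: "T > 0" using one_minus_norm_sq_pos by (simp add: T_def)
  define F' where "F' z = (if z \<in> unit_disc then F z else 0)" for z
  have [measurable]: "F' \<in> borel_measurable borel"
    unfolding F'_def by (intro borel_measurable_on_disc holomorphic_on_imp_continuous_on F)
  define Q where "Q u = (if u \<in> unit_disc then F (moebius \<zeta> u) / (1 - cnj \<zeta> * u) ^ (q + 2) else 0)" for u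
  have [measurable]: "Q \<in> borel_measurable borel"
    unfolding Q_def using denominator_nonzero
    by (intro borel_measurable_on_disc holomorphic_on_imp_continuous_on holomorphic_intros holomorphic_compose_moebius F) auto
  define H where "H z = ennreal ((cmod (F' z))\<^sup>2 * (1 - (cmod z)\<^sup>2) ^ q)" for z
  have [measurable]: "H \<in> borel_measurable borel" unfolding H_def by measurable
  have "bergman q F = (\<integral>\<^sup>+z\<in>unit_disc. H z \<partial>area_measure)"
    unfolding bergman_def by (intro nn_integral_cong) (auto simp: H_def F'_def indicator_def)
  also have "\<dots> = ennreal (1 / pi) * (\<integral>\<^sup>+z\<in>moebius \<zeta> ` unit_disc. H z \<partial>lborel)"
    by (simp add: nn_integral_area_measure moebius_image)
  also have "(\<integral>\<^sup>+z\<in>moebius \<zeta> ` unit_disc. H z \<partial>lborel)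
     = (\<integral>\<^sup>+u\<in>unit_disc. H (moebius \<zeta> u) * ennreal ((cmod (deriv (moebius \<zeta>) u))\<^sup>2) \<partial>lborel)"
    by (rule nn_integral_holomorphic_substitution[OF _ moebius_holomorphic moebius_inj]) auto
  also have "\<dots> = (\<integral>\<^sup>+u. ennreal (T ^ (q + 2)) * (ennreal ((cmod (Q u))\<^sup>2 * (1 - (cmod u)\<^sup>2) ^ q) * indicator unit_disc u) \<partial>lborel)"
  proof (intro nn_integral_cong)
    fix u :: complex
    show "H (moebius \<zeta> u) * ennreal ((cmod (deriv (moebius \<zeta>) u))\<^sup>2) * indicator unit_disc u
       = ennreal (T ^ (q + 2)) * (ennreal ((cmod (Q u))\<^sup>2 * (1 - (cmod u)\<^sup>2) ^ q) * indicator unit_disc u)"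
    proof (cases "u \<in> unit_disc")
      case True
      hence u: "cmod u < 1" by simp
      define d where "d = cmod (1 - cnj \<zeta> * u)"
      have d: "d > 0" using denominator_nonzero[of u] u by (simp add: d_def)
      have u2: "(cmod u)\<^sup>2 < 1" using u by (simp add: abs_square_less_1)
      have D: "(cmod (deriv (moebius \<zeta>) u))\<^sup>2 = T\<^sup>2 / d ^ 4"
        using DERIV_imp_deriv[OF has_field_derivative_moebius[OF u]] T
        by (simp add: norm_divide norm_power d_def T_def power_divide del: of_real_diff flip: power_mult)
      have "(cmod (F (moebius \<zeta> u)))\<^sup>2 * (1 - (cmod (moebius \<zeta> u))\<^sup>2) ^ q * (cmod (deriv (moebius \<zeta>) u))\<^sup>2
         = T ^ (q + 2) * ((cmod (Q u))\<^sup>2 * (1 - (cmod u)\<^sup>2) ^ q)"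
      proof -
        have A: "(cmod (Q u))\<^sup>2 = (cmod (F (moebius \<zeta> u)))\<^sup>2 / (d ^ (q + 2))\<^sup>2"
          using True by (simp add: Q_def norm_divide norm_mult norm_power d_def power_divide)
        have B: "(d ^ (q + 2))\<^sup>2 = (d\<^sup>2) ^ q * d ^ 4"
          by (simp only: power_add power_mult_distrib flip: power_mult) (simp add: mult.commute)
        have C: "1 - (cmod (moebius \<zeta> u))\<^sup>2 = T * (1 - (cmod u)\<^sup>2) / d\<^sup>2"
          using norm_moebius[of u] u by (simp add: T_def d_def)
        show ?thesis unfolding D A B C
          by (simp add: power_mult_distrib power_divide power_add power2_eq_square mult_ac)
      qed
      moreover have "moebius \<zeta> u \<in> unit_disc" using moebius_in_disc[OF u] by simp
      moreover have "H (moebius \<zeta> u) = ennreal ((cmod (F (moebius \<zeta> u)))\<^sup>2 * (1 - (cmod (moebius \<zeta> u))\<^sup>2) ^ q)"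
        using moebius_in_disc[OF u] by (simp add: H_def F'_def)
      moreover have "ennreal (a * (cmod b)\<^sup>2) = ennreal a * ennreal ((cmod b)\<^sup>2)" for a and b :: complex
        by (rule ennreal_mult'') simp
      moreover have "ennreal (T ^ (q + 2) * b) = ennreal (T ^ (q + 2)) * ennreal b" for b
        using T by (intro ennreal_mult') simp
      ultimately have "H (moebius \<zeta> u) * ennreal ((cmod (deriv (moebius \<zeta>) u))\<^sup>2)
          = ennreal (T ^ (q + 2)) * ennreal ((cmod (Q u))\<^sup>2 * (1 - (cmod u)\<^sup>2) ^ q)"
        by metis
      thus ?thesis using True by simp
    qed simp
  qed
  also have "\<dots> = ennreal (T ^ (q + 2)) * (\<integral>\<^sup>+u\<in>unit_disc. ennreal ((cmod (Q u))\<^sup>2 * (1 - (cmod u)\<^sup>2) ^ q) \<partial>lborel)"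
    by (subst nn_integral_cmult) auto
  also have "ennreal (1 / pi) * \<dots> = ennreal (T ^ (q + 2)) * (\<integral>\<^sup>+u\<in>unit_disc. ennreal ((cmod (Q u))\<^sup>2 * (1 - (cmod u)\<^sup>2) ^ q) \<partial>area_measure)"
    by (subst nn_integral_area_measure) (auto simp: mult_ac)
  also have "(\<integral>\<^sup>+u\<in>unit_disc. ennreal ((cmod (Q u))\<^sup>2 * (1 - (cmod u)\<^sup>2) ^ q) \<partial>area_measure)
      = bergman q (\<lambda>u. F (moebius \<zeta> u) / (1 - cnj \<zeta> * u) ^ (q + 2))"
    unfolding bergman_def by (intro nn_integral_cong) (auto simp: Q_def indicator_def)
  finally show ?thesis by (simp add: T_def)
qed

end

section \<open>Point masses in the disc\<close>

lemma higher_deriv_shifted_quotient: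
  assumes g: "g holomorphic_on unit_disc"
  shows "z \<in> unit_disc \<Longrightarrow> (deriv ^^ Suc r) (\<lambda>z. c + (z - \<zeta>) * g z) z
     = (z - \<zeta>) * (deriv ^^ Suc r) g z + of_nat (Suc r) * (deriv ^^ r) g z"
proof (induction r arbitrary: z)
  case 0
  have "(g has_field_derivative deriv g z) (at z)"
    using holomorphic_derivI[OF g _ 0] by simp
  hence "((\<lambda>z. c + (z - \<zeta>) * g z) has_field_derivative ((z - \<zeta>) * deriv g z + g z)) (at z)"
    by (auto intro!: derivative_eq_intros)
  thus ?case by (simp add: DERIV_imp_deriv)
next
  case (Suc r)
  have d: "((deriv ^^ j) g has_field_derivative (deriv ^^ Suc j) g z) (at z)" for j
    using holomorphic_derivI[OF higher_deriv_holomorphic_disc[OF g] _ Suc.prems] by simp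
  have "((\<lambda>z. (z - \<zeta>) * (deriv ^^ Suc r) g z + of_nat (Suc r) * (deriv ^^ r) g z) has_field_derivative
     ((z - \<zeta>) * (deriv ^^ Suc (Suc r)) g z + (deriv ^^ Suc r) g z + of_nat (Suc r) * (deriv ^^ Suc r) g z)) (at z)"
    by (rule derivative_eq_intros d refl | simp del: funpow.simps of_nat_Suc)+
  moreover have "eventually (\<lambda>w. w \<in> unit_disc) (nhds z)"
    using Suc.prems by (intro eventually_nhds_in_open) auto
  hence "eventually (\<lambda>w. (w - \<zeta>) * (deriv ^^ Suc r) g w + of_nat (Suc r) * (deriv ^^ r) g w
      = (deriv ^^ Suc r) (\<lambda>z. c + (z - \<zeta>) * g z) w) (nhds z)"
    by eventually_elim (rule Suc.IH[symmetric])
  ultimately have "((deriv ^^ Suc r) (\<lambda>z. c + (z - \<zeta>) * g z) has_field_derivative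
     ((z - \<zeta>) * (deriv ^^ Suc (Suc r)) g z + (deriv ^^ Suc r) g z + of_nat (Suc r) * (deriv ^^ Suc r) g z)) (at z)"
    using DERIV_cong_ev[OF refl _ refl] by fast
  from DERIV_imp_deriv[OF this] show ?case
    by (simp add: algebra_simps)
qed

text \<open>
  The Euler operator is diagonal on monomials.
\<close>

lemma taylor_coeff_euler_operator:
  assumes X: "X holomorphic_on unit_disc"
  shows "taylor_coeff (\<lambda>u. u * deriv X u + of_nat k * X u) n = of_nat (n + k) * taylor_coeff X n"
proof -
  have "fps_expansion (\<lambda>u. u * deriv X u + of_nat k * X u) 0
     = fps_X * fps_deriv (fps_expansion X 0) + fps_const (of_nat k) * fps_expansion X 0"
    by (intro fps_expansion_eqI fps_expansion_intros taylor_has_fps_expansion X)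
  thus ?thesis by (cases n) (simp_all add: algebra_simps)
qed

context
  fixes \<zeta> :: complex
  assumes \<zeta>: "cmod \<zeta> < 1"
begin

text \<open>
  In the coordinate \<open>u\<close> with \<open>z = moebius \<zeta> u\<close> the point \<open>\<zeta>\<close> becomes the origin. With \<open>f = c + (z - \<zeta>) g\<close>
  the \<open>k\<close>-th derivative of \<open>f\<close> is \<open>(z - \<zeta>) G' + k G\<close> for \<open>G = (deriv ^^ r) g\<close>, and after
  multiplication by the power of \<open>1 - cnj \<zeta> * u\<close> dictated by \<open>bergman_moebius\<close> it becomes
  \<open>u X' + k X\<close>, the same function for every term of the kernel. So the terms differ only in their
  diagonal weights, and the sum over \<open>i\<close> is the one of \<open>sums_fact_ratio\<close>.
\<close>

lemma local_dirichlet_moebius: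
  assumes k: "k = Suc r" and g: "g holomorphic_on unit_disc"
    and f: "f holomorphic_on unit_disc" and fg: "\<And>z. z \<in> unit_disc \<Longrightarrow> f z = c + (z - \<zeta>) * g z"
  defines "X \<equiv> (\<lambda>u. (deriv ^^ r) g (moebius \<zeta> u) / (1 - cnj \<zeta> * u) ^ k)"
  shows "local_dirichlet \<zeta> k f = ennreal ((1 - (cmod \<zeta>)\<^sup>2) ^ k / fact r) *
     (\<Sum>n. ennreal (fact n / fact (n + r) * (cmod (taylor_coeff X n))\<^sup>2))"
    and "X holomorphic_on unit_disc"
proof -
  define T where "T = 1 - (cmod \<zeta>)\<^sup>2"
  have T: "T > 0" using one_minus_norm_sq_pos[OF \<zeta>] by (simp add: T_def)
  have nz: "1 - cnj \<zeta> * u \<noteq> 0" if "cmod u < 1" for u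
    using denominator_nonzero[OF \<zeta>, of u] that by simp
  show hX: "X holomorphic_on unit_disc"
    unfolding X_def using nz
    by (intro holomorphic_intros holomorphic_compose_moebius[OF \<zeta>] higher_deriv_holomorphic_disc g) auto
  define Y where "Y = (\<lambda>u. (deriv ^^ k) f (moebius \<zeta> u) / (1 - cnj \<zeta> * u) ^ (k + 1))"
  have hY: "Y holomorphic_on unit_disc"
    unfolding Y_def using nz
    by (intro holomorphic_intros holomorphic_compose_moebius[OF \<zeta>] higher_deriv_holomorphic_disc f) auto
  have fk: "(deriv ^^ k) f z = (z - \<zeta>) * (deriv ^^ k) g z + of_nat k * (deriv ^^ r) g z" if "z \<in> unit_disc" for z
  proof -
    have "(deriv ^^ k) f z = (deriv ^^ k) (\<lambda>z. c + (z - \<zeta>) * g z) z"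
      using that by (intro higher_deriv_transform_within_open[of _ unit_disc] f fg) (auto intro!: holomorphic_intros g)
    thus ?thesis unfolding k using higher_deriv_shifted_quotient[OF g that] by simp
  qed
  have XY: "Y u = u * deriv X u + of_nat k * X u" if u: "u \<in> unit_disc" for u
  proof -
    have u1: "cmod u < 1" using u by simp
    define d where "d = 1 - cnj \<zeta> * u"
    have d: "d \<noteq> 0" using nz[OF u1] by (simp add: d_def)
    have mu: "moebius \<zeta> u \<in> unit_disc" using moebius_in_disc[OF \<zeta> u1] by simp
    define G1 where "G1 = (deriv ^^ k) g (moebius \<zeta> u)"
    define G0 where "G0 = (deriv ^^ r) g (moebius \<zeta> u)"
    have "((deriv ^^ r) g has_field_derivative G1) (at (moebius \<zeta> u))"
      using holomorphic_derivI[OF higher_deriv_holomorphic_disc[OF g] _ mu, of r] by (simp add: G1_def k)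
    from DERIV_chain2[OF this has_field_derivative_moebius[OF \<zeta> u1]]
    have 1: "((\<lambda>u. (deriv ^^ r) g (moebius \<zeta> u)) has_field_derivative (G1 * (- of_real T / d\<^sup>2))) (at u)"
      by (simp add: T_def d_def)
    have 2: "((\<lambda>u. (1 - cnj \<zeta> * u) ^ k) has_field_derivative (of_nat k * d ^ r * (- cnj \<zeta>))) (at u)"
    proof -
      have "((\<lambda>u. 1 - cnj \<zeta> * u) has_field_derivative - cnj \<zeta>) (at u)"
        by (auto intro!: derivative_eq_intros)
      from DERIV_power[OF this, of k] show ?thesis
        by (simp add: d_def k mult_ac)
    qed
    have "(X has_field_derivative ((G1 * (- of_real T / d\<^sup>2)) * d ^ k - G0 * (of_nat k * d ^ r * (- cnj \<zeta>))) / (d ^ k * d ^ k)) (at u)"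
      unfolding X_def using DERIV_divide[OF 1 2] d by (simp add: d_def G0_def)
    hence dX: "deriv X u = ((G1 * (- of_real T / d\<^sup>2)) * d ^ k - G0 * (of_nat k * d ^ r * (- cnj \<zeta>))) / (d ^ k * d ^ k)"
      by (rule DERIV_imp_deriv)
    have Xu: "X u = G0 / d ^ k" by (simp add: X_def d_def G0_def)
    have "u * deriv X u + of_nat k * X u = ((- u * of_real T / d) * G1 + of_nat k * G0 * (cnj \<zeta> * u + d)) / d ^ (k + 1)"
      unfolding dX Xu using d
      by (simp add: k field_simps power2_eq_square)
    also have "cnj \<zeta> * u + d = 1" by (simp add: d_def)
    also have "- u * of_real T / d = moebius \<zeta> u - \<zeta>"
      using moebius_minus[OF \<zeta>, of u] u1 by (simp add: T_def d_def)
    also have "((moebius \<zeta> u - \<zeta>) * G1 + of_nat k * G0 * 1) / d ^ (k + 1) = Y u"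
      unfolding Y_def fk[OF mu] by (simp add: G1_def G0_def d_def)
    finally show ?thesis ..
  qed
  have tY: "taylor_coeff Y n = of_nat (n + k) * taylor_coeff X n" for n
  proof -
    have "fps_expansion Y 0 = fps_expansion (\<lambda>u. u * deriv X u + of_nat k * X u) 0"
      by (rule taylor_fps_cong) (rule XY)
    thus ?thesis using taylor_coeff_euler_operator[OF hX, of k n] by simp
  qed
  have summand: "ennreal (fact i / (fact (k - 1) * fact (k + i)) * T ^ i) * bergman (k + i) (\<lambda>z. (deriv ^^ k) f z / (1 - cnj \<zeta> * z) ^ Suc i)
     = (\<Sum>n. ennreal (T ^ k / fact r * (fact n * (real (n + k))\<^sup>2 * (cmod (taylor_coeff X n))\<^sup>2)) * ennreal (fact i / fact (n + k + i + 1)))" for i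
  proof -
    define F where "F z = (deriv ^^ k) f z / (1 - cnj \<zeta> * z) ^ Suc i" for z
    have hF: "F holomorphic_on unit_disc"
      unfolding F_def using nz by (intro holomorphic_intros higher_deriv_holomorphic_disc f) auto
    have "bergman (k + i) F = ennreal (T ^ (k + i + 2)) * bergman (k + i) (\<lambda>u. F (moebius \<zeta> u) / (1 - cnj \<zeta> * u) ^ (k + i + 2))"
      unfolding T_def by (rule bergman_moebius[OF \<zeta> hF])
    also have "bergman (k + i) (\<lambda>u. F (moebius \<zeta> u) / (1 - cnj \<zeta> * u) ^ (k + i + 2))
      = (\<integral>\<^sup>+u. ennreal (1 / T ^ (2 * Suc i)) * (ennreal ((cmod (Y u))\<^sup>2 * (1 - (cmod u)\<^sup>2) ^ (k + i)) * indicator unit_disc u) \<partial>area_measure)"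
      unfolding bergman_def
    proof (intro nn_integral_cong)
      fix u :: complex
      show "ennreal ((cmod (F (moebius \<zeta> u) / (1 - cnj \<zeta> * u) ^ (k + i + 2)))\<^sup>2 * (1 - (cmod u)\<^sup>2) ^ (k + i)) * indicator unit_disc u
        = ennreal (1 / T ^ (2 * Suc i)) * (ennreal ((cmod (Y u))\<^sup>2 * (1 - (cmod u)\<^sup>2) ^ (k + i)) * indicator unit_disc u)"
      proof (cases "u \<in> unit_disc")
        case True
        hence u: "cmod u < 1" by simp
        define d where "d = 1 - cnj \<zeta> * u"
        have d: "d \<noteq> 0" using nz[OF u] by (simp add: d_def)
        have "F (moebius \<zeta> u) / d ^ (k + i + 2) = (deriv ^^ k) f (moebius \<zeta> u) / ((of_real T / d) ^ Suc i * d ^ (k + i + 2))"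
          using one_minus_cnj_moebius[OF \<zeta>, of u] u by (simp add: F_def T_def d_def)
        also have "(of_real T / d) ^ Suc i * d ^ (k + i + 2) = of_real T ^ Suc i * d ^ (k + 1)"
        proof -
          have "d ^ (k + i + 2) = d ^ (k + 1) * d ^ Suc i" by (simp flip: power_add)
          thus ?thesis using d by (simp add: power_divide)
        qed
        also have "(deriv ^^ k) f (moebius \<zeta> u) / (of_real T ^ Suc i * d ^ (k + 1)) = Y u / of_real T ^ Suc i"
          by (simp add: Y_def d_def)
        finally have "F (moebius \<zeta> u) / (1 - cnj \<zeta> * u) ^ (k + i + 2) = Y u / of_real T ^ Suc i"
          by (simp add: d_def)
        hence S: "(cmod (F (moebius \<zeta> u) / (1 - cnj \<zeta> * u) ^ (k + i + 2)))\<^sup>2 = (1 / T ^ (2 * Suc i)) * (cmod (Y u))\<^sup>2"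
          using T by (simp only: norm_divide norm_power norm_of_real power_divide mult.commute[of 2] power_mult) simp
        have "0 \<le> 1 / T ^ (2 * Suc i)" using T by simp
        from ennreal_mult'[OF this] show ?thesis
          unfolding S by (simp only: mult.assoc)
      qed simp
    qed
    also have "\<dots> = ennreal (1 / T ^ (2 * Suc i)) * bergman (k + i) Y"
    proof -
      have [measurable]: "(\<lambda>z. if z \<in> unit_disc then Y z else 0) \<in> borel_measurable borel"
        by (intro borel_measurable_on_disc holomorphic_on_imp_continuous_on hY)
      have e: "(\<lambda>u. ennreal ((cmod (Y u))\<^sup>2 * (1 - (cmod u)\<^sup>2) ^ (k + i)) * indicator unit_disc u)
         = (\<lambda>u. ennreal ((cmod (if u \<in> unit_disc then Y u else 0))\<^sup>2 * (1 - (cmod u)\<^sup>2) ^ (k + i)) * indicator unit_disc u)"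
        by (auto simp: fun_eq_iff indicator_def)
      have "(\<lambda>u. ennreal ((cmod (Y u))\<^sup>2 * (1 - (cmod u)\<^sup>2) ^ (k + i)) * indicator unit_disc u) \<in> borel_measurable area_measure"
        unfolding e by measurable
      thus ?thesis unfolding bergman_def by (rule nn_integral_cmult)
    qed
    also have "bergman (k + i) Y = (\<Sum>n. ennreal (fact n * fact (k + i) / fact (n + (k + i) + 1) * (cmod (taylor_coeff Y n))\<^sup>2))"
      by (rule bergman_parseval[OF hY])
    finally have "ennreal (fact i / (fact (k - 1) * fact (k + i)) * T ^ i) * bergman (k + i) F
       = ennreal (fact i / (fact r * fact (k + i)) * T ^ i) * (ennreal (T ^ (k + i + 2)) * (ennreal (1 / T ^ (2 * Suc i)) *
         (\<Sum>n. ennreal (fact n * fact (k + i) / fact (n + (k + i) + 1) * (cmod (taylor_coeff Y n))\<^sup>2))))"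
      by (simp add: k)
    also have "\<dots> = ennreal (fact i / (fact r * fact (k + i)) * T ^ k) *
         (\<Sum>n. ennreal (fact n * fact (k + i) / fact (n + (k + i) + 1) * (cmod (taylor_coeff Y n))\<^sup>2))"
    proof -
      have "T ^ i * (T ^ (k + i + 2) * (1 / T ^ (2 * Suc i))) = T ^ k"
      proof -
        have "T ^ i * T ^ (k + i + 2) = T ^ k * T ^ (2 * Suc i)"
          by (simp add: power_add[symmetric] mult_2 add.left_commute)
        moreover have "x * (y * (1 / z)) = w" if "x * y = w * z" "z > 0" for x y z w :: real
          using that by (simp add: field_simps)
        ultimately show ?thesis using T by (metis zero_less_power)
      qed
      hence "fact i / (fact r * fact (k + i)) * T ^ i * T ^ (k + i + 2) * (1 / T ^ (2 * Suc i)) = fact i / (fact r * fact (k + i)) * T ^ k"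
        by (simp only: mult.assoc)
      moreover have "ennreal a * (ennreal b * (ennreal c * S)) = ennreal (a * b * c) * S" if "0 \<le> a" "0 \<le> b" for a b c S
        using that by (simp add: ennreal_mult' mult.assoc)
      moreover have "0 \<le> fact i / (fact r * fact (k + i)) * T ^ i" "0 \<le> T ^ (k + i + 2)"
        using T by auto
      ultimately show ?thesis by presburger
    qed
    also have "\<dots> = (\<Sum>n. ennreal (T ^ k / fact r * (fact n * (real (n + k))\<^sup>2 * (cmod (taylor_coeff X n))\<^sup>2)) * ennreal (fact i / fact (n + k + i + 1)))"
      unfolding ennreal_suminf_cmult[symmetric]
    proof (intro suminf_cong)
      fix n
      have "fact i / (fact r * fact (k + i)) * T ^ k * (fact n * fact (k + i) / fact (n + (k + i) + 1) * (cmod (taylor_coeff Y n))\<^sup>2)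
        = T ^ k / fact r * (fact n * (real (n + k))\<^sup>2 * (cmod (taylor_coeff X n))\<^sup>2) * (fact i / fact (n + k + i + 1))"
      proof -
        have "(cmod (taylor_coeff Y n))\<^sup>2 = (real (n + k))\<^sup>2 * (cmod (taylor_coeff X n))\<^sup>2"
          unfolding tY norm_mult power_mult_distrib by (simp only: norm_of_nat)
        moreover have "n + (k + i) + 1 = n + k + i + 1" by simp
        ultimately show ?thesis by (simp only:) simp
      qed
      thus "ennreal (fact i / (fact r * fact (k + i)) * T ^ k) * ennreal (fact n * fact (k + i) / fact (n + (k + i) + 1) * (cmod (taylor_coeff Y n))\<^sup>2)
        = ennreal (T ^ k / fact r * (fact n * (real (n + k))\<^sup>2 * (cmod (taylor_coeff X n))\<^sup>2)) * ennreal (fact i / fact (n + k + i + 1))"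
        using T by (subst (1 2) ennreal_mult[symmetric]) auto
    qed
    finally show ?thesis unfolding F_def .
  qed
  have "local_dirichlet \<zeta> k f = (\<Sum>i. \<Sum>n. ennreal (T ^ k / fact r * (fact n * (real (n + k))\<^sup>2 * (cmod (taylor_coeff X n))\<^sup>2)) * ennreal (fact i / fact (n + k + i + 1)))"
    using \<zeta> unfolding summand[symmetric] unfolding T_def by (intro local_dirichlet_eq_suminf_bergman f) simp
  also have "\<dots> = (\<Sum>n. ennreal (T ^ k / fact r * (fact n * (real (n + k))\<^sup>2 * (cmod (taylor_coeff X n))\<^sup>2)) * (\<Sum>i. ennreal (fact i / fact (n + k + i + 1))))"
    by (subst suminf_swap_ennreal) simp
  also have "\<dots> = (\<Sum>n. ennreal (T ^ k / fact r) * ennreal (fact n / fact (n + r) * (cmod (taylor_coeff X n))\<^sup>2))"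
  proof (intro suminf_cong)
    fix n
    have "(\<lambda>i. fact i / fact (n + k + i + 1)) sums (1 / (real (n + k) * fact (n + k)))"
      by (rule sums_fact_ratio) (simp add: k)
    hence "(\<Sum>i. ennreal (fact i / fact (n + k + i + 1))) = ennreal (1 / (real (n + k) * fact (n + k)))"
      by (subst suminf_ennreal2) (auto simp: sums_iff)
    moreover have "T ^ k / fact r * (fact n * (real (n + k))\<^sup>2 * (cmod (taylor_coeff X n))\<^sup>2) * (1 / (real (n + k) * fact (n + k)))
       = T ^ k / fact r * (fact n / fact (n + r) * (cmod (taylor_coeff X n))\<^sup>2)"
    proof -
      have "fact (n + k) = real (n + k) * fact (n + r)" by (simp add: k)
      moreover have "real (n + k) > 0" by (simp add: k)
      moreover have "A * (B * N\<^sup>2 * C) * (1 / (N * (N * D))) = A * (B / D * C)" if "N > 0" "D > 0" for A B C D N :: real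
        using that by (simp add: power2_eq_square)
      ultimately show ?thesis by (metis fact_gt_zero)
    qed
    ultimately show "ennreal (T ^ k / fact r * (fact n * (real (n + k))\<^sup>2 * (cmod (taylor_coeff X n))\<^sup>2)) * (\<Sum>i. ennreal (fact i / fact (n + k + i + 1)))
       = ennreal (T ^ k / fact r) * ennreal (fact n / fact (n + r) * (cmod (taylor_coeff X n))\<^sup>2)"
      using T by (simp flip: ennreal_mult)
  qed
  finally show "local_dirichlet \<zeta> k f = ennreal ((1 - (cmod \<zeta>)\<^sup>2) ^ k / fact r) *
     (\<Sum>n. ennreal (fact n / fact (n + r) * (cmod (taylor_coeff X n))\<^sup>2))"
    by (simp add: T_def)
qed

end

lemma summable_taylor_coeff_larger_disc:
  assumes F: "F holomorphic_on ball 0 R" and R: "R > 1"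
  shows "summable (\<lambda>n. cmod (taylor_coeff F n))"
proof -
  define r where "r = (1 + R) / 2"
  have r: "1 < r" "r < R" using R by (auto simp: r_def)
  have "summable (\<lambda>n. taylor_coeff F n * complex_of_real r ^ n)"
    using holomorphic_power_series[OF F, of "complex_of_real r"] r by (auto simp: fps_expansion_def sums_iff)
  from powser_insidea[OF this, of 1] r show ?thesis by simp
qed

lemma binomial_weighted_suminf_shift:
  fixes x :: "nat \<Rightarrow> real"
  shows "(\<Sum>n. ennreal (real (n choose r) * x n)) = (\<Sum>n. ennreal (real ((n + r) choose r) * x (n + r)))"
proof -
  have "(\<Sum>n. ennreal (real (n choose r) * x n)) = (\<Sum>n. ennreal (real ((n + r) choose r) * x (n + r))) + (\<Sum>n<r. ennreal (real (n choose r) * x n))"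
    by (rule suminf_offset) simp
  moreover have "(\<Sum>n<r. ennreal (real (n choose r) * x n)) = 0"
    by (intro sum.neutral) (simp add: binomial_eq_0)
  ultimately show ?thesis by simp
qed

context
  fixes \<zeta> :: complex
  assumes \<zeta>: "cmod \<zeta> < 1"
begin

text \<open>
  \<open>moebius \<zeta>\<close> is holomorphic beyond the closed unit disc.
\<close>

lemma larger_disc:
  obtains R where "R > 1" "\<And>u :: complex. u \<in> ball 0 R \<Longrightarrow> 1 - cnj \<zeta> * u \<noteq> 0"
proof
  (* Lies strictly between 1 and 1 / |zeta|, also when zeta = 0. *)
  define R where "R = 2 / (1 + cmod \<zeta>)"
  show "R > 1" using \<zeta> by (simp add: R_def field_simps add_pos_nonneg)
  fix u :: complex assume u: "u \<in> ball 0 R"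
  show "1 - cnj \<zeta> * u \<noteq> 0"
  proof
    assume "1 - cnj \<zeta> * u = 0"
    hence "cmod \<zeta> * cmod u = 1" by (metis complex_mod_cnj eq_iff_diff_eq_0 norm_mult norm_one)
    moreover have "cmod \<zeta> * cmod u \<le> cmod \<zeta> * R" using u by (intro mult_left_mono) auto
    moreover have "cmod \<zeta> * R < 1" using \<zeta> by (simp add: R_def field_simps add_pos_nonneg)
    ultimately show False by simp
  qed
qed

text \<open>
  On the circle the Moebius map has modulus one. In terms of coefficients this is the identity
  \<open>|\<zeta> x - y|\<^sup>2 - |x - cnj \<zeta> y|\<^sup>2 = (1 - |\<zeta>|\<^sup>2) (|y|\<^sup>2 - |x|\<^sup>2)\<close>, which telescopes when \<open>x\<close> and \<open>y\<close> are
  consecutive coefficients of \<open>F u / (1 - cnj \<zeta> * u)\<close>.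
\<close>

lemma moebius_mult_isometric:
  assumes R: "R > 1" and nz: "\<And>u. u \<in> ball 0 R \<Longrightarrow> 1 - cnj \<zeta> * u \<noteq> 0" and F: "F holomorphic_on ball 0 R"
  shows "(\<Sum>n. (cmod (taylor_coeff (\<lambda>u. moebius \<zeta> u * F u) n))\<^sup>2) = (\<Sum>n. (cmod (taylor_coeff F n))\<^sup>2)"
proof -
  define q where "q u = F u / (1 - cnj \<zeta> * u)" for u
  have hq: "q holomorphic_on ball 0 R"
    unfolding q_def using nz by (intro holomorphic_intros F) auto
  have hP: "(\<lambda>u. moebius \<zeta> u * F u) holomorphic_on ball 0 R"
    unfolding moebius_def using nz by (intro holomorphic_intros F) auto
  have sub: "unit_disc \<subseteq> ball 0 R" using R by auto
  have hqd: "q holomorphic_on unit_disc" by (rule holomorphic_on_subset[OF hq sub])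
  define a where "a n = taylor_coeff q n" for n
  define T where "T = 1 - (cmod \<zeta>)\<^sup>2"
  have cF: "taylor_coeff F n = a n - cnj \<zeta> * (if n = 0 then 0 else a (n - 1))" for n
  proof -
    have "fps_expansion F 0 = fps_expansion (\<lambda>u. q u * (1 + (- cnj \<zeta>) * u)) 0"
      using nz sub by (intro taylor_fps_cong) (auto simp: q_def)
    also have "\<dots> = fps_expansion q 0 * (fps_const 1 + fps_const (- cnj \<zeta>) * fps_X)"
      by (simp only: taylor_fps_mult[OF hqd holomorphic_on_affine] taylor_fps_linear)
    finally show ?thesis by (simp add: a_def distrib_left mult.assoc[symmetric])
  qed
  have cP: "taylor_coeff (\<lambda>u. moebius \<zeta> u * F u) n = \<zeta> * a n - (if n = 0 then 0 else a (n - 1))" for n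
  proof -
    have "fps_expansion (\<lambda>u. moebius \<zeta> u * F u) 0 = fps_expansion (\<lambda>u. q u * (\<zeta> + (- 1) * u)) 0"
      using nz sub by (intro taylor_fps_cong) (auto simp: q_def moebius_def)
    also have "\<dots> = fps_expansion q 0 * (fps_const \<zeta> + fps_const (- 1) * fps_X)"
      by (simp only: taylor_fps_mult[OF hqd holomorphic_on_affine] taylor_fps_linear)
    finally show ?thesis by (simp add: a_def distrib_left mult.assoc[symmetric])
  qed
  have id: "(cmod (\<zeta> * x - y))\<^sup>2 - (cmod (x - cnj \<zeta> * y))\<^sup>2 = T * (cmod y)\<^sup>2 - T * (cmod x)\<^sup>2" for x y
    unfolding T_def cmod_power2 by (simp add: algebra_simps power2_eq_square)
  have fin: "(\<Sum>n<Suc N. (cmod (taylor_coeff (\<lambda>u. moebius \<zeta> u * F u) n))\<^sup>2)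
      = (\<Sum>n<Suc N. (cmod (taylor_coeff F n))\<^sup>2) - T * (cmod (a N))\<^sup>2" for N
  proof (induction N)
    case 0
    show ?case using id[of "a 0" 0] by (simp add: cF cP)
  next
    case (Suc N)
    show ?case using Suc.IH id[of "a (Suc N)" "a N"]
      unfolding sum.lessThan_Suc[of _ "Suc N"] by (simp add: cF cP)
  qed
  have s1: "summable (\<lambda>n. (cmod (taylor_coeff F n))\<^sup>2)" and s2: "summable (\<lambda>n. (cmod (taylor_coeff (\<lambda>u. moebius \<zeta> u * F u) n))\<^sup>2)"
    by (rule summable_norm_imp_summable_norm_sq[OF summable_taylor_coeff_larger_disc[OF F R]],
        rule summable_norm_imp_summable_norm_sq[OF summable_taylor_coeff_larger_disc[OF hP R]])
  have "summable (\<lambda>n. cmod (a n))" unfolding a_def by (rule summable_taylor_coeff_larger_disc[OF hq R])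
  from summable_LIMSEQ_zero[OF summable_norm_imp_summable_norm_sq[OF this]]
  have "(\<lambda>N. (\<Sum>n<Suc N. (cmod (taylor_coeff F n))\<^sup>2) - T * (cmod (a N))\<^sup>2) \<longlonglongrightarrow> (\<Sum>n. (cmod (taylor_coeff F n))\<^sup>2) - T * 0"
    by (intro tendsto_intros LIMSEQ_Suc summable_LIMSEQ s1)
  moreover have "(\<lambda>N. \<Sum>n<Suc N. (cmod (taylor_coeff (\<lambda>u. moebius \<zeta> u * F u) n))\<^sup>2) \<longlonglongrightarrow> (\<Sum>n. (cmod (taylor_coeff (\<lambda>u. moebius \<zeta> u * F u) n))\<^sup>2)"
    by (intro LIMSEQ_Suc summable_LIMSEQ s2)
  ultimately show ?thesis unfolding fin using LIMSEQ_unique by fastforce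
qed

lemma taylor_coeff_szego:
  "taylor_coeff (\<lambda>u. 1 / (1 - cnj \<zeta> * u)) n = cnj \<zeta> ^ n"
proof -
  define e where "e u = 1 / (1 - cnj \<zeta> * u)" for u
  have nz: "1 - cnj \<zeta> * u \<noteq> 0" if "cmod u < 1" for u
    using denominator_nonzero[OF \<zeta>, of u] that by simp
  have he: "e holomorphic_on unit_disc" unfolding e_def using nz by (intro holomorphic_intros) auto
  have "fps_expansion (\<lambda>u. 1 + 0 * u :: complex) 0 = fps_expansion (\<lambda>u. e u * (1 + (- cnj \<zeta>) * u)) 0"
    using nz by (intro taylor_fps_cong) (auto simp: e_def)
  also have "\<dots> = fps_expansion e 0 * (fps_const 1 + fps_const (- cnj \<zeta>) * fps_X)"
    by (simp only: taylor_fps_mult[OF he holomorphic_on_affine] taylor_fps_linear)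
  finally have eq: "fps_const 1 + fps_const 0 * fps_X = fps_expansion e 0 * (fps_const 1 + fps_const (- cnj \<zeta>) * fps_X)"
    by (simp only: taylor_fps_linear)
  have rec: "(if n = 0 then 1 else 0) = taylor_coeff e n - cnj \<zeta> * (if n = 0 then 0 else taylor_coeff e (n - 1))" for n
    using arg_cong[OF eq, of "\<lambda>F. fps_nth F n"] by (simp add: distrib_left mult.assoc[symmetric])
  have "taylor_coeff e n = cnj \<zeta> ^ n"
  proof (induction n)
    case 0 show ?case using rec[of 0] by simp
  next
    case (Suc n) thus ?case using rec[of "Suc n"] by simp
  qed
  thus ?thesis by (simp add: e_def[abs_def])
qed

text \<open>
  Induction by Horner's scheme. Apart from the constant term, the function has a factor \<open>moebius \<zeta> u\<close>;
  it vanishes at \<open>\<zeta>\<close> and is therefore orthogonal to the reproducing kernel \<open>1 / (1 - cnj \<zeta> * u)\<close>, and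
  removing the factor preserves the norm by \<open>moebius_mult_isometric\<close>.
\<close>

lemma hardy_moebius_polynomial:
  "(\<Sum>n. (cmod (taylor_coeff (\<lambda>u. (\<Sum>j<N. b j * moebius \<zeta> u ^ j) / (1 - cnj \<zeta> * u)) n))\<^sup>2)
     = (\<Sum>j<N. (cmod (b j))\<^sup>2) / (1 - (cmod \<zeta>)\<^sup>2)"
proof (induction N arbitrary: b)
  case 0
  show ?case by (simp add: fps_expansion_def)
next
  case (Suc N)
  obtain R where R: "R > 1" and nz: "\<And>u. u \<in> ball 0 R \<Longrightarrow> 1 - cnj \<zeta> * u \<noteq> 0"
    using larger_disc by blast
  have sub: "unit_disc \<subseteq> ball 0 R" using R by auto
  define T where "T = 1 - (cmod \<zeta>)\<^sup>2"
  have T: "T > 0" using one_minus_norm_sq_pos[OF \<zeta>] by (simp add: T_def)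
  define X where "X u = (\<Sum>j<N. b (Suc j) * moebius \<zeta> u ^ j) / (1 - cnj \<zeta> * u)" for u
  define P where "P u = moebius \<zeta> u * X u" for u
  have hX: "X holomorphic_on ball 0 R"
    unfolding X_def moebius_def using nz by (intro holomorphic_intros) auto
  have hP: "P holomorphic_on ball 0 R"
    unfolding P_def moebius_def using nz by (intro holomorphic_intros hX) auto
  define e where "e u = 1 / (1 - cnj \<zeta> * u)" for u
  have he: "e holomorphic_on unit_disc"
    unfolding e_def using nz sub by (intro holomorphic_intros) auto
  have hPd: "P holomorphic_on unit_disc" by (rule holomorphic_on_subset[OF hP sub])
  have co: "taylor_coeff (\<lambda>u. (\<Sum>j<Suc N. b j * moebius \<zeta> u ^ j) / (1 - cnj \<zeta> * u)) n = b 0 * cnj \<zeta> ^ n + taylor_coeff P n" for n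
  proof -
    have "(\<lambda>u. (\<Sum>j<Suc N. b j * moebius \<zeta> u ^ j) / (1 - cnj \<zeta> * u)) = (\<lambda>u. b 0 * e u + P u)"
      by (auto simp: fun_eq_iff e_def P_def X_def sum.lessThan_Suc_shift sum_distrib_left add_divide_distrib mult_ac simp del: sum.lessThan_Suc)
    moreover have "fps_expansion (\<lambda>u. b 0 * e u + P u) 0 = fps_const (b 0) * fps_expansion e 0 + fps_expansion P 0"
      by (intro fps_expansion_eqI fps_expansion_intros taylor_has_fps_expansion he hPd)
    ultimately show ?thesis using taylor_coeff_szego[of n] by (simp add: e_def[abs_def])
  qed
  have sP: "summable (\<lambda>n. cmod (taylor_coeff P n))" by (rule summable_taylor_coeff_larger_disc[OF hP R])
  have sP2: "summable (\<lambda>n. (cmod (taylor_coeff P n))\<^sup>2)" by (rule summable_norm_imp_summable_norm_sq[OF sP])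
  have P0: "(\<lambda>n. taylor_coeff P n * \<zeta> ^ n) sums 0"
    using taylor_sums[OF hPd, of \<zeta>] \<zeta> by (simp add: P_def moebius_def)
  have cross: "(\<lambda>n. 2 * Re (b 0 * cnj \<zeta> ^ n * cnj (taylor_coeff P n))) sums 0"
  proof -
    have "(\<lambda>n. cnj (b 0) * (taylor_coeff P n * \<zeta> ^ n)) sums (cnj (b 0) * 0)"
      by (intro sums_mult P0)
    hence "(\<lambda>n. 2 * Re (cnj (b 0) * (taylor_coeff P n * \<zeta> ^ n))) sums (2 * Re (cnj (b 0) * 0))"
      by (rule sums_mult[OF sums_Re])
    moreover have "Re (b 0 * cnj \<zeta> ^ n * cnj (taylor_coeff P n)) = Re (cnj (b 0) * (taylor_coeff P n * \<zeta> ^ n))" for n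
    proof -
      have "b 0 * cnj \<zeta> ^ n * cnj (taylor_coeff P n) = cnj (cnj (b 0) * (taylor_coeff P n * \<zeta> ^ n))" by simp
      thus ?thesis by (simp only: cnj.sel(1))
    qed
    ultimately show ?thesis by simp
  qed
  have geo: "(\<lambda>n. (cmod (b 0 * cnj \<zeta> ^ n))\<^sup>2) sums ((cmod (b 0))\<^sup>2 / T)"
  proof -
    have "(\<lambda>n. ((cmod \<zeta>)\<^sup>2) ^ n) sums (1 / (1 - (cmod \<zeta>)\<^sup>2))"
      using \<zeta> by (intro geometric_sums) (simp add: abs_square_less_1)
    from sums_mult[OF this, of "(cmod (b 0))\<^sup>2"] show ?thesis
      by (simp add: norm_mult norm_power power_mult_distrib T_def mult.commute flip: power_mult)
  qed
  have "(\<lambda>n. (cmod (b 0 * cnj \<zeta> ^ n + taylor_coeff P n))\<^sup>2) sums ((cmod (b 0))\<^sup>2 / T + (\<Sum>n. (cmod (taylor_coeff P n))\<^sup>2) + 0)"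
    unfolding cmod_add_sq by (intro sums_add geo cross summable_sums sP2)
  hence "(\<Sum>n. (cmod (b 0 * cnj \<zeta> ^ n + taylor_coeff P n))\<^sup>2) = (cmod (b 0))\<^sup>2 / T + (\<Sum>n. (cmod (taylor_coeff P n))\<^sup>2)"
    by (simp add: sums_iff)
  also have "(\<Sum>n. (cmod (taylor_coeff P n))\<^sup>2) = (\<Sum>n. (cmod (taylor_coeff X n))\<^sup>2)"
    unfolding P_def[abs_def] by (rule moebius_mult_isometric[OF R nz hX])
  also have "\<dots> = (\<Sum>j<N. (cmod (b (Suc j)))\<^sup>2) / T"
    unfolding X_def[abs_def] T_def by (rule Suc.IH)
  finally show ?case unfolding co unfolding sum.lessThan_Suc_shift[of _ N] T_def by (simp add: add_divide_distrib)
qed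

text \<open>
  The Taylor polynomials of \<open>g\<close> satisfy \<open>hardy_moebius_polynomial\<close>; their transforms converge
  uniformly near the origin, hence coefficientwise, and finite partial sums pass to the limit.
\<close>

lemma hardy_moebius_le:
  assumes g: "g holomorphic_on unit_disc"
  shows "ennreal (1 - (cmod \<zeta>)\<^sup>2) * (\<Sum>n. ennreal ((cmod (taylor_coeff (\<lambda>u. g (moebius \<zeta> u) / (1 - cnj \<zeta> * u)) n))\<^sup>2))
     \<le> (\<Sum>n. ennreal ((cmod (taylor_coeff g n))\<^sup>2))"
proof (cases "summable (\<lambda>n. (cmod (taylor_coeff g n))\<^sup>2)")
  case False
  hence "(\<Sum>n. ennreal ((cmod (taylor_coeff g n))\<^sup>2)) = top"
    by (metis summable_suminf_not_top zero_le_power2)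
  thus ?thesis by simp
next
  case True
  define T where "T = 1 - (cmod \<zeta>)\<^sup>2"
  have T: "T > 0" using one_minus_norm_sq_pos[OF \<zeta>] by (simp add: T_def)
  define b where "b = taylor_coeff g"
  define E where "E = (\<Sum>n. (cmod (b n))\<^sup>2)"
  define X where "X u = g (moebius \<zeta> u) / (1 - cnj \<zeta> * u)" for u
  define XN where "XN N u = (\<Sum>j<N. b j * moebius \<zeta> u ^ j) / (1 - cnj \<zeta> * u)" for N u
  obtain R where R: "R > 1" and nz: "\<And>u. u \<in> ball 0 R \<Longrightarrow> 1 - cnj \<zeta> * u \<noteq> 0"
    using larger_disc by blast
  have hXN: "XN N holomorphic_on ball 0 R" for N
    unfolding XN_def moebius_def using nz by (intro holomorphic_intros) auto
  have sub: "unit_disc \<subseteq> ball 0 R" using R by auto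
  have sXN: "summable (\<lambda>n. (cmod (taylor_coeff (XN N) n))\<^sup>2)" for N
    by (rule summable_norm_imp_summable_norm_sq[OF summable_taylor_coeff_larger_disc[OF hXN R]])
  have coef: "(\<lambda>N. taylor_coeff (XN N) n) \<longlonglongrightarrow> taylor_coeff X n" for n
  proof -
    have "compact (moebius \<zeta> ` cball 0 (1/2))"
      using holomorphic_on_imp_continuous_on[OF moebius_holomorphic[OF \<zeta>]]
      by (intro compact_continuous_image) (auto elim: continuous_on_subset)
    moreover have "moebius \<zeta> ` cball 0 (1/2) \<noteq> {}" by auto
    ultimately obtain w where w: "w \<in> moebius \<zeta> ` cball 0 (1/2)" "\<And>v. v \<in> moebius \<zeta> ` cball 0 (1/2) \<Longrightarrow> cmod v \<le> cmod w"
      using continuous_attains_sup[of "moebius \<zeta> ` cball 0 (1/2)" cmod] by (auto intro: continuous_intros)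
    define \<rho> where "\<rho> = cmod w"
    have \<rho>: "\<rho> < 1" using w(1) moebius_in_disc[OF \<zeta>] by (auto simp: \<rho>_def)
    define C where "C = 1 / (1 - cmod \<zeta>)"
    have bound: "cmod (b j * moebius \<zeta> u ^ j / (1 - cnj \<zeta> * u)) \<le> cmod (b j * of_real \<rho> ^ j) * C" if u: "u \<in> ball 0 (1/2)" for u j
    proof -
      have "cmod (moebius \<zeta> u) \<le> \<rho>" using w(2)[of "moebius \<zeta> u"] u by (auto simp: \<rho>_def)
      hence 1: "cmod (moebius \<zeta> u) ^ j \<le> \<rho> ^ j" by (intro power_mono) auto
      have "1 - cmod \<zeta> \<le> cmod 1 - cmod (cnj \<zeta> * u)"
        using u mult_left_le[of "cmod u" "cmod \<zeta>"] by (simp add: norm_mult)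
      also have "\<dots> \<le> cmod (1 - cnj \<zeta> * u)" by (rule norm_triangle_ineq2)
      finally have 2: "1 / cmod (1 - cnj \<zeta> * u) \<le> C"
        unfolding C_def using \<zeta> by (intro divide_left_mono mult_pos_pos) auto
      have "cmod (b j * moebius \<zeta> u ^ j / (1 - cnj \<zeta> * u)) = (cmod (b j) * cmod (moebius \<zeta> u) ^ j) * (1 / cmod (1 - cnj \<zeta> * u))"
        by (simp add: norm_mult norm_divide norm_power)
      also have "\<dots> \<le> (cmod (b j) * \<rho> ^ j) * C"
        using 1 2 \<rho> by (intro mult_mono) (auto simp: \<rho>_def)
      finally show ?thesis by (simp add: norm_mult norm_power \<rho>_def)
    qed
    have "summable (\<lambda>j. cmod (b j * of_real \<rho> ^ j) * C)"
      using summable_norm_taylor[OF g, of "of_real \<rho>"] \<rho> unfolding b_def by (intro summable_mult2) (auto simp: \<rho>_def)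
    hence ul: "uniform_limit (ball 0 (1/2)) (\<lambda>N u. \<Sum>j<N. b j * moebius \<zeta> u ^ j / (1 - cnj \<zeta> * u)) (\<lambda>u. \<Sum>j. b j * moebius \<zeta> u ^ j / (1 - cnj \<zeta> * u)) sequentially"
      by (intro Weierstrass_m_test[OF bound])
    have eqX: "(\<Sum>j. b j * moebius \<zeta> u ^ j / (1 - cnj \<zeta> * u)) = X u" if "u \<in> ball 0 (1/2)" for u
    proof -
      have "moebius \<zeta> u \<in> unit_disc" using moebius_in_disc[OF \<zeta>, of u] that by simp
      from sums_divide[OF taylor_sums[OF g this], of "1 - cnj \<zeta> * u"] show ?thesis
        by (simp add: sums_iff X_def b_def)
    qed
    have ul': "uniform_limit (ball 0 (1/2)) XN X sequentially"
      using ul by (rule uniform_limit_cong'[THEN iffD1, rotated -1]) (auto simp: XN_def sum_divide_distrib eqX)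
    have "((\<lambda>N. (deriv ^^ n) (XN N) 0) \<longlongrightarrow> (deriv ^^ n) X 0) sequentially"
    proof (rule higher_deriv_complex_uniform_limit[OF ul'])
      show "eventually (\<lambda>N. XN N holomorphic_on ball 0 (1/2)) sequentially"
        using hXN R by (intro always_eventually allI holomorphic_on_subset[OF hXN]) auto
    qed auto
    thus ?thesis unfolding fps_expansion_def by (simp add: tendsto_divide)
  qed
  (* Partial sums in n are continuous under coefficientwise convergence in N. *)
  have "T * (\<Sum>n<M. (cmod (taylor_coeff X n))\<^sup>2) \<le> E" for M
  proof (rule LIMSEQ_le_const2)
    show "(\<lambda>N. T * (\<Sum>n<M. (cmod (taylor_coeff (XN N) n))\<^sup>2)) \<longlonglongrightarrow> T * (\<Sum>n<M. (cmod (taylor_coeff X n))\<^sup>2)"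
      by (intro tendsto_intros coef)
    have "T * (\<Sum>n<M. (cmod (taylor_coeff (XN N) n))\<^sup>2) \<le> E" for N
    proof -
      have "T * (\<Sum>n<M. (cmod (taylor_coeff (XN N) n))\<^sup>2) \<le> T * (\<Sum>n. (cmod (taylor_coeff (XN N) n))\<^sup>2)"
        using T by (intro mult_left_mono sum_le_suminf sXN) auto
      also have "\<dots> = (\<Sum>j<N. (cmod (b j))\<^sup>2)"
        using hardy_moebius_polynomial[of b N] T unfolding XN_def[abs_def] T_def by simp
      also have "\<dots> \<le> E" unfolding E_def b_def by (intro sum_le_suminf True) auto
      finally show ?thesis .
    qed
    thus "\<exists>N0. \<forall>N\<ge>N0. T * (\<Sum>n<M. (cmod (taylor_coeff (XN N) n))\<^sup>2) \<le> E" by blast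
  qed
  hence bd: "(\<Sum>n<M. (cmod (taylor_coeff X n))\<^sup>2) \<le> E / T" for M
    using T by (simp add: field_simps)
  have sX: "summable (\<lambda>n. (cmod (taylor_coeff X n))\<^sup>2)"
    using bd by (intro summableI_nonneg_bounded) auto
  have "(\<Sum>n. (cmod (taylor_coeff X n))\<^sup>2) \<le> E / T"
    using bd by (intro suminf_le_const sX) auto
  hence "T * (\<Sum>n. (cmod (taylor_coeff X n))\<^sup>2) \<le> E" using T by (simp add: field_simps)
  hence "ennreal (T * (\<Sum>n. (cmod (taylor_coeff X n))\<^sup>2)) \<le> ennreal E" by (rule ennreal_leI)
  moreover have "ennreal (T * (\<Sum>n. (cmod (taylor_coeff X n))\<^sup>2)) = ennreal T * (\<Sum>n. ennreal ((cmod (taylor_coeff X n))\<^sup>2))"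
    using T by (subst ennreal_mult') (auto simp: suminf_ennreal2 sX)
  moreover have "ennreal E = (\<Sum>n. ennreal ((cmod (taylor_coeff g n))\<^sup>2))"
    unfolding E_def b_def by (subst suminf_ennreal2) (auto simp: True)
  ultimately show ?thesis by (simp add: T_def X_def[abs_def])
qed

text \<open>
  The transformation is an involution up to the factor \<open>1 - (cmod \<zeta>)\<^sup>2\<close>, so applying
  \<open>hardy_moebius_le\<close> to the transform of \<open>g\<close> gives the reverse inequality.
\<close>

lemma hardy_moebius:
  assumes g: "g holomorphic_on unit_disc"
  shows "ennreal (1 - (cmod \<zeta>)\<^sup>2) * (\<Sum>n. ennreal ((cmod (taylor_coeff (\<lambda>u. g (moebius \<zeta> u) / (1 - cnj \<zeta> * u)) n))\<^sup>2))
     = (\<Sum>n. ennreal ((cmod (taylor_coeff g n))\<^sup>2))"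
proof (rule antisym[OF hardy_moebius_le[OF g]])
  define T where "T = 1 - (cmod \<zeta>)\<^sup>2"
  have T: "T > 0" using one_minus_norm_sq_pos[OF \<zeta>] by (simp add: T_def)
  have nz: "1 - cnj \<zeta> * u \<noteq> 0" if "cmod u < 1" for u
    using denominator_nonzero[OF \<zeta>, of u] that by simp
  define X where "X u = g (moebius \<zeta> u) / (1 - cnj \<zeta> * u)" for u
  have hX: "X holomorphic_on unit_disc"
    unfolding X_def using nz by (intro holomorphic_intros holomorphic_compose_moebius[OF \<zeta>] g) auto
  have "fps_expansion (\<lambda>u. X (moebius \<zeta> u) / (1 - cnj \<zeta> * u)) 0 = fps_expansion (\<lambda>u. of_real (1 / T) * g u) 0"
  proof (rule taylor_fps_cong)
    fix u assume "u \<in> unit_disc"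
    hence u: "cmod u < 1" by simp
    show "X (moebius \<zeta> u) / (1 - cnj \<zeta> * u) = of_real (1 / T) * g u"
      unfolding X_def moebius_moebius[OF \<zeta> u] using one_minus_cnj_moebius[OF \<zeta>, of u] nz[OF u] u T
      by (simp add: T_def del: of_real_diff)
  qed
  also have "\<dots> = fps_const (of_real (1 / T)) * fps_expansion g 0"
    by (intro fps_expansion_eqI fps_expansion_intros taylor_has_fps_expansion g)
  finally have co: "taylor_coeff (\<lambda>u. X (moebius \<zeta> u) / (1 - cnj \<zeta> * u)) n = of_real (1 / T) * taylor_coeff g n" for n
    by simp
  have "ennreal T * (\<Sum>n. ennreal ((cmod (of_real (1 / T) * taylor_coeff g n))\<^sup>2)) \<le> (\<Sum>n. ennreal ((cmod (taylor_coeff X n))\<^sup>2))"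
    using hardy_moebius_le[OF hX] unfolding co T_def .
  hence "ennreal T * (ennreal T * (\<Sum>n. ennreal ((cmod (of_real (1 / T) * taylor_coeff g n))\<^sup>2))) \<le> ennreal T * (\<Sum>n. ennreal ((cmod (taylor_coeff X n))\<^sup>2))"
    by (rule mult_left_mono) simp
  also have "ennreal T * (ennreal T * (\<Sum>n. ennreal ((cmod (of_real (1 / T) * taylor_coeff g n))\<^sup>2))) = (\<Sum>n. ennreal ((cmod (taylor_coeff g n))\<^sup>2))"
    unfolding ennreal_suminf_cmult[symmetric]
  proof (intro suminf_cong)
    fix n
    have "T * (T * (cmod (of_real (1 / T) * taylor_coeff g n))\<^sup>2) = (cmod (taylor_coeff g n))\<^sup>2"
      using T by (simp add: norm_mult norm_divide power_mult_distrib power_divide power2_eq_square)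
    thus "ennreal T * (ennreal T * ennreal ((cmod (of_real (1 / T) * taylor_coeff g n))\<^sup>2)) = ennreal ((cmod (taylor_coeff g n))\<^sup>2)"
      using ennreal_mult'[of T] T by (metis less_imp_le)
  qed
  finally show "(\<Sum>n. ennreal ((cmod (taylor_coeff g n))\<^sup>2)) \<le> ennreal (1 - (cmod \<zeta>)\<^sup>2) * (\<Sum>n. ennreal ((cmod (taylor_coeff (\<lambda>u. g (moebius \<zeta> u) / (1 - cnj \<zeta> * u)) n))\<^sup>2))"
    by (simp add: T_def X_def[abs_def])
qed

text \<open>
  The series of \<open>local_dirichlet_moebius\<close> is transformed back to the coordinate \<open>z\<close>: for \<open>k \<ge> 2\<close> it is an
  area integral of \<open>(deriv ^^ (k - 1)) g\<close> and \<open>bergman_moebius\<close> applies, for \<open>k = 1\<close> it is a Hardy norm.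
\<close>

theorem local_dirichlet_disc_eq:
  assumes k: "k \<ge> 1" and g: "g holomorphic_on unit_disc"
    and f: "f holomorphic_on unit_disc" and fg: "\<And>z. z \<in> unit_disc \<Longrightarrow> f z = c + (z - \<zeta>) * g z"
  shows "local_dirichlet \<zeta> k f = (\<Sum>n. ennreal (real (n choose (k - 1)) * (cmod (taylor_coeff g n))\<^sup>2))"
proof -
  obtain r where r: "k = Suc r" using k by (cases k) auto
  define T where "T = 1 - (cmod \<zeta>)\<^sup>2"
  have T: "T > 0" using one_minus_norm_sq_pos[OF \<zeta>] by (simp add: T_def)
  define X where "X = (\<lambda>u. (deriv ^^ r) g (moebius \<zeta> u) / (1 - cnj \<zeta> * u) ^ k)"
  have hX: "X holomorphic_on unit_disc"
    unfolding X_def by (rule local_dirichlet_moebius(2)[OF \<zeta> r g f fg])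
  have L: "local_dirichlet \<zeta> k f = ennreal (T ^ k / fact r) * (\<Sum>n. ennreal (fact n / fact (n + r) * (cmod (taylor_coeff X n))\<^sup>2))"
    unfolding X_def T_def by (rule local_dirichlet_moebius(1)[OF \<zeta> r g f fg])
  show ?thesis
  proof (cases r)
    case 0
    have "ennreal T * (\<Sum>n. ennreal ((cmod (taylor_coeff X n))\<^sup>2)) = (\<Sum>n. ennreal ((cmod (taylor_coeff g n))\<^sup>2))"
      using hardy_moebius[OF g] by (simp add: X_def r 0 T_def)
    thus ?thesis unfolding L by (simp add: r 0)
  next
    case (Suc q)
    define G where "G = (deriv ^^ r) g"
    have hG: "G holomorphic_on unit_disc" unfolding G_def by (rule higher_deriv_holomorphic_disc[OF g])
    have kq: "k = q + 2" by (simp add: r Suc)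
    have "ennreal (T ^ k) * bergman q X = bergman q G"
      using bergman_moebius[OF \<zeta> hG, of q] unfolding kq[symmetric] by (simp add: X_def G_def T_def)
    moreover have "bergman q X = ennreal (fact q) * (\<Sum>n. ennreal (fact n / fact (n + r) * (cmod (taylor_coeff X n))\<^sup>2))"
      unfolding bergman_parseval[OF hX] ennreal_suminf_cmult[symmetric]
      by (intro suminf_cong, subst ennreal_mult'[symmetric]) (auto simp: Suc)
    moreover have "bergman q G = ennreal (fact q * fact r) * (\<Sum>n. ennreal (real ((n + r) choose r) * (cmod (taylor_coeff g (n + r)))\<^sup>2))"
      unfolding bergman_parseval[OF hG] ennreal_suminf_cmult[symmetric]
    proof (intro suminf_cong)
      fix n
      have 1: "(cmod (taylor_coeff G n))\<^sup>2 = (fact (n + r) / fact n)\<^sup>2 * (cmod (taylor_coeff g (n + r)))\<^sup>2"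
        unfolding G_def taylor_coeff_higher_deriv norm_mult power_mult_distrib by (simp only: norm_of_real power2_abs)
      have 2: "real ((n + r) choose r) = fact (n + r) / (fact r * fact n)"
        using binomial_fact[of r "n + r", where 'a=real] by simp
      have 3: "n + q + 1 = n + r" by (simp add: Suc)
      have "fact n * fact q / fact (n + q + 1) * (cmod (taylor_coeff G n))\<^sup>2 = fact q * fact r * (real ((n + r) choose r) * (cmod (taylor_coeff g (n + r)))\<^sup>2)"
        unfolding 1 2 3 by (simp add: power2_eq_square)
      thus "ennreal (fact n * fact q / fact (n + q + 1) * (cmod (taylor_coeff G n))\<^sup>2)
         = ennreal (fact q * fact r) * ennreal (real ((n + r) choose r) * (cmod (taylor_coeff g (n + r)))\<^sup>2)"
        by (subst ennreal_mult'[symmetric]) auto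
    qed
    ultimately have eq: "ennreal (T ^ k) * (ennreal (fact q) * (\<Sum>n. ennreal (fact n / fact (n + r) * (cmod (taylor_coeff X n))\<^sup>2)))
       = ennreal (fact q * fact r) * (\<Sum>n. ennreal (real ((n + r) choose r) * (cmod (taylor_coeff g (n + r)))\<^sup>2))"
      by simp
    have m: "ennreal a * (ennreal b * S) = ennreal (a * b) * S" if "0 \<le> a" for a b S
      using that by (simp add: ennreal_mult' mult.assoc)
    have "local_dirichlet \<zeta> k f = ennreal (1 / (fact q * fact r)) * (ennreal (T ^ k) * (ennreal (fact q) * (\<Sum>n. ennreal (fact n / fact (n + r) * (cmod (taylor_coeff X n))\<^sup>2))))"
      unfolding L using T by (simp add: m)
    also have "\<dots> = (\<Sum>n. ennreal (real ((n + r) choose r) * (cmod (taylor_coeff g (n + r)))\<^sup>2))"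
      unfolding eq by (simp add: m)
    also have "\<dots> = (\<Sum>n. ennreal (real (n choose r) * (cmod (taylor_coeff g n))\<^sup>2))"
      by (rule binomial_weighted_suminf_shift[symmetric])
    finally show ?thesis by (simp add: r)
  qed
qed

end

section \<open>Hilbert spaces of functions, adjoints and defect forms\<close>

context
  fixes H :: "('a \<Rightarrow> complex) set" and N :: "('a \<Rightarrow> complex) \<Rightarrow> real"
  assumes HS: "hilbert_function_space H N"
begin

lemma hfs_zero: "(\<lambda>x. 0) \<in> H"
  and hfs_add: "f \<in> H \<Longrightarrow> g \<in> H \<Longrightarrow> (\<lambda>x. f x + g x) \<in> H"
  and hfs_scale: "f \<in> H \<Longrightarrow> (\<lambda>x. c * f x) \<in> H"
  and hfs_norm_nonneg: "f \<in> H \<Longrightarrow> 0 \<le> N f"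
  and hfs_inner_self: "f \<in> H \<Longrightarrow> inner_of N f f = complex_of_real ((N f)\<^sup>2)"
  and hfs_norm_eq_0: "f \<in> H \<Longrightarrow> N f = 0 \<Longrightarrow> f = (\<lambda>x. 0)"
  and hfs_inner_add_left: "f \<in> H \<Longrightarrow> g \<in> H \<Longrightarrow> h \<in> H \<Longrightarrow>
        inner_of N (\<lambda>x. f x + g x) h = inner_of N f h + inner_of N g h"
  and hfs_inner_scale_left: "f \<in> H \<Longrightarrow> g \<in> H \<Longrightarrow> inner_of N (\<lambda>x. c * f x) g = c * inner_of N f g"
  and hfs_inner_cnj: "f \<in> H \<Longrightarrow> g \<in> H \<Longrightarrow> inner_of N g f = cnj (inner_of N f g)"
  and hfs_complete: "(\<And>n::nat. X n \<in> H) \<Longrightarrow> (\<And>e. e > 0 \<Longrightarrow> \<exists>M. \<forall>m\<ge>M. \<forall>n\<ge>M. N (\<lambda>x. X m x - X n x) < e) \<Longrightarrow>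
        \<exists>f\<in>H. (\<lambda>n. N (\<lambda>x. X n x - f x)) \<longlonglongrightarrow> 0"
  using HS unfolding hilbert_function_space_def by blast+

lemma hfs_diff: "f \<in> H \<Longrightarrow> g \<in> H \<Longrightarrow> (\<lambda>x. f x - g x) \<in> H"
  using hfs_add[of f "\<lambda>x. (-1) * g x"] hfs_scale[of g "-1"] by simp

lemma hfs_inner_add_right:
  "f \<in> H \<Longrightarrow> g \<in> H \<Longrightarrow> h \<in> H \<Longrightarrow> inner_of N h (\<lambda>x. f x + g x) = inner_of N h f + inner_of N h g"
  using hfs_inner_cnj[of "\<lambda>x. f x + g x" h] hfs_inner_add_left[of f g h] hfs_add[of f g]
    hfs_inner_cnj[of f h] hfs_inner_cnj[of g h] by simp

lemma hfs_inner_scale_right: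
  "f \<in> H \<Longrightarrow> g \<in> H \<Longrightarrow> inner_of N f (\<lambda>x. c * g x) = cnj c * inner_of N f g"
  using hfs_inner_cnj[of "\<lambda>x. c * g x" f] hfs_inner_scale_left[of g f c] hfs_scale[of g c]
    hfs_inner_cnj[of g f] by simp

lemma hfs_norm_sq_add:
  assumes "f \<in> H" "g \<in> H"
  shows "(N (\<lambda>x. f x + g x))\<^sup>2 = (N f)\<^sup>2 + (N g)\<^sup>2 + 2 * Re (inner_of N f g)"
proof -
  have "complex_of_real ((N (\<lambda>x. f x + g x))\<^sup>2) = inner_of N (\<lambda>x. f x + g x) (\<lambda>x. f x + g x)"
    using assms hfs_add hfs_inner_self by metis
  also have "\<dots> = complex_of_real ((N f)\<^sup>2) + inner_of N f g + cnj (inner_of N f g) + complex_of_real ((N g)\<^sup>2)"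
    using assms by (simp add: hfs_inner_add_left hfs_inner_add_right hfs_add hfs_inner_self hfs_inner_cnj[of f g])
  finally have "Re (complex_of_real ((N (\<lambda>x. f x + g x))\<^sup>2)) = Re (complex_of_real ((N f)\<^sup>2) + inner_of N f g + cnj (inner_of N f g) + complex_of_real ((N g)\<^sup>2))"
    by (rule arg_cong)
  thus ?thesis by simp
qed

lemma hfs_norm_sq_scale: "f \<in> H \<Longrightarrow> (N (\<lambda>x. c * f x))\<^sup>2 = (cmod c)\<^sup>2 * (N f)\<^sup>2"
proof -
  assume f: "f \<in> H"
  have "complex_of_real ((N (\<lambda>x. c * f x))\<^sup>2) = inner_of N (\<lambda>x. c * f x) (\<lambda>x. c * f x)"
    using f hfs_scale hfs_inner_self by metis
  also have "\<dots> = c * (cnj c * complex_of_real ((N f)\<^sup>2))"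
    using f by (simp add: hfs_inner_scale_left hfs_inner_scale_right hfs_scale hfs_inner_self)
  also have "\<dots> = complex_of_real ((cmod c)\<^sup>2 * (N f)\<^sup>2)"
    unfolding of_real_mult complex_norm_square by (simp add: mult.assoc)
  finally show ?thesis by (simp only: of_real_eq_iff)
qed

lemma hfs_norm_scale: "f \<in> H \<Longrightarrow> N (\<lambda>x. c * f x) = cmod c * N f"
  using hfs_norm_sq_scale[of f c] hfs_norm_nonneg[of f] hfs_norm_nonneg[OF hfs_scale, of f c]
  by (metis mult_nonneg_nonneg norm_ge_zero power2_eq_imp_eq power_mult_distrib)

lemma hfs_cauchy_schwarz:
  assumes "f \<in> H" "g \<in> H"
  shows "cmod (inner_of N f g) \<le> N f * N g"
proof (cases "N g = 0")
  case True
  hence "g = (\<lambda>x. 0 * g x)" using hfs_norm_eq_0[OF assms(2)] by auto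
  hence "inner_of N f g = cnj 0 * inner_of N f g"
    using hfs_inner_scale_right[OF assms, of 0] by metis
  thus ?thesis using True by simp
next
  case False
  define c where "c = inner_of N f g / complex_of_real ((N g)\<^sup>2)"
  have ng: "(N g)\<^sup>2 > 0" using False by simp
  have "0 \<le> (N (\<lambda>x. f x + (- c) * g x))\<^sup>2" by simp
  also have "\<dots> = (N f)\<^sup>2 + (cmod c)\<^sup>2 * (N g)\<^sup>2 + 2 * Re (inner_of N f (\<lambda>x. (- c) * g x))"
    unfolding hfs_norm_sq_add[OF assms(1) hfs_scale[OF assms(2)]] hfs_norm_sq_scale[OF assms(2)] by simp
  also have "inner_of N f (\<lambda>x. (- c) * g x) = - (cnj c * inner_of N f g)"
    by (subst hfs_inner_scale_right[OF assms]) simp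
  also have "cnj c * inner_of N f g = complex_of_real ((cmod (inner_of N f g))\<^sup>2 / (N g)\<^sup>2)"
    unfolding of_real_divide complex_norm_square by (simp add: c_def mult.commute)
  also have "(cmod c)\<^sup>2 * (N g)\<^sup>2 = (cmod (inner_of N f g))\<^sup>2 / (N g)\<^sup>2"
  proof -
    have "cmod c = cmod (inner_of N f g) / (N g)\<^sup>2" using ng by (simp add: c_def norm_divide norm_power)
    moreover have "(x / s)\<^sup>2 * s = x\<^sup>2 / s" if "s > 0" for x s :: real
      using that by (simp add: power2_eq_square)
    ultimately show ?thesis using ng by metis
  qed
  finally have "(cmod (inner_of N f g))\<^sup>2 / (N g)\<^sup>2 \<le> (N f)\<^sup>2" by simp
  hence "(cmod (inner_of N f g))\<^sup>2 \<le> (N f * N g)\<^sup>2"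
    using ng by (simp add: field_simps power_mult_distrib)
  thus ?thesis using hfs_norm_nonneg[OF assms(1)] hfs_norm_nonneg[OF assms(2)] by (auto elim!: power2_le_imp_le)
qed

text \<open>
  A representing vector is found as a minimizer of \<open>J f = (N f)\<^sup>2 - 2 Re (\<phi> f)\<close>. The parallelogram law
  makes minimizing sequences Cauchy, and the first variation of \<open>J\<close> at the minimizer in the directions
  \<open>g\<close> and \<open>\<i> g\<close> is the representation formula.
\<close>

lemma hfs_riesz:
  assumes add: "\<And>f g. f \<in> H \<Longrightarrow> g \<in> H \<Longrightarrow> \<phi> (\<lambda>x. f x + g x) = \<phi> f + \<phi> g"
    and scale: "\<And>c f. f \<in> H \<Longrightarrow> \<phi> (\<lambda>x. c * f x) = c * \<phi> f"
    and bd: "\<And>f. f \<in> H \<Longrightarrow> cmod (\<phi> f) \<le> C * N f"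
  shows "\<exists>h\<in>H. \<forall>f\<in>H. \<phi> f = inner_of N f h"
proof -
  define J where "J f = (N f)\<^sup>2 - 2 * Re (\<phi> f)" for f
  have low: "J f \<ge> - C\<^sup>2" if "f \<in> H" for f
  proof -
    have "Re (\<phi> f) \<le> C * N f" using bd[OF that] complex_Re_le_cmod order_trans by blast
    moreover have "0 \<le> (N f - C)\<^sup>2" by simp
    ultimately show ?thesis unfolding J_def by (simp add: power2_diff algebra_simps)
  qed
  define m where "m = Inf (J ` H)"
  have bdd: "bdd_below (J ` H)" using low by (intro bdd_belowI2[of _ "- C\<^sup>2"]) auto
  have mle: "m \<le> J f" if "f \<in> H" for f unfolding m_def using that by (intro cInf_lower bdd) auto
  have "\<exists>f\<in>H. J f < m + 1 / real (Suc n)" for n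
  proof -
    have "m < m + 1 / real (Suc n)" by simp
    then obtain y where "y \<in> J ` H" "y < m + 1 / real (Suc n)"
      unfolding m_def using hfs_zero cInf_lessD[of "J ` H"] by (metis empty_iff image_eqI)
    thus ?thesis by blast
  qed
  then obtain X where X: "\<And>n. X n \<in> H" "\<And>n. J (X n) < m + 1 / real (Suc n)" by metis
  have par: "(N (\<lambda>x. f x - g x))\<^sup>2 \<le> 2 * (J f - m) + 2 * (J g - m)" if fg: "f \<in> H" "g \<in> H" for f g
  proof -
    have g': "(\<lambda>x. (-1) * g x) \<in> H" by (rule hfs_scale[OF fg(2)])
    have s: "(\<lambda>x. f x + g x) \<in> H" by (rule hfs_add[OF fg])
    have "(N (\<lambda>x. f x + (-1) * g x))\<^sup>2 = (N f)\<^sup>2 + (N (\<lambda>x. (-1) * g x))\<^sup>2 + 2 * Re (inner_of N f (\<lambda>x. (-1) * g x))"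
      by (rule hfs_norm_sq_add[OF fg(1) g'])
    also have "inner_of N f (\<lambda>x. (-1) * g x) = - inner_of N f g"
      by (subst hfs_inner_scale_right[OF fg]) simp
    also have "(N (\<lambda>x. (-1) * g x))\<^sup>2 = (N g)\<^sup>2" by (subst hfs_norm_sq_scale[OF fg(2)]) simp
    finally have 1: "(N (\<lambda>x. f x - g x))\<^sup>2 = (N f)\<^sup>2 + (N g)\<^sup>2 - 2 * Re (inner_of N f g)" by simp
    have "J (\<lambda>x. (1/2) * (f x + g x)) = (1/4) * (N (\<lambda>x. f x + g x))\<^sup>2 - Re (\<phi> f + \<phi> g)"
      unfolding J_def by (subst hfs_norm_sq_scale[OF s], subst scale[OF s], subst add[OF fg]) (simp add: power2_eq_square norm_divide field_simps)
    hence "m \<le> (1/4) * (N (\<lambda>x. f x + g x))\<^sup>2 - Re (\<phi> f + \<phi> g)"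
      using mle[OF hfs_scale[OF s]] by metis
    thus ?thesis unfolding 1 hfs_norm_sq_add[OF fg] J_def by (simp add: field_simps)
  qed
  have "\<exists>f\<in>H. (\<lambda>n. N (\<lambda>x. X n x - f x)) \<longlonglongrightarrow> 0"
  proof (rule hfs_complete[OF X(1)])
    fix e :: real assume e: "e > 0"
    obtain M where M: "real M > 4 / e\<^sup>2" using reals_Archimedean2 by blast
    have small: "J (X n) - m < e\<^sup>2 / 4" if "n \<ge> M" for n
    proof -
      have "J (X n) - m < 1 / real (Suc n)" using X(2)[of n] by simp
      also have "1 / real (Suc n) \<le> 1 / (4 / e\<^sup>2)"
        using that M e by (intro divide_left_mono) (auto intro!: mult_pos_pos divide_pos_pos)
      finally show ?thesis by simp
    qed
    have "N (\<lambda>x. X i x - X j x) < e" if "i \<ge> M" "j \<ge> M" for i j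
    proof (rule power2_less_imp_less)
      have "(N (\<lambda>x. X i x - X j x))\<^sup>2 \<le> 2 * (J (X i) - m) + 2 * (J (X j) - m)"
        by (rule par[OF X(1) X(1)])
      also have "\<dots> < 2 * (e\<^sup>2 / 4) + 2 * (e\<^sup>2 / 4)"
        using small[OF that(1)] small[OF that(2)] by (intro add_strict_mono mult_strict_left_mono) auto
      finally show "(N (\<lambda>x. X i x - X j x))\<^sup>2 < e\<^sup>2" by simp
    qed (use e in simp)
    thus "\<exists>M. \<forall>m\<ge>M. \<forall>n\<ge>M. N (\<lambda>x. X m x - X n x) < e" by blast
  qed
  then obtain h where h: "h \<in> H" "(\<lambda>n. N (\<lambda>x. X n x - h x)) \<longlonglongrightarrow> 0" by blast
  have Jh: "J h \<le> m"
  proof (rule LIMSEQ_le_const)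
    define d where "d n = N (\<lambda>x. X n x - h x)" for n
    have d: "d \<longlonglongrightarrow> 0" using h(2) by (simp add: d_def[abs_def])
    have "J h \<le> m + 1 / real (Suc n) + d n * (2 * N h + d n + 2 * \<bar>C\<bar>) + 0" for n
    proof -
      define r where "r = (\<lambda>x. h x - X n x)"
      have rH: "r \<in> H" unfolding r_def by (rule hfs_diff[OF h(1) X(1)])
      have r': "(\<lambda>x. (-1) * r x) = (\<lambda>x. X n x - h x)" by (auto simp: r_def)
      have Nr: "N r = d n" using hfs_norm_scale[OF rH, of "-1"] unfolding r' d_def by simp
      have hX: "(\<lambda>x. h x + (-1) * r x) = X n" by (auto simp: r_def)
      have "(N (X n))\<^sup>2 = (N h)\<^sup>2 + (N (\<lambda>x. (-1) * r x))\<^sup>2 + 2 * Re (inner_of N h (\<lambda>x. (-1) * r x))"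
        using hfs_norm_sq_add[OF h(1) hfs_scale[OF rH, of "-1"]] unfolding hX .
      also have "inner_of N h (\<lambda>x. (-1) * r x) = - inner_of N h r"
        by (subst hfs_inner_scale_right[OF h(1) rH]) simp
      finally have 1: "(N h)\<^sup>2 \<le> (N (X n))\<^sup>2 + 2 * Re (inner_of N h r)" by simp
      have "Re (inner_of N h r) \<le> N h * d n"
        using hfs_cauchy_schwarz[OF h(1) rH] complex_Re_le_cmod[of "inner_of N h r"] Nr by simp
      moreover have "\<phi> (X n) = \<phi> h + (-1) * \<phi> r"
        using add[OF h(1) hfs_scale[OF rH, of "-1"]] scale[OF rH, of "-1"] unfolding hX by simp
      moreover have "- Re (\<phi> r) \<le> \<bar>C\<bar> * d n"
      proof -
        have "- Re (\<phi> r) \<le> cmod (\<phi> r)" using abs_Re_le_cmod[of "\<phi> r"] by linarith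
        also have "\<dots> \<le> C * d n" using bd[OF rH] Nr by simp
        also have "\<dots> \<le> \<bar>C\<bar> * d n" using hfs_norm_nonneg[OF rH] Nr by (intro mult_right_mono) auto
        finally show ?thesis .
      qed
      ultimately have "J h \<le> J (X n) + 2 * (N h * d n) + 2 * (\<bar>C\<bar> * d n)"
        using 1 by (simp add: J_def)
      moreover have "0 \<le> d n * d n" by simp
      moreover have "d n * (2 * N h + d n + 2 * \<bar>C\<bar>) = d n * d n + 2 * (N h * d n) + 2 * (\<bar>C\<bar> * d n)"
        by (simp add: algebra_simps)
      ultimately show ?thesis using X(2)[of n] by linarith
    qed
    thus "\<exists>k. \<forall>n\<ge>k. J h \<le> m + 1 / real (Suc n) + d n * (2 * N h + d n + 2 * \<bar>C\<bar>) + 0" by blast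
    have "(\<lambda>n. m + 1 / real (Suc n) + d n * (2 * N h + d n + 2 * \<bar>C\<bar>) + 0) \<longlonglongrightarrow> m + 0 + 0 * (2 * N h + 0 + 2 * \<bar>C\<bar>) + 0"
      using LIMSEQ_inverse_real_of_nat by (intro tendsto_intros d) (simp add: inverse_eq_divide)
    thus "(\<lambda>n. m + 1 / real (Suc n) + d n * (2 * N h + d n + 2 * \<bar>C\<bar>) + 0) \<longlonglongrightarrow> m" by simp
  qed
  have re: "Re (inner_of N g h - \<phi> g) = 0" if g: "g \<in> H" for g
  proof (rule ccontr)
    define a where "a = Re (inner_of N g h - \<phi> g)"
    assume "Re (inner_of N g h - \<phi> g) \<noteq> 0"
    hence a: "a \<noteq> 0" by (simp add: a_def)
    (* With t = - a / s the first-order gain 2 t a exceeds the second-order loss t^2 (N g)^2;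
       the summand 1 keeps s positive when g = 0. *)
    define s where "s = (N g)\<^sup>2 + 1"
    have s: "s > 0" by (simp add: s_def add_nonneg_pos)
    define t where "t = - a / s"
    have tg: "(\<lambda>x. complex_of_real t * g x) \<in> H" by (rule hfs_scale[OF g])
    have "m \<le> J (\<lambda>x. h x + complex_of_real t * g x)" by (rule mle[OF hfs_add[OF h(1) tg]])
    also have "\<dots> = J h + t\<^sup>2 * (N g)\<^sup>2 + 2 * t * a"
      unfolding J_def hfs_norm_sq_add[OF h(1) tg] add[OF h(1) tg] scale[OF g] hfs_norm_sq_scale[OF g]
        hfs_inner_scale_right[OF h(1) g] hfs_inner_cnj[OF g h(1)] a_def
      by (simp add: algebra_simps)
    finally have "0 \<le> t\<^sup>2 * (N g)\<^sup>2 + 2 * t * a" using Jh by linarith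
    also have "\<dots> \<le> t\<^sup>2 * s + 2 * t * a" unfolding s_def by (simp add: algebra_simps)
    also have "\<dots> = - (a\<^sup>2 / s)"
      using s by (simp add: t_def power2_eq_square field_simps)
    also have "\<dots> < 0" using a s by simp
    finally show False by simp
  qed
  have "\<phi> f = inner_of N f h" if f: "f \<in> H" for f
  proof -
    have "Re (inner_of N (\<lambda>x. \<i> * f x) h - \<phi> (\<lambda>x. \<i> * f x)) = 0" by (rule re[OF hfs_scale[OF f]])
    hence "Im (inner_of N f h - \<phi> f) = 0"
      unfolding hfs_inner_scale_left[OF f h(1)] scale[OF f] by simp
    thus ?thesis using re[OF f] by (simp add: complex_eq_iff)
  qed
  thus ?thesis using h(1) by blast
qed

context
  fixes T :: "('a \<Rightarrow> complex) \<Rightarrow> 'a \<Rightarrow> complex"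
  assumes BT: "bounded_operator_on H N T"
begin

lemma bop_closed: "f \<in> H \<Longrightarrow> T f \<in> H"
  and bop_add: "f \<in> H \<Longrightarrow> g \<in> H \<Longrightarrow> T (\<lambda>x. f x + g x) = (\<lambda>x. T f x + T g x)"
  and bop_scale: "f \<in> H \<Longrightarrow> T (\<lambda>x. c * f x) = (\<lambda>x. c * T f x)"
  using BT unfolding bounded_operator_on_def by blast+

text \<open>
  Justifies the definite description in \<open>adjoint_on\<close>.
\<close>

lemma adjoint_ex1:
  assumes g: "g \<in> H"
  shows "\<exists>!h. h \<in> H \<and> (\<forall>f\<in>H. inner_of N (T f) g = inner_of N f h)"
proof (rule ex_ex1I)
  obtain C where C: "\<And>f. f \<in> H \<Longrightarrow> N (T f) \<le> C * N f"
    using BT unfolding bounded_operator_on_def by blast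
  have "\<exists>h\<in>H. \<forall>f\<in>H. inner_of N (T f) g = inner_of N f h"
  proof (rule hfs_riesz[where C = "C * N g"])
    fix f assume f: "f \<in> H"
    have "cmod (inner_of N (T f) g) \<le> N (T f) * N g" by (rule hfs_cauchy_schwarz[OF bop_closed[OF f] g])
    also have "\<dots> \<le> C * N f * N g" by (intro mult_right_mono C f hfs_norm_nonneg g)
    finally show "cmod (inner_of N (T f) g) \<le> C * N g * N f" by (simp add: mult_ac)
  qed (simp_all add: bop_add bop_scale bop_closed g hfs_inner_add_left hfs_inner_scale_left)
  thus "\<exists>h. h \<in> H \<and> (\<forall>f\<in>H. inner_of N (T f) g = inner_of N f h)" by blast
next
  fix h h' assume 1: "h \<in> H \<and> (\<forall>f\<in>H. inner_of N (T f) g = inner_of N f h)"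
    and 2: "h' \<in> H \<and> (\<forall>f\<in>H. inner_of N (T f) g = inner_of N f h')"
  define d where "d = (\<lambda>x. h x + (-1) * h' x)"
  have d: "d \<in> H" unfolding d_def using 1 2 by (intro hfs_add hfs_scale) auto
  have "inner_of N d d = inner_of N d h + cnj (-1) * inner_of N d h'"
    using 1 2 d hfs_inner_add_right[of h "\<lambda>x. (-1) * h' x" d] hfs_inner_scale_right[of d h' "-1"] hfs_scale[of h' "-1"]
    by (simp add: d_def)
  also have "\<dots> = 0" using 1 2 d by (metis add.right_inverse complex_cnj_minus complex_cnj_one mult_minus_left mult_1)
  finally have "N d = 0" using hfs_inner_self[OF d] by simp
  hence "d = (\<lambda>x. 0)" by (rule hfs_norm_eq_0[OF d])
  thus "h = h'" by (auto simp: d_def fun_eq_iff)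
qed

lemma adjoint_closed: "g \<in> H \<Longrightarrow> adjoint_on H N T g \<in> H"
  and inner_adjoint: "f \<in> H \<Longrightarrow> g \<in> H \<Longrightarrow> inner_of N (T f) g = inner_of N f (adjoint_on H N T g)"
  using theI'[OF adjoint_ex1, of g] unfolding adjoint_on_def by blast+

lemma bop_pow_closed: "f \<in> H \<Longrightarrow> (T ^^ j) f \<in> H"
  by (induction j) (auto intro: bop_closed)

lemma adjoint_pow_closed: "f \<in> H \<Longrightarrow> (adjoint_on H N T ^^ j) f \<in> H"
  by (induction j) (auto intro: adjoint_closed)

lemma inner_adjoint_pow:
  "f \<in> H \<Longrightarrow> g \<in> H \<Longrightarrow> inner_of N ((T ^^ j) f) g = inner_of N f ((adjoint_on H N T ^^ j) g)"
proof (induction j arbitrary: g)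
  case (Suc j)
  have "inner_of N ((T ^^ Suc j) f) g = inner_of N ((T ^^ j) f) (adjoint_on H N T g)"
    using inner_adjoint[OF bop_pow_closed[OF Suc.prems(1)] Suc.prems(2)] by simp
  also have "\<dots> = inner_of N f ((adjoint_on H N T ^^ j) (adjoint_on H N T g))"
    by (rule Suc.IH[OF Suc.prems(1) adjoint_closed[OF Suc.prems(2)]])
  finally show ?case by (simp add: funpow_swap1)
qed simp

lemma bop_pow_add_scale:
  "f \<in> H \<Longrightarrow> g \<in> H \<Longrightarrow> (T ^^ j) (\<lambda>x. f x + c * g x) = (\<lambda>x. (T ^^ j) f x + c * (T ^^ j) g x)"
proof (induction j)
  case (Suc j)
  thus ?case
    using bop_add[OF bop_pow_closed[OF Suc.prems(1)] hfs_scale[OF bop_pow_closed[OF Suc.prems(2)]], of j c j]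
      bop_scale[OF bop_pow_closed[OF Suc.prems(2)], of c j] by simp
qed simp

lemma hfs_sum_closed_inner:
  fixes n :: nat
  assumes "\<And>j. F j \<in> H" "g \<in> H"
  shows "(\<lambda>x. \<Sum>j\<le>n. c j * F j x) \<in> H \<and> inner_of N (\<lambda>x. \<Sum>j\<le>n. c j * F j x) g = (\<Sum>j\<le>n. c j * inner_of N (F j) g)"
proof (induction n)
  case 0 thus ?case using assms by (simp add: hfs_scale hfs_inner_scale_left)
next
  case (Suc n) thus ?case using assms by (simp add: hfs_scale hfs_add hfs_inner_add_left hfs_inner_scale_left)
qed

lemma B_op_closed_inner:
  assumes f: "f \<in> H" and g: "g \<in> H"
  shows "B_op H N n T f \<in> H"
    and "inner_of N (B_op H N n T f) g = (\<Sum>j\<le>n. (-1) ^ j * of_nat (n choose j) * inner_of N ((T ^^ j) f) ((T ^^ j) g))"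
proof -
  have c: "(adjoint_on H N T ^^ j) ((T ^^ j) f) \<in> H" for j
    by (intro adjoint_pow_closed bop_pow_closed f)
  have "inner_of N ((adjoint_on H N T ^^ j) ((T ^^ j) f)) g = inner_of N ((T ^^ j) f) ((T ^^ j) g)" for j
    using hfs_inner_cnj[OF g c[of j]] inner_adjoint_pow[OF g bop_pow_closed[OF f], of j j]
      hfs_inner_cnj[OF bop_pow_closed[OF g] bop_pow_closed[OF f], of j j] by simp
  thus "B_op H N n T f \<in> H"
    and "inner_of N (B_op H N n T f) g = (\<Sum>j\<le>n. (-1) ^ j * of_nat (n choose j) * inner_of N ((T ^^ j) f) ((T ^^ j) g))"
    using hfs_sum_closed_inner[where F = "\<lambda>j. (adjoint_on H N T ^^ j) ((T ^^ j) f)" and g = g and n = n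
        and c = "\<lambda>j. (-1) ^ j * of_nat (n choose j)"] c g
    unfolding B_op_def by auto
qed

text \<open>
  The quadratic form of the operator \<open>B_op H N n T\<close>.
\<close>

definition defect :: "nat \<Rightarrow> ('a \<Rightarrow> complex) \<Rightarrow> real" where
  "defect n f = (\<Sum>j\<le>n. (-1) ^ j * real (n choose j) * (N ((T ^^ j) f))\<^sup>2)"

lemma inner_B_op_self:
  "f \<in> H \<Longrightarrow> inner_of N (B_op H N n T f) f = complex_of_real (defect n f)"
  by (simp add: B_op_closed_inner(2) hfs_inner_self bop_pow_closed defect_def)

lemma dirichlet_type_operatorI:
  assumes "\<And>n f. n \<ge> k \<Longrightarrow> f \<in> H \<Longrightarrow> (-1) ^ k * defect n f \<ge> 0"
  shows "dirichlet_type_operator H N k T"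
  unfolding dirichlet_type_operator_def positive_operator_on_def
proof (intro conjI HS BT allI impI ballI)
  fix n f assume n: "n \<ge> k" and f: "f \<in> H"
  have "inner_of N (\<lambda>x. (-1) ^ k * B_op H N n T f x) f = complex_of_real ((-1) ^ k * defect n f)"
    by (simp add: hfs_inner_scale_left[OF B_op_closed_inner(1)[OF f f] f] inner_B_op_self[OF f])
  thus "inner_of N (\<lambda>x. (-1) ^ k * B_op H N n T f x) f \<in> \<real>\<^sub>\<ge>\<^sub>0"
    using assms[OF n f] by (metis nonneg_Reals_of_real_iff)
qed

text \<open>
  For the non-trivial direction the sesquilinear form of \<open>B_op\<close> is recovered from its quadratic form by
  polarization; if it vanishes, every \<open>B_op H N n T f\<close> is orthogonal to itself.
\<close>

lemma n_isometry_iff_defect: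
  "n_isometry H N n T \<longleftrightarrow> (\<forall>f\<in>H. defect n f = 0)"
proof
  assume iso: "n_isometry H N n T"
  show "\<forall>f\<in>H. defect n f = 0"
  proof
    fix f assume f: "f \<in> H"
    have "B_op H N n T f = (\<lambda>x. 0 * f x)" using iso f unfolding n_isometry_def by simp
    hence "inner_of N (B_op H N n T f) f = 0" using hfs_inner_scale_left[OF f f, of 0] by simp
    thus "defect n f = 0" using inner_B_op_self[OF f] by simp
  qed
next
  assume z: "\<forall>f\<in>H. defect n f = 0"
  have "B_op H N n T f = (\<lambda>x. 0)" if f: "f \<in> H" for f
  proof -
    define g where "g = B_op H N n T f"
    have g: "g \<in> H" unfolding g_def by (rule B_op_closed_inner(1)[OF f f])
    have "inner_of N g g = (\<Sum>j\<le>n. (-1) ^ j * of_nat (n choose j) * inner_of N ((T ^^ j) f) ((T ^^ j) g))"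
      unfolding g_def by (rule B_op_closed_inner(2)[OF f g[unfolded g_def]])
    also have "\<dots> = (\<Sum>j\<le>n. \<Sum>l<4. (-1) ^ j * of_nat (n choose j) * (\<i> ^ l * complex_of_real ((N ((T ^^ j) (\<lambda>x. f x + \<i> ^ l * g x)))\<^sup>2)) / 4)"
      unfolding inner_of_def bop_pow_add_scale[OF f g] by (simp add: sum_distrib_left sum_divide_distrib)
    also have "\<dots> = (\<Sum>l<4. \<Sum>j\<le>n. (-1) ^ j * of_nat (n choose j) * (\<i> ^ l * complex_of_real ((N ((T ^^ j) (\<lambda>x. f x + \<i> ^ l * g x)))\<^sup>2)) / 4)"
      by (rule sum.swap)
    also have "\<dots> = (\<Sum>l<4. \<i> ^ l / 4 * complex_of_real (defect n (\<lambda>x. f x + \<i> ^ l * g x)))"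
      unfolding defect_def by (intro sum.cong refl) (simp add: sum_distrib_left mult_ac)
    also have "\<dots> = 0"
      using z hfs_add[OF f hfs_scale[OF g]] by simp
    finally have "N g = 0" using hfs_inner_self[OF g] by simp
    thus ?thesis using hfs_norm_eq_0[OF g] by (simp add: g_def)
  qed
  thus "n_isometry H N n T" unfolding n_isometry_def using HS BT by blast
qed

end

end

section \<open>Multiplication by the coordinate for point masses\<close>

text \<open>
  For \<open>\<zeta>\<close> in the disc, \<open>u n\<close> may be taken to be the sum of \<open>taylor_coeff f m * \<zeta> ^ (m - n)\<close> over \<open>m \<ge> n\<close>.
  On the circle this series can diverge; the recurrence still makes sense.
\<close>

definition tail_sequence :: "complex \<Rightarrow> (complex \<Rightarrow> complex) \<Rightarrow> (nat \<Rightarrow> complex) \<Rightarrow> bool" where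
  "tail_sequence \<zeta> f u \<longleftrightarrow> (\<forall>n. taylor_coeff f n = u n - \<zeta> * u (Suc n))"

lemma taylor_coeff_shifted_quotient:
  assumes g: "g holomorphic_on unit_disc" and fg: "\<And>z. z \<in> unit_disc \<Longrightarrow> f z = c + (z - \<zeta>) * g z"
  shows "taylor_coeff f n = (if n = 0 then c else taylor_coeff g (n - 1)) - \<zeta> * taylor_coeff g n"
proof -
  have "fps_expansion f 0 = fps_expansion (\<lambda>z. c + (z - \<zeta>) * g z) 0"
    by (rule taylor_fps_cong) (rule fg)
  also have "\<dots> = fps_const c + (fps_X - fps_const \<zeta>) * fps_expansion g 0"
    by (intro fps_expansion_eqI fps_expansion_intros taylor_has_fps_expansion g)
  finally show ?thesis by (simp add: left_diff_distrib)
qed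

text \<open>
  The coefficients of the difference quotient at \<open>\<zeta>\<close>, preceded by the value at \<open>\<zeta>\<close>.
\<close>

lemma tail_sequence_exists_disc:
  assumes k: "k \<ge> 1" and \<zeta>: "cmod \<zeta> < 1" and f: "f holomorphic_on unit_disc" and fin: "local_dirichlet \<zeta> k f < \<infinity>"
  shows "\<exists>u. tail_sequence \<zeta> f u \<and> summable (\<lambda>n. real (n choose (k - 1)) * (cmod (u (Suc n)))\<^sup>2)"
proof -
  define g where "g z = (if z = \<zeta> then deriv f \<zeta> else (f z - f \<zeta>) / (z - \<zeta>))" for z
  have g: "g holomorphic_on unit_disc"
    unfolding g_def by (rule pole_lemma_open[OF f]) simp
  have fg: "f z = f \<zeta> + (z - \<zeta>) * g z" for z by (simp add: g_def)
  define u where "u n = (if n = 0 then f \<zeta> else taylor_coeff g (n - 1))" for n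
  have "tail_sequence \<zeta> f u"
    unfolding tail_sequence_def using taylor_coeff_shifted_quotient[OF g fg] by (simp add: u_def)
  moreover have "(\<Sum>n. ennreal (real (n choose (k - 1)) * (cmod (u (Suc n)))\<^sup>2)) \<noteq> top"
    using fin local_dirichlet_disc_eq[OF \<zeta> k g f fg] by (simp add: u_def)
  hence "summable (\<lambda>n. real (n choose (k - 1)) * (cmod (u (Suc n)))\<^sup>2)"
    by (rule summable_suminf_not_top[rotated]) simp
  ultimately show ?thesis by blast
qed

text \<open>
  Summability bounds \<open>u\<close>, so \<open>u (Suc n)\<close> are the Taylor coefficients of a holomorphic function on the disc,
  which the recurrence identifies as the quotient in \<open>local_dirichlet_disc_eq\<close>.
\<close>

lemma local_dirichlet_tail_disc:
  assumes k: "k \<ge> 1" and \<zeta>: "cmod \<zeta> < 1" and f: "f holomorphic_on unit_disc" and u: "tail_sequence \<zeta> f u"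
    and sm: "summable (\<lambda>n. real (n choose (k - 1)) * (cmod (u (Suc n)))\<^sup>2)"
  shows "local_dirichlet \<zeta> k f = ennreal (\<Sum>n. real (n choose (k - 1)) * (cmod (u (Suc n)))\<^sup>2)"
proof -
  (* The formal quotient (f - u 0) / (z - zeta). *)
  define G where "G = Abs_fps (\<lambda>n. u (Suc n))"
  have "eventually (\<lambda>n. real (n choose (k - 1)) * (cmod (u (Suc n)))\<^sup>2 < 1) sequentially"
    using summable_LIMSEQ_zero[OF sm] by (rule order_tendstoD) simp
  hence ev: "eventually (\<lambda>n. cmod (u (Suc n)) \<le> 1) sequentially"
    using eventually_ge_at_top[of "k - 1"]
  proof eventually_elim
    case (elim n)
    have "n choose (k - 1) > 0" using elim(2) by simp
    hence "1 \<le> real (n choose (k - 1))" by linarith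
    hence "1 * (cmod (u (Suc n)))\<^sup>2 \<le> real (n choose (k - 1)) * (cmod (u (Suc n)))\<^sup>2"
      by (intro mult_right_mono) auto
    hence "(cmod (u (Suc n)))\<^sup>2 \<le> 1" using elim(1) by simp
    thus ?case by (simp add: abs_square_le_1)
  qed
  have "conv_radius (\<lambda>n. u (Suc n)) \<ge> 1"
  proof (rule conv_radius_geI_ex)
    fix r :: real assume r: "0 < r" "ereal r < 1"
    have "summable (\<lambda>n. u (Suc n) * of_real r ^ n)"
    proof (rule summable_comparison_test_ev)
      show "eventually (\<lambda>n. norm (u (Suc n) * of_real r ^ n) \<le> r ^ n) sequentially"
        using ev by eventually_elim (use r in \<open>simp add: norm_mult norm_power mult_left_le_one_le\<close>)
      show "summable (\<lambda>n. r ^ n)" using r by (intro summable_geometric) (simp add: one_ereal_def)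
    qed
    thus "\<exists>z. norm z = r \<and> summable (\<lambda>n. u (Suc n) * z ^ n)"
      using r by (intro exI[of _ "of_real r"]) auto
  qed
  hence rad: "fps_conv_radius G \<ge> 1" by (simp add: fps_conv_radius_def G_def)
  define g where "g = eval_fps G"
  have g: "g holomorphic_on unit_disc"
    unfolding g_def
  proof (intro holomorphic_on_eval_fps subsetI)
    fix z :: complex assume "z \<in> unit_disc"
    hence "ereal (cmod z) < 1" by (simp add: one_ereal_def)
    thus "z \<in> eball 0 (fps_conv_radius G)" using less_le_trans[OF _ rad] by (simp add: in_eball_iff)
  qed
  have "g has_fps_expansion G"
    unfolding g_def by (intro eval_fps_has_fps_expansion less_le_trans[OF _ rad]) simp
  hence cg: "taylor_coeff g n = u (Suc n)" for n
    by (simp add: fps_expansion_eqI G_def)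
  define h where "h z = u 0 + (z - \<zeta>) * g z" for z
  have h: "h holomorphic_on unit_disc" unfolding h_def by (intro holomorphic_intros g)
  have ch: "taylor_coeff h n = taylor_coeff f n" for n
    using taylor_coeff_shifted_quotient[OF g, of h "u 0" \<zeta> n] u
    by (cases n) (auto simp: h_def cg tail_sequence_def)
  have fg: "f z = u 0 + (z - \<zeta>) * g z" if z: "z \<in> unit_disc" for z
    using taylor_sums[OF f z] taylor_sums[OF h z] unfolding ch h_def using sums_unique2 by metis
  have "local_dirichlet \<zeta> k f = (\<Sum>n. ennreal (real (n choose (k - 1)) * (cmod (taylor_coeff g n))\<^sup>2))"
    by (rule local_dirichlet_disc_eq[OF \<zeta> k g f]) (rule fg)
  also have "\<dots> = ennreal (\<Sum>n. real (n choose (k - 1)) * (cmod (u (Suc n)))\<^sup>2)"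
    unfolding cg by (rule suminf_ennreal2) (auto simp: sm[simplified])
  finally show ?thesis .
qed

lemma tail_sequence_exists_circle:
  assumes k: "k \<ge> 1" and \<zeta>: "cmod \<zeta> = 1" and f: "f holomorphic_on unit_disc" and fin: "local_dirichlet \<zeta> k f < \<infinity>"
  shows "\<exists>u. tail_sequence \<zeta> f u \<and> summable (\<lambda>n. real (n choose (k - 1)) * (cmod (u (Suc n)))\<^sup>2)"
proof -
  obtain r where r: "k = Suc r" using k by (cases k) auto
  have zz: "cnj \<zeta> * \<zeta> = 1" using \<zeta> complex_norm_square[of \<zeta>] by (simp add: mult.commute)
  have "summable (\<lambda>n. fact n / (fact r * fact (Suc (n + k))) *
     (cmod (\<Sum>m\<le>n. of_real (fact (m + k) / fact m) * (\<zeta> ^ (m + k) * taylor_coeff f (m + k))))\<^sup>2)"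
    using fin unfolding local_dirichlet_circle_eq[OF r \<zeta> f]
    by (intro summable_suminf_not_top) auto
  from weighted_difference_antidifference[OF r this]
  obtain v where v: "\<And>n. \<zeta> ^ n * taylor_coeff f n = v n - v (Suc n)"
    and sm: "summable (\<lambda>n. real ((n + r) choose r) * (cmod (v (n + k)))\<^sup>2)" by blast
  define u where "u n = cnj \<zeta> ^ n * v n" for n
  have "tail_sequence \<zeta> f u"
    unfolding tail_sequence_def
  proof
    fix n
    have "u n - \<zeta> * u (Suc n) = cnj \<zeta> ^ n * (v n - (cnj \<zeta> * \<zeta>) * v (Suc n))"
      by (simp add: u_def algebra_simps)
    also have "\<dots> = (cnj \<zeta> * \<zeta>) ^ n * taylor_coeff f n"
      unfolding zz by (simp add: v[symmetric] power_mult_distrib[symmetric] mult.assoc[symmetric] zz)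
    finally show "taylor_coeff f n = u n - \<zeta> * u (Suc n)" unfolding zz by simp
  qed
  moreover have "summable (\<lambda>n. real (n choose r) * (cmod (u (Suc n)))\<^sup>2)"
  proof (subst summable_iff_shift[of _ r, symmetric])
    show "summable (\<lambda>n. real ((n + r) choose r) * (cmod (u (Suc (n + r))))\<^sup>2)"
      using sm \<zeta> by (simp add: u_def r norm_mult norm_power)
  qed
  ultimately show ?thesis by (auto simp: r)
qed

lemma local_dirichlet_tail_circle:
  assumes k: "k \<ge> 1" and \<zeta>: "cmod \<zeta> = 1" and f: "f holomorphic_on unit_disc" and u: "tail_sequence \<zeta> f u"
    and sm: "summable (\<lambda>n. real (n choose (k - 1)) * (cmod (u (Suc n)))\<^sup>2)"
  shows "local_dirichlet \<zeta> k f = ennreal (\<Sum>n. real (n choose (k - 1)) * (cmod (u (Suc n)))\<^sup>2)"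
proof -
  obtain r where r: "k = Suc r" using k by (cases k) auto
  define v where "v n = \<zeta> ^ n * u n" for n
  have v: "\<zeta> ^ n * taylor_coeff f n = v n - v (Suc n)" for n
    unfolding u[unfolded tail_sequence_def, rule_format] v_def by (simp add: algebra_simps)
  have nv: "cmod (v (n + k)) = cmod (u (Suc (n + r)))" for n
    using \<zeta> by (simp add: v_def norm_mult norm_power r)
  have sm': "summable (\<lambda>n. real ((n + r) choose r) * (cmod (v (n + k)))\<^sup>2)"
    unfolding nv using summable_ignore_initial_segment[OF sm, of r] by (simp add: r)
  from weighted_difference_sums[OF r sm']
  have s: "(\<lambda>n. fact n / (fact r * fact (Suc (n + k))) * (cmod (\<Sum>m\<le>n. of_real (fact (m + k) / fact m) * (\<zeta> ^ (m + k) * taylor_coeff f (m + k))))\<^sup>2) sums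
     (\<Sum>n. real ((n + r) choose r) * (cmod (v (n + k)))\<^sup>2)"
    unfolding v by simp
  have "local_dirichlet \<zeta> k f = ennreal (\<Sum>n. real ((n + r) choose r) * (cmod (v (n + k)))\<^sup>2)"
    unfolding local_dirichlet_circle_eq[OF r \<zeta> f] using s
    by (subst suminf_ennreal2) (auto simp: sums_iff)
  also have "\<dots> = (\<Sum>n. ennreal (real ((n + r) choose r) * (cmod (u (Suc (n + r))))\<^sup>2))"
    using sm' unfolding nv by (intro suminf_ennreal2[symmetric]) auto
  also have "\<dots> = (\<Sum>n. ennreal (real (n choose r) * (cmod (u (Suc n)))\<^sup>2))"
    by (rule binomial_weighted_suminf_shift[symmetric])
  also have "\<dots> = ennreal (\<Sum>n. real (n choose r) * (cmod (u (Suc n)))\<^sup>2)"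
    using sm by (intro suminf_ennreal2) (auto simp: r)
  finally show ?thesis by (simp add: r)
qed

lemma tail_sequence_exists:
  assumes "k \<ge> 1" "cmod \<zeta> \<le> 1" "f holomorphic_on unit_disc" "local_dirichlet \<zeta> k f < \<infinity>"
  shows "\<exists>u. tail_sequence \<zeta> f u \<and> summable (\<lambda>n. real (n choose (k - 1)) * (cmod (u (Suc n)))\<^sup>2)"
  using assms tail_sequence_exists_disc tail_sequence_exists_circle by (cases "cmod \<zeta> = 1") auto

theorem local_dirichlet_tail:
  assumes "k \<ge> 1" "cmod \<zeta> \<le> 1" "f holomorphic_on unit_disc" "tail_sequence \<zeta> f u"
    "summable (\<lambda>n. real (n choose (k - 1)) * (cmod (u (Suc n)))\<^sup>2)"
  shows "local_dirichlet \<zeta> k f = ennreal (\<Sum>n. real (n choose (k - 1)) * (cmod (u (Suc n)))\<^sup>2)"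
  using assms local_dirichlet_tail_disc local_dirichlet_tail_circle by (cases "cmod \<zeta> = 1") auto

lemma M_z_holomorphic: "f holomorphic_on unit_disc \<Longrightarrow> M_z f holomorphic_on unit_disc"
  unfolding M_z_def by (intro holomorphic_intros)

lemma taylor_coeff_M_z:
  assumes f: "f holomorphic_on unit_disc"
  shows "taylor_coeff (M_z f) n = (if n = 0 then 0 else taylor_coeff f (n - 1))"
proof -
  have "fps_expansion (M_z f) 0 = fps_X * fps_expansion f 0"
    unfolding M_z_def by (intro fps_expansion_eqI fps_expansion_intros taylor_has_fps_expansion f)
  thus ?thesis by simp
qed

text \<open>
  The tail sequence of \<open>M_z f\<close>.
\<close>

definition shift_tail :: "complex \<Rightarrow> (nat \<Rightarrow> complex) \<Rightarrow> nat \<Rightarrow> complex" where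
  "shift_tail \<zeta> u n = (if n = 0 then \<zeta> * u 0 else u (n - 1))"

lemma tail_sequence_M_z:
  assumes "f holomorphic_on unit_disc" "tail_sequence \<zeta> f u"
  shows "tail_sequence \<zeta> (M_z f) (shift_tail \<zeta> u)"
  using assms unfolding tail_sequence_def by (auto simp: taylor_coeff_M_z shift_tail_def)

text \<open>
  For \<open>n > r\<close> the binomial weights grow by at most the factor \<open>r + 1\<close> under the shift. The index \<open>n = r\<close>,
  whose weight was zero before, is estimated by \<open>u r = taylor_coeff f r + \<zeta> * u (Suc r)\<close>.
\<close>

lemma shift_tail_bound:
  assumes \<zeta>: "cmod \<zeta> \<le> 1" and u: "tail_sequence \<zeta> f u"
    and sm: "summable (\<lambda>n. real (n choose r) * (cmod (u (Suc n)))\<^sup>2)"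
  shows "summable (\<lambda>n. real (n choose r) * (cmod (u n))\<^sup>2)"
    and "(\<Sum>n. real (n choose r) * (cmod (u n))\<^sup>2)
       \<le> (real r + 3) * (\<Sum>n. real (n choose r) * (cmod (u (Suc n)))\<^sup>2) + 2 * (cmod (taylor_coeff f r))\<^sup>2"
proof -
  define y where "y n = real (n choose r) * (cmod (u (Suc n)))\<^sup>2" for n
  define A where "A = 2 * (cmod (taylor_coeff f r))\<^sup>2 + 2 * y r"
  (* A summable majorant: the shifted weights for n > r, and A for the single index n = r. *)
  define b where "b n = (if n = 0 then 0 else (real r + 1) * y (n - 1)) + (if n = r then A else 0)" for n
  have y0: "y n \<ge> 0" for n by (simp add: y_def)
  have A0: "A \<ge> 0" using y0[of r] by (simp add: A_def)
  have sy: "summable y" using sm by (simp add: y_def[abs_def])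
  have "(\<lambda>n. (real r + 1) * y n) sums ((real r + 1) * suminf y)"
    by (intro sums_mult summable_sums sy)
  hence "(\<lambda>n. (if Suc n = 0 then 0 else (real r + 1) * y (Suc n - 1))) sums ((real r + 1) * suminf y)" by simp
  hence "(\<lambda>n. (if n = 0 then 0 else (real r + 1) * y (n - 1))) sums ((real r + 1) * suminf y)"
    by (subst (asm) sums_Suc_iff) simp
  hence sb: "b sums ((real r + 1) * suminf y + A)"
    unfolding b_def by (intro sums_add sums_single)
  have xb: "real (n choose r) * (cmod (u n))\<^sup>2 \<le> b n" for n
  proof -
    consider "n < r" | "n = r" | "n > r" by linarith
    thus ?thesis
    proof cases
      case 1
      thus ?thesis using y0 by (simp add: b_def binomial_eq_0)
    next
      case 2
      have ur: "u r = taylor_coeff f r + \<zeta> * u (Suc r)" using u by (simp add: tail_sequence_def)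
      from cmod_add_sq_le[of "taylor_coeff f r" "\<zeta> * u (Suc r)"]
      have "(cmod (u r))\<^sup>2 \<le> 2 * (cmod (taylor_coeff f r))\<^sup>2 + 2 * (cmod (\<zeta> * u (Suc r)))\<^sup>2" unfolding ur .
      moreover have "(cmod (\<zeta> * u (Suc r)))\<^sup>2 \<le> (cmod (u (Suc r)))\<^sup>2"
        using \<zeta> by (intro power_mono) (auto simp: norm_mult mult_left_le_one_le)
      moreover have "y r = (cmod (u (Suc r)))\<^sup>2" by (simp add: y_def)
      ultimately have "(cmod (u r))\<^sup>2 \<le> A" unfolding A_def by linarith
      thus ?thesis using 2 y0[of "r - 1"] by (simp add: b_def add_nonneg_nonneg add_increasing)
    next
      case 3
      then obtain m where m: "n = Suc m" "m \<ge> r" by (cases n) auto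
      have "Suc m * (m choose r) = (Suc m - r) * (Suc m choose r)"
        using m(2) binomial_absorb_comp[of "Suc m" r] by simp
      hence "real (Suc m) * real (m choose r) = real (Suc m - r) * real (Suc m choose r)"
        by (metis of_nat_mult)
      moreover have "real (Suc m) \<le> (real r + 1) * real (Suc m - r)"
      proof -
        have "Suc m \<le> (r + 1) * (Suc m - r)"
        proof -
          obtain d where "m = r + d" using m(2) le_Suc_ex by blast
          thus ?thesis by simp
        qed
        hence "real (Suc m) \<le> real ((r + 1) * (Suc m - r))" by (simp only: of_nat_le_iff)
        thus ?thesis by (simp only: of_nat_mult of_nat_add of_nat_1)
      qed
      ultimately have "real (Suc m - r) * real (Suc m choose r) \<le> (real r + 1) * real (Suc m - r) * real (m choose r)"
        by (metis mult_right_mono of_nat_0_le_iff)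
      moreover have "real (Suc m - r) > 0" using m(2) by simp
      ultimately have "real (Suc m choose r) \<le> (real r + 1) * real (m choose r)"
        by (simp add: mult.assoc mult.left_commute)
      hence "real (n choose r) * (cmod (u n))\<^sup>2 \<le> (real r + 1) * real (m choose r) * (cmod (u (Suc m)))\<^sup>2"
        unfolding m(1) by (intro mult_right_mono) auto
      thus ?thesis using 3 by (simp add: b_def m(1) y_def mult.assoc)
    qed
  qed
  show sx: "summable (\<lambda>n. real (n choose r) * (cmod (u n))\<^sup>2)"
    using xb by (intro summable_comparison_test[OF _ sums_summable[OF sb]]) auto
  have "(\<Sum>n. real (n choose r) * (cmod (u n))\<^sup>2) \<le> suminf b"
    using xb by (intro suminf_le sx sums_summable[OF sb])
  also have "\<dots> = (real r + 1) * suminf y + A" using sb by (simp add: sums_iff)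
  also have "y r \<le> suminf y"
    using sum_le_suminf[OF sy, of "{r}"] y0 by simp
  hence "(real r + 1) * suminf y + A \<le> (real r + 3) * suminf y + 2 * (cmod (taylor_coeff f r))\<^sup>2"
    by (simp add: A_def algebra_simps)
  finally show "(\<Sum>n. real (n choose r) * (cmod (u n))\<^sup>2)
       \<le> (real r + 3) * (\<Sum>n. real (n choose r) * (cmod (u (Suc n)))\<^sup>2) + 2 * (cmod (taylor_coeff f r))\<^sup>2"
    by (simp add: y_def[abs_def])
qed

text \<open>
  This estimate is uniform in \<open>\<zeta>\<close>, so that it survives integration over \<open>\<mu>\<close> and makes \<open>M_z\<close> bounded.
\<close>

theorem local_dirichlet_M_z_le:
  assumes k: "k \<ge> 1" and \<zeta>: "cmod \<zeta> \<le> 1" and f: "f holomorphic_on unit_disc"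
  shows "local_dirichlet \<zeta> k (M_z f) \<le> ennreal (real k + 2) * local_dirichlet \<zeta> k f + ennreal (2 * (cmod (taylor_coeff f (k - 1)))\<^sup>2)"
proof (cases "local_dirichlet \<zeta> k f < \<infinity>")
  case False
  hence "local_dirichlet \<zeta> k f = top" by (simp add: not_less top.extremum_unique)
  thus ?thesis by (simp add: ennreal_mult_top)
next
  case True
  then obtain u where u: "tail_sequence \<zeta> f u" and sm: "summable (\<lambda>n. real (n choose (k - 1)) * (cmod (u (Suc n)))\<^sup>2)"
    using tail_sequence_exists[OF k \<zeta> f] by blast
  have kr: "real (k - 1) + 3 = real k + 2" using k by simp
  have s: "shift_tail \<zeta> u (Suc n) = u n" for n by (simp add: shift_tail_def)
  have L: "local_dirichlet \<zeta> k (M_z f) = ennreal (\<Sum>n. real (n choose (k - 1)) * (cmod (u n))\<^sup>2)"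
    using local_dirichlet_tail[OF k \<zeta> M_z_holomorphic[OF f] tail_sequence_M_z[OF f u]] shift_tail_bound(1)[OF \<zeta> u sm]
    unfolding s by blast
  have "ennreal (\<Sum>n. real (n choose (k - 1)) * (cmod (u n))\<^sup>2) \<le>
     ennreal ((real k + 2) * (\<Sum>n. real (n choose (k - 1)) * (cmod (u (Suc n)))\<^sup>2) + 2 * (cmod (taylor_coeff f (k - 1)))\<^sup>2)"
    using shift_tail_bound(2)[OF \<zeta> u sm] unfolding kr by (rule ennreal_leI)
  also have "\<dots> = ennreal (real k + 2) * ennreal (\<Sum>n. real (n choose (k - 1)) * (cmod (u (Suc n)))\<^sup>2) + ennreal (2 * (cmod (taylor_coeff f (k - 1)))\<^sup>2)"
  proof -
    have "ennreal (c * S + B) = ennreal c * ennreal S + ennreal B" if "0 \<le> c" "0 \<le> S" "0 \<le> B" for c S B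
      using that by (subst ennreal_plus) (auto simp: ennreal_mult)
    moreover have "0 \<le> (\<Sum>n. real (n choose (k - 1)) * (cmod (u (Suc n)))\<^sup>2)"
      by (intro suminf_nonneg[OF sm]) simp
    ultimately show ?thesis by simp
  qed
  finally show ?thesis unfolding L local_dirichlet_tail[OF k \<zeta> f u sm] .
qed

lemma alternating_binomial_Suc:
  fixes x :: "nat \<Rightarrow> real"
  shows "(\<Sum>j\<le>Suc N. (-1) ^ j * real (Suc N choose j) * x j) = (\<Sum>j\<le>N. (-1) ^ j * real (N choose j) * (x j - x (Suc j)))"
proof -
  have "(\<Sum>j\<le>Suc N. (-1) ^ j * real (Suc N choose j) * x j)
     = x 0 + (\<Sum>j\<le>N. (-1) ^ Suc j * real (Suc N choose Suc j) * x (Suc j))"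
    by (simp add: sum.atMost_Suc_shift del: sum.atMost_Suc)
  also have "(\<Sum>j\<le>N. (-1) ^ Suc j * real (Suc N choose Suc j) * x (Suc j))
     = (\<Sum>j\<le>N. (-1) ^ Suc j * real (N choose Suc j) * x (Suc j)) - (\<Sum>j\<le>N. (-1) ^ j * real (N choose j) * x (Suc j))"
    unfolding sum_subtractf[symmetric] by (intro sum.cong refl) (simp add: algebra_simps)
  also have "x 0 + ((\<Sum>j\<le>N. (-1) ^ Suc j * real (N choose Suc j) * x (Suc j)) - (\<Sum>j\<le>N. (-1) ^ j * real (N choose j) * x (Suc j)))
     = (\<Sum>j\<le>Suc N. (-1) ^ j * real (N choose j) * x j) - (\<Sum>j\<le>N. (-1) ^ j * real (N choose j) * x (Suc j))"
    by (simp add: sum.atMost_Suc_shift del: sum.atMost_Suc)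
  also have "(\<Sum>j\<le>Suc N. (-1) ^ j * real (N choose j) * x j) = (\<Sum>j\<le>N. (-1) ^ j * real (N choose j) * x j)"
    by (simp add: binomial_eq_0)
  finally show ?thesis by (simp add: sum_subtractf right_diff_distrib)
qed

text \<open>
  One difference in \<open>j\<close> lowers the level \<open>p\<close> by one, with a change of sign; at level \<open>0\<close> each further
  difference is multiplication by \<open>1 - \<rho>\<close>.
\<close>

lemma alternating_sum_of_tower:
  fixes d :: "nat \<Rightarrow> nat \<Rightarrow> real"
  assumes base: "\<And>j. d 0 (Suc j) = \<rho> * d 0 j"
    and step: "\<And>p j. p < k \<Longrightarrow> d (Suc p) (Suc j) = d (Suc p) j + d p j"
  shows "p \<le> k \<Longrightarrow> p \<le> N \<Longrightarrow> (\<Sum>j\<le>N. (-1) ^ j * real (N choose j) * d p (i + j)) = (-1) ^ p * (1 - \<rho>) ^ (N - p) * d 0 i"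
proof (induction p arbitrary: N i)
  case 0
  show ?case
  proof (induction N arbitrary: i)
    case (Suc N)
    have "(\<Sum>j\<le>Suc N. (-1) ^ j * real (Suc N choose j) * d 0 (i + j)) = (\<Sum>j\<le>N. (-1) ^ j * real (N choose j) * d 0 (i + j)) * (1 - \<rho>)"
      unfolding alternating_binomial_Suc sum_distrib_right by (intro sum.cong refl) (simp add: base algebra_simps)
    thus ?case using Suc.IH[of i] by simp
  qed simp
next
  case (Suc p)
  then obtain N' where N': "N = Suc N'" by (cases N) auto
  have "(\<Sum>j\<le>N. (-1) ^ j * real (N choose j) * d (Suc p) (i + j)) = - (\<Sum>j\<le>N'. (-1) ^ j * real (N' choose j) * d p (i + j))"
    unfolding N' alternating_binomial_Suc using Suc.prems by (simp add: step sum_negf[symmetric])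
  also have "\<dots> = - ((-1) ^ p * (1 - \<rho>) ^ (N' - p) * d 0 i)"
    using Suc.prems N' by (subst Suc.IH) auto
  finally show ?case by (simp add: N')
qed

lemma summable_lower_binomial:
  fixes x :: "nat \<Rightarrow> real"
  assumes q: "q \<le> r" and x: "\<And>n. x n \<ge> 0" and sm: "summable (\<lambda>n. real (n choose r) * x n)"
  shows "summable (\<lambda>n. real (n choose q) * x n)"
proof (rule summable_comparison_test_ev)
  show "summable (\<lambda>n. real (r choose q) * (real (n choose r) * x n))" by (intro summable_mult sm)
  show "eventually (\<lambda>n. norm (real (n choose q) * x n) \<le> real (r choose q) * (real (n choose r) * x n)) sequentially"
    using eventually_ge_at_top[of r]
  proof eventually_elim
    case (elim n)
    have "(n choose r) * (r choose q) = (n choose q) * ((n - q) choose (r - q))"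
      by (rule choose_mult) (use q elim in auto)
    moreover have "(n - q) choose (r - q) > 0" by (rule zero_less_binomial) (use q elim in simp)
    hence "(n choose q) * 1 \<le> (n choose q) * ((n - q) choose (r - q))" by (intro mult_le_mono2) linarith
    ultimately have "n choose q \<le> (n choose r) * (r choose q)" by (simp only: mult_1_right)
    hence "real (n choose q) \<le> real ((n choose r) * (r choose q))" by (simp only: of_nat_le_iff)
    hence "real (n choose q) * x n \<le> (real (n choose r) * real (r choose q)) * x n"
      using x by (intro mult_right_mono) auto
    thus ?case using x by (simp add: mult_ac)
  qed
qed

text \<open>
  The levels of the tower are \<open>|u\<^sub>0|\<^sup>2\<close> and the sums of \<open>(n choose q) |u\<^sub>n\<^sub>+\<^sub>1|\<^sup>2\<close> for \<open>q < k\<close>. Pascal's rule is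
  the step from one level to the next.
\<close>

theorem local_dirichlet_alternating_sum:
  assumes k: "k \<ge> 1" and \<zeta>: "cmod \<zeta> \<le> 1" and f: "f holomorphic_on unit_disc" and u: "tail_sequence \<zeta> f u"
    and sm: "summable (\<lambda>n. real (n choose (k - 1)) * (cmod (u (Suc n)))\<^sup>2)" and N: "k \<le> N"
  shows "(\<Sum>j\<le>N. (-1) ^ j * real (N choose j) * enn2real (local_dirichlet \<zeta> k ((M_z ^^ j) f)))
     = (-1) ^ k * (1 - (cmod \<zeta>)\<^sup>2) ^ (N - k) * (cmod (u 0))\<^sup>2"
proof -
  define U where "U j = (shift_tail \<zeta> ^^ j) u" for j
  have U0: "U 0 = u" by (simp add: U_def)
  have US: "U (Suc j) 0 = \<zeta> * U j 0" "U (Suc j) (Suc n) = U j n" for j n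
    by (simp_all add: U_def shift_tail_def)
  have hol: "(M_z ^^ j) f holomorphic_on unit_disc" for j
    by (induction j) (auto intro: f M_z_holomorphic)
  have tail: "tail_sequence \<zeta> ((M_z ^^ j) f) (U j)" for j
    by (induction j) (auto simp: U_def u intro!: tail_sequence_M_z hol)
  have sU: "summable (\<lambda>n. real (n choose (k - 1)) * (cmod (U j (Suc n)))\<^sup>2)" for j
  proof (induction j)
    case 0 show ?case using sm by (simp add: U0)
  next
    case (Suc j) thus ?case using shift_tail_bound(1)[OF \<zeta> tail[of j]] by (simp add: US)
  qed
  have sUq: "summable (\<lambda>n. real (n choose q) * (cmod (U j (Suc n)))\<^sup>2)" if "q < k" for q j
    using that by (intro summable_lower_binomial[OF _ _ sU]) auto
  define d where "d p j = (case p of 0 \<Rightarrow> (cmod (U j 0))\<^sup>2 | Suc q \<Rightarrow> (\<Sum>n. real (n choose q) * (cmod (U j (Suc n)))\<^sup>2))" for p j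
  have base: "d 0 (Suc j) = (cmod \<zeta>)\<^sup>2 * d 0 j" for j
    by (simp add: d_def US norm_mult power_mult_distrib)
  have step: "d (Suc p) (Suc j) = d (Suc p) j + d p j" if p: "p < k" for p j
  proof (cases p)
    case 0
    have "(\<lambda>n. (cmod (U j (Suc n)))\<^sup>2) sums (\<Sum>n. (cmod (U j (Suc n)))\<^sup>2)"
      using sUq[of 0 j] k by (intro summable_sums) simp
    from sums_Suc[OF this] show ?thesis unfolding 0 by (simp add: d_def US sums_iff)
  next
    case (Suc q)
    have 1: "(\<lambda>n. real (n choose p) * (cmod (U j (Suc n)))\<^sup>2) sums d (Suc p) j"
      unfolding d_def using sUq[OF p, of j] by (simp add: summable_sums)
    have 2: "(\<lambda>n. real (n choose q) * (cmod (U j (Suc n)))\<^sup>2) sums d p j"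
      unfolding d_def Suc using sUq[of q j] p Suc by (simp add: summable_sums)
    have "(\<lambda>n. real (Suc n choose p) * (cmod (U j (Suc n)))\<^sup>2) sums (d (Suc p) j + d p j)"
      using sums_add[OF 1 2] by (simp add: Suc algebra_simps)
    hence "(\<lambda>n. real (n choose p) * (cmod (U j n))\<^sup>2) sums (d (Suc p) j + d p j)"
      by (subst (asm) sums_Suc_iff[of "\<lambda>n. real (n choose p) * (cmod (U j n))\<^sup>2"]) (simp add: Suc)
    thus ?thesis by (simp add: d_def US sums_iff)
  qed
  have dk: "enn2real (local_dirichlet \<zeta> k ((M_z ^^ j) f)) = d k j" for j
  proof -
    have "0 \<le> (\<Sum>n. real (n choose (k - 1)) * (cmod (U j (Suc n)))\<^sup>2)"
      by (intro suminf_nonneg[OF sU]) simp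
    moreover have "d k j = (\<Sum>n. real (n choose (k - 1)) * (cmod (U j (Suc n)))\<^sup>2)"
      using k by (cases k) (simp_all add: d_def)
    ultimately show ?thesis
      unfolding local_dirichlet_tail[OF k \<zeta> hol tail sU] by simp
  qed
  have "(\<Sum>j\<le>N. (-1) ^ j * real (N choose j) * d k (0 + j)) = (-1) ^ k * (1 - (cmod \<zeta>)\<^sup>2) ^ (N - k) * d 0 0"
    by (rule alternating_sum_of_tower[where k = k]) (auto intro: base step simp: N)
  thus ?thesis by (simp add: dk) (simp add: d_def U0)
qed

section \<open>The energy as a squared norm and its lower bound\<close>

lemma enn2real_le_imp_le_ennreal: "enn2real y \<le> c \<Longrightarrow> y < top \<Longrightarrow> y \<le> ennreal c"
  by (cases y) (auto intro: ennreal_leI)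

lemma le_suminf_ennreal: "b m \<le> (\<Sum>n. b n)" for b :: "nat \<Rightarrow> ennreal"
  using sum_le_suminf[of b "{m}"] by simp

lemma nn_integral_norm_sq_add_finite:
  fixes \<phi> \<psi> :: "'a \<Rightarrow> complex"
  assumes [measurable]: "\<phi> \<in> borel_measurable M" "\<psi> \<in> borel_measurable M"
    and fin: "(\<integral>\<^sup>+x. ennreal ((cmod (\<phi> x))\<^sup>2) \<partial>M) < \<infinity>" "(\<integral>\<^sup>+x. ennreal ((cmod (\<psi> x))\<^sup>2) \<partial>M) < \<infinity>"
  shows "(\<integral>\<^sup>+x. ennreal ((cmod (\<phi> x + c * \<psi> x))\<^sup>2) \<partial>M) < \<infinity>"
proof -
  have "(\<integral>\<^sup>+x. ennreal ((cmod (\<phi> x + c * \<psi> x))\<^sup>2) \<partial>M)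
      \<le> (\<integral>\<^sup>+x. (ennreal 2 * ennreal ((cmod (\<phi> x))\<^sup>2) + ennreal (2 * (cmod c)\<^sup>2) * ennreal ((cmod (\<psi> x))\<^sup>2)) \<partial>M)"
  proof (rule nn_integral_mono)
    fix x
    have "(cmod (\<phi> x + c * \<psi> x))\<^sup>2 \<le> 2 * (cmod (\<phi> x))\<^sup>2 + 2 * (cmod c)\<^sup>2 * (cmod (\<psi> x))\<^sup>2"
      using cmod_add_sq_le[of "\<phi> x" "c * \<psi> x"] by (simp add: norm_mult power_mult_distrib mult.assoc)
    hence "ennreal ((cmod (\<phi> x + c * \<psi> x))\<^sup>2) \<le> ennreal (2 * (cmod (\<phi> x))\<^sup>2 + 2 * (cmod c)\<^sup>2 * (cmod (\<psi> x))\<^sup>2)"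
      by (rule ennreal_leI)
    also have "\<dots> = ennreal 2 * ennreal ((cmod (\<phi> x))\<^sup>2) + ennreal (2 * (cmod c)\<^sup>2) * ennreal ((cmod (\<psi> x))\<^sup>2)"
      by (subst ennreal_plus) (auto simp: ennreal_mult)
    finally show "ennreal ((cmod (\<phi> x + c * \<psi> x))\<^sup>2) \<le> ennreal 2 * ennreal ((cmod (\<phi> x))\<^sup>2) + ennreal (2 * (cmod c)\<^sup>2) * ennreal ((cmod (\<psi> x))\<^sup>2)" .
  qed
  also have "\<dots> = ennreal 2 * (\<integral>\<^sup>+x. ennreal ((cmod (\<phi> x))\<^sup>2) \<partial>M) + ennreal (2 * (cmod c)\<^sup>2) * (\<integral>\<^sup>+x. ennreal ((cmod (\<psi> x))\<^sup>2) \<partial>M)"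
    by (subst nn_integral_add) (auto simp: nn_integral_cmult)
  also have "\<dots> < \<infinity>" using fin by (simp add: ennreal_mult_less_top)
  finally show ?thesis .
qed

text \<open>
  Polarization holds pointwise for complex numbers; it may be integrated because sums of square
  integrable functions are square integrable.
\<close>

lemma polarization_integral:
  fixes \<phi> \<psi> :: "'a \<Rightarrow> complex"
  assumes m [measurable]: "\<phi> \<in> borel_measurable M" "\<psi> \<in> borel_measurable M"
    and fin: "(\<integral>\<^sup>+x. ennreal ((cmod (\<phi> x))\<^sup>2) \<partial>M) < \<infinity>" "(\<integral>\<^sup>+x. ennreal ((cmod (\<psi> x))\<^sup>2) \<partial>M) < \<infinity>"
  shows "integrable M (\<lambda>x. \<phi> x * cnj (\<psi> x))"
    and "(\<Sum>j<4. \<i> ^ j * complex_of_real (enn2real (\<integral>\<^sup>+x. ennreal ((cmod (\<phi> x + \<i> ^ j * \<psi> x))\<^sup>2) \<partial>M))) / 4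
       = (\<integral>x. \<phi> x * cnj (\<psi> x) \<partial>M)"
proof -
  have int: "integrable M (\<lambda>x. (cmod (\<phi> x + c * \<psi> x))\<^sup>2)" for c
    by (rule integrableI_bounded) (use nn_integral_norm_sq_add_finite[OF m fin, of c] in auto)
  have pt: "\<phi> x * cnj (\<psi> x) = (\<Sum>j<4. \<i> ^ j / 4 * complex_of_real ((cmod (\<phi> x + \<i> ^ j * \<psi> x))\<^sup>2))" for x
  proof -
    have "(\<Sum>j<4. \<i> ^ j / 4 * complex_of_real ((cmod (\<phi> x + \<i> ^ j * \<psi> x))\<^sup>2))
       = (\<Sum>j<4. \<i> ^ j / 4 * ((\<phi> x + \<i> ^ j * \<psi> x) * cnj (\<phi> x + \<i> ^ j * \<psi> x)))"
      by (simp only: complex_norm_square)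
    also have "\<dots> = \<phi> x * cnj (\<psi> x)"
      by (simp add: eval_nat_numeral algebra_simps)
    finally show ?thesis ..
  qed
  have ic: "integrable M (\<lambda>x. \<i> ^ j / 4 * complex_of_real ((cmod (\<phi> x + \<i> ^ j * \<psi> x))\<^sup>2))" for j
    by (intro integrable_mult_right integrable_of_real int)
  show "integrable M (\<lambda>x. \<phi> x * cnj (\<psi> x))"
    unfolding pt by (intro Bochner_Integration.integrable_sum ic)
  have "(\<integral>x. \<phi> x * cnj (\<psi> x) \<partial>M) = (\<Sum>j<4. \<i> ^ j / 4 * complex_of_real (\<integral>x. (cmod (\<phi> x + \<i> ^ j * \<psi> x))\<^sup>2 \<partial>M))"
    unfolding pt by (subst Bochner_Integration.integral_sum[OF ic]) (simp only: integral_mult_right_zero integral_complex_of_real)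
  also have "\<dots> = (\<Sum>j<4. \<i> ^ j / 4 * complex_of_real (enn2real (\<integral>\<^sup>+x. ennreal ((cmod (\<phi> x + \<i> ^ j * \<psi> x))\<^sup>2) \<partial>M)))"
    by (subst integral_eq_nn_integral) auto
  finally show "(\<Sum>j<4. \<i> ^ j * complex_of_real (enn2real (\<integral>\<^sup>+x. ennreal ((cmod (\<phi> x + \<i> ^ j * \<psi> x))\<^sup>2) \<partial>M))) / 4
       = (\<integral>x. \<phi> x * cnj (\<psi> x) \<partial>M)"
    by (simp add: sum_divide_distrib)
qed

lemma integral_norm_sq:
  fixes \<phi> :: "'a \<Rightarrow> complex"
  assumes [measurable]: "\<phi> \<in> borel_measurable M"
  shows "(\<integral>x. \<phi> x * cnj (\<phi> x) \<partial>M) = complex_of_real (enn2real (\<integral>\<^sup>+x. ennreal ((cmod (\<phi> x))\<^sup>2) \<partial>M))"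
proof -
  have "(\<integral>x. \<phi> x * cnj (\<phi> x) \<partial>M) = (\<integral>x. complex_of_real ((cmod (\<phi> x))\<^sup>2) \<partial>M)"
    by (simp only: complex_norm_square)
  also have "\<dots> = complex_of_real (\<integral>x. (cmod (\<phi> x))\<^sup>2 \<partial>M)" by (rule integral_complex_of_real)
  also have "(\<integral>x. (cmod (\<phi> x))\<^sup>2 \<partial>M) = enn2real (\<integral>\<^sup>+x. ennreal ((cmod (\<phi> x))\<^sup>2) \<partial>M)"
    by (rule integral_eq_nn_integral) auto
  finally show ?thesis .
qed

text \<open>
  Cauchy-Schwarz for the Taylor series.
\<close>

lemma hardy_point_bound:
  assumes f: "f holomorphic_on unit_disc" and fin: "hardy_norm_sq f < \<infinity>" and z: "cmod z \<le> \<rho>" "\<rho> < 1"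
  shows "(cmod (f z))\<^sup>2 \<le> enn2real (hardy_norm_sq f) / (1 - \<rho>\<^sup>2)"
proof -
  let ?a = "taylor_coeff f"
  have \<rho>: "0 \<le> \<rho>" using z norm_ge_zero order_trans by blast
  have \<rho>2: "\<rho>\<^sup>2 < 1" using \<rho> z by (simp add: abs_square_less_1)
  have sm: "summable (\<lambda>n. (cmod (?a n))\<^sup>2)"
    using fin unfolding hardy_norm_sq_eq_suminf[OF f] by (intro summable_suminf_not_top) auto
  have E: "enn2real (hardy_norm_sq f) = (\<Sum>n. (cmod (?a n))\<^sup>2)"
    unfolding hardy_norm_sq_eq_suminf[OF f] using sm by (subst suminf_ennreal2) (auto simp: suminf_nonneg)
  have "(cmod (\<Sum>n<m. ?a n * z ^ n))\<^sup>2 \<le> (\<Sum>n. (cmod (?a n))\<^sup>2) * (1 / (1 - \<rho>\<^sup>2))" for m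
  proof -
    have "(cmod (\<Sum>n<m. ?a n * z ^ n))\<^sup>2 \<le> (\<Sum>n<m. cmod (?a n) * \<rho> ^ n)\<^sup>2"
      using z by (intro power_mono order_trans[OF norm_sum] sum_mono) (auto simp: norm_mult norm_power intro!: mult_left_mono power_mono)
    also have "\<dots> \<le> (\<Sum>n<m. (cmod (?a n))\<^sup>2) * (\<Sum>n<m. (\<rho> ^ n)\<^sup>2)"
      by (rule Cauchy_Schwarz_ineq_sum)
    also have "\<dots> \<le> (\<Sum>n. (cmod (?a n))\<^sup>2) * (1 / (1 - \<rho>\<^sup>2))"
    proof (intro mult_mono)
      show "(\<Sum>n<m. (cmod (?a n))\<^sup>2) \<le> (\<Sum>n. (cmod (?a n))\<^sup>2)" by (intro sum_le_suminf sm) auto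
      have g: "(\<lambda>n. (\<rho>\<^sup>2) ^ n) sums (1 / (1 - \<rho>\<^sup>2))" using \<rho>2 by (intro geometric_sums) simp
      have "(\<Sum>n<m. (\<rho>\<^sup>2) ^ n) \<le> 1 / (1 - \<rho>\<^sup>2)"
        using sum_le_suminf[OF sums_summable[OF g], of "{..<m}"] g by (simp add: sums_iff)
      thus "(\<Sum>n<m. (\<rho> ^ n)\<^sup>2) \<le> 1 / (1 - \<rho>\<^sup>2)" by (simp add: power_mult[symmetric] mult.commute)
    qed (auto intro!: suminf_nonneg sm sum_nonneg)
    finally show ?thesis .
  qed
  moreover have "(\<lambda>m. (cmod (\<Sum>n<m. ?a n * z ^ n))\<^sup>2) \<longlonglongrightarrow> (cmod (f z))\<^sup>2"
    using taylor_sums[OF f, of z] z by (intro tendsto_intros) (simp add: sums_def)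
  ultimately have "(cmod (f z))\<^sup>2 \<le> (\<Sum>n. (cmod (?a n))\<^sup>2) * (1 / (1 - \<rho>\<^sup>2))"
    by (intro LIMSEQ_le_const2) auto
  thus ?thesis by (simp add: E)
qed

context
  fixes \<mu> :: "complex measure" and k :: nat
  assumes k: "k \<ge> 1" and \<mu>: "\<mu> \<in> finite_borel_measures_on closed_unit_disc"
begin

text \<open>
  With this measure the energy \<open>D_int\<close> becomes the squared \<open>L\<^sup>2\<close> norm of \<open>disc_deriv f\<close>.
\<close>

definition weight_measure :: "complex measure" where
  "weight_measure = density area_measure (U_pot \<mu> k)"

definition disc_deriv :: "(complex \<Rightarrow> complex) \<Rightarrow> complex \<Rightarrow> complex" where
  "disc_deriv f z = (if z \<in> unit_disc then (deriv ^^ k) f z else 0)"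

lemma sets_weight_measure [simp, measurable_cong]: "sets weight_measure = sets borel"
  by (simp add: weight_measure_def)

lemma measurable_disc_deriv: "f holomorphic_on unit_disc \<Longrightarrow> disc_deriv f \<in> borel_measurable weight_measure"
  unfolding disc_deriv_def measurable_cong_sets[OF sets_weight_measure refl]
  by (intro borel_measurable_on_disc holomorphic_on_imp_continuous_on higher_deriv_holomorphic_disc)

lemma D_int_eq_weight:
  assumes f: "f holomorphic_on unit_disc"
  shows "D_int \<mu> k f = (\<integral>\<^sup>+z. ennreal ((cmod (disc_deriv f z))\<^sup>2) \<partial>weight_measure)"
proof -
  have [measurable]: "disc_deriv f \<in> borel_measurable borel"
    using measurable_disc_deriv[OF f] by (simp add: measurable_cong_sets[OF sets_weight_measure refl])
  have [measurable]: "U_pot \<mu> k \<in> borel_measurable borel" by (rule measurable_U_pot[OF \<mu>])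
  have "(\<integral>\<^sup>+z. ennreal ((cmod (disc_deriv f z))\<^sup>2) \<partial>weight_measure)
      = (\<integral>\<^sup>+z. U_pot \<mu> k z * ennreal ((cmod (disc_deriv f z))\<^sup>2) \<partial>area_measure)"
    unfolding weight_measure_def by (rule nn_integral_density) measurable
  also have "\<dots> = D_int \<mu> k f"
    unfolding D_int_def by (intro nn_integral_cong) (auto simp: disc_deriv_def indicator_def mult.commute)
  finally show ?thesis ..
qed

lemma hardy_eq_count:
  "f holomorphic_on unit_disc \<Longrightarrow> hardy_norm_sq f = (\<integral>\<^sup>+n. ennreal ((cmod (taylor_coeff f n))\<^sup>2) \<partial>count_space UNIV)"
  by (simp add: hardy_norm_sq_eq_suminf nn_integral_count_space_nat)

lemma taylor_coeff_lin:
  assumes "f holomorphic_on unit_disc" "g holomorphic_on unit_disc"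
  shows "taylor_coeff (\<lambda>z. f z + c * g z) n = taylor_coeff f n + c * taylor_coeff g n"
proof -
  have "fps_expansion (\<lambda>z. f z + c * g z) 0 = fps_expansion f 0 + fps_const c * fps_expansion g 0"
    by (intro fps_expansion_eqI fps_expansion_intros taylor_has_fps_expansion assms)
  thus ?thesis by simp
qed

lemma disc_deriv_lin:
  assumes "f holomorphic_on unit_disc" "g holomorphic_on unit_disc"
  shows "disc_deriv (\<lambda>z. f z + c * g z) z = disc_deriv f z + c * disc_deriv g z"
proof (cases "z \<in> unit_disc")
  case True
  have "(deriv ^^ k) (\<lambda>z. f z + c * g z) z = (deriv ^^ k) f z + (deriv ^^ k) (\<lambda>z. c * g z) z"
    using True assms by (intro higher_deriv_add[of _ unit_disc]) (auto intro!: holomorphic_intros)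
  also have "(deriv ^^ k) (\<lambda>z. c * g z) z = c * (deriv ^^ k) g z"
    using True assms by (intro higher_deriv_cmult[of _ unit_disc]) auto
  finally show ?thesis using True by (simp add: disc_deriv_def)
qed (simp add: disc_deriv_def)

lemma dirichlet_spaceD:
  assumes "f \<in> dirichlet_space \<mu> k"
  shows "f holomorphic_on unit_disc" "z \<notin> unit_disc \<Longrightarrow> f z = 0" "D_int \<mu> k f < \<infinity>"
  using assms by (auto simp: dirichlet_space_def)

lemma dirichlet_space_lin:
  assumes f: "f \<in> dirichlet_space \<mu> k" and g: "g \<in> dirichlet_space \<mu> k"
  shows "(\<lambda>z. f z + c * g z) \<in> dirichlet_space \<mu> k"
proof -
  note f' = dirichlet_spaceD[OF f] and g' = dirichlet_spaceD[OF g]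
  have h: "(\<lambda>z. f z + c * g z) holomorphic_on unit_disc" by (intro holomorphic_intros f' g')
  have "(\<integral>\<^sup>+z. ennreal ((cmod (disc_deriv f z + c * disc_deriv g z))\<^sup>2) \<partial>weight_measure) < \<infinity>"
    using f'(3) g'(3) unfolding D_int_eq_weight[OF f'(1)] D_int_eq_weight[OF g'(1)]
    by (intro nn_integral_norm_sq_add_finite measurable_disc_deriv f' g')
  hence "D_int \<mu> k (\<lambda>z. f z + c * g z) < \<infinity>"
    unfolding D_int_eq_weight[OF h] disc_deriv_lin[OF f'(1) g'(1)] .
  thus ?thesis using h f'(2) g'(2) by (simp add: dirichlet_space_def)
qed

lemma zero_in_dirichlet_space: "(\<lambda>z. 0) \<in> dirichlet_space \<mu> k"
  by (simp add: dirichlet_space_def D_int_def)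

text \<open>
  The term \<open>i = 0\<close> alone suffices, as \<open>cmod (1 - cnj \<zeta> * z) \<le> 2\<close>.
\<close>

lemma local_kernel_lower_bound:
  assumes \<zeta>: "cmod \<zeta> \<le> 1" and z: "cmod z < 1"
  shows "ennreal (1 / (4 * fact (k - 1) * fact k) * (1 - (cmod z)\<^sup>2) ^ k) \<le> local_kernel k z \<zeta>"
proof -
  define d where "d = cmod (1 - cnj \<zeta> * z)"
  have d0: "d > 0" using one_minus_cnj_mult_nonzero[OF \<zeta> z] by (simp add: d_def)
  have "d \<le> cmod 1 + cmod (cnj \<zeta> * z)" unfolding d_def by (rule norm_triangle_ineq4)
  also have "cmod (cnj \<zeta> * z) \<le> 1 * 1" unfolding norm_mult using \<zeta> z by (intro mult_mono) auto
  finally have "d \<le> 2" by simp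
  hence "d\<^sup>2 \<le> 2\<^sup>2" using d0 by (intro power_mono) auto
  hence d4: "d\<^sup>2 \<le> 4" by simp
  have s: "0 \<le> (1 - (cmod z)\<^sup>2) ^ k" using z by (simp add: power_le_one)
  have "1 / (4 * fact (k - 1) * fact k) * (1 - (cmod z)\<^sup>2) ^ k = 1 / (fact (k - 1) * fact k) * ((1 - (cmod z)\<^sup>2) ^ k / 4)"
    by simp
  also have "\<dots> \<le> 1 / (fact (k - 1) * fact k) * ((1 - (cmod z)\<^sup>2) ^ k / d\<^sup>2)"
    using s d0 d4 by (intro mult_left_mono divide_left_mono) auto
  also have "\<dots> = kernel_term k z \<zeta> 0"
    by (simp add: kernel_term_def d_def)
  finally have "ennreal (1 / (4 * fact (k - 1) * fact k) * (1 - (cmod z)\<^sup>2) ^ k) \<le> ennreal (kernel_term k z \<zeta> 0)"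
    by (rule ennreal_leI)
  also have "\<dots> \<le> local_kernel k z \<zeta>"
    unfolding local_kernel_def using sum_le_suminf[of "\<lambda>i. ennreal (kernel_term k z \<zeta> i)" "{0}"] by simp
  finally show ?thesis .
qed

text \<open>
  Compares \<open>D\<^sub>\<zeta> f\<close> with the tail of the Hardy norm. The factor \<open>8\<close> is the \<open>4\<close> of
  \<open>local_kernel_lower_bound\<close> times the \<open>2\<close> lost when the diagonal weights of \<open>bergman_parseval\<close> are
  bounded below by \<open>1 / 2\<close>.
\<close>

lemma local_dirichlet_lower_bound:
  assumes \<zeta>: "cmod \<zeta> \<le> 1" and f: "f holomorphic_on unit_disc"
  shows "ennreal (1 / (8 * fact (k - 1) * fact k)) * (\<Sum>n. ennreal ((cmod (taylor_coeff f (n + k)))\<^sup>2)) \<le> local_dirichlet \<zeta> k f"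
proof -
  define F where "F = (deriv ^^ k) f"
  have hF: "F holomorphic_on unit_disc" unfolding F_def by (rule higher_deriv_holomorphic_disc[OF f])
  define c where "c = 1 / (4 * fact (k - 1) * fact k :: real)"
  have c: "c > 0" by (simp add: c_def)
  have [measurable]: "(\<lambda>z. if z \<in> unit_disc then F z else 0) \<in> borel_measurable borel"
    by (intro borel_measurable_on_disc holomorphic_on_imp_continuous_on hF)
  have e: "(\<lambda>z. ennreal ((cmod (F z))\<^sup>2 * (1 - (cmod z)\<^sup>2) ^ k) * indicator unit_disc z)
     = (\<lambda>z. ennreal ((cmod (if z \<in> unit_disc then F z else 0))\<^sup>2 * (1 - (cmod z)\<^sup>2) ^ k) * indicator unit_disc z)"
    by (auto simp: fun_eq_iff indicator_def)
  have mb: "(\<lambda>z. ennreal ((cmod (F z))\<^sup>2 * (1 - (cmod z)\<^sup>2) ^ k) * indicator unit_disc z) \<in> borel_measurable area_measure"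
    unfolding e by measurable
  have "ennreal c * bergman k F = (\<integral>\<^sup>+z. ennreal c * (ennreal ((cmod (F z))\<^sup>2 * (1 - (cmod z)\<^sup>2) ^ k) * indicator unit_disc z) \<partial>area_measure)"
    unfolding bergman_def by (rule nn_integral_cmult[symmetric, OF mb])
  also have "\<dots> \<le> local_dirichlet \<zeta> k f"
    unfolding local_dirichlet_def
  proof (rule nn_integral_mono)
    fix z :: complex
    show "ennreal c * (ennreal ((cmod (F z))\<^sup>2 * (1 - (cmod z)\<^sup>2) ^ k) * indicator unit_disc z)
       \<le> ennreal ((cmod ((deriv ^^ k) f z))\<^sup>2) * local_kernel k z \<zeta> * indicator unit_disc z"
    proof (cases "z \<in> unit_disc")
      case True
      hence z: "cmod z < 1" by simp
      have "ennreal c * ennreal ((cmod (F z))\<^sup>2 * (1 - (cmod z)\<^sup>2) ^ k) = ennreal ((cmod (F z))\<^sup>2) * ennreal (c * (1 - (cmod z)\<^sup>2) ^ k)"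
        using c z by (simp add: ennreal_mult'[symmetric] mult_ac power_le_one)
      also have "\<dots> \<le> ennreal ((cmod (F z))\<^sup>2) * local_kernel k z \<zeta>"
        unfolding c_def by (intro mult_left_mono local_kernel_lower_bound[OF \<zeta> z]) simp
      finally show ?thesis using True by (simp add: F_def)
    qed simp
  qed
  finally have 1: "ennreal c * bergman k F \<le> local_dirichlet \<zeta> k f" .
  have "ennreal (1 / 2) * (\<Sum>n. ennreal ((cmod (taylor_coeff f (n + k)))\<^sup>2)) \<le> bergman k F"
    unfolding bergman_parseval[OF hF] ennreal_suminf_cmult[symmetric]
  proof (intro suminf_le)
    fix n
    obtain r where r: "k = Suc r" using k by (cases k) auto
    have co: "(cmod (taylor_coeff F n))\<^sup>2 = (fact (n + k) / fact n)\<^sup>2 * (cmod (taylor_coeff f (n + k)))\<^sup>2"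
      unfolding F_def taylor_coeff_higher_deriv norm_mult power_mult_distrib by (simp only: norm_of_real power2_abs)
    have "(1/2 :: real) \<le> fact n * fact k / fact (n + k + 1) * (fact (n + k) / fact n)\<^sup>2"
    proof -
      have f1: "fact (n + k + 1) = (real (n + k) + 1) * fact (n + k)" by simp
      have f2: "fact (n + k) = real (n + k) * fact (n + r)" by (simp add: r)
      have "fact n * fact k / fact (n + k + 1) * (fact (n + k) / fact n)\<^sup>2 = fact k * (fact (n + r) / fact n) * (real (n + k) / (real (n + k) + 1))"
      proof -
        have "A * K / ((m + 1) * B) * (B / A)\<^sup>2 = K * (D / A) * (m / (m + 1))"
          if "B = m * D" "A > 0" "D > 0" "m > 0" for A B K D m :: real
          using that by (simp add: power2_eq_square mult_ac)
        from this[OF f2, of "fact n" "fact k"] show ?thesis unfolding f1 using k by simp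
      qed
      moreover have "1 * 1 * (1/2) \<le> fact k * (fact (n + r) / fact n) * (real (n + k) / (real (n + k) + 1))"
      proof (intro mult_mono)
        show "1 \<le> (fact k :: real)" by (rule fact_ge_1)
        show "1 \<le> (fact (n + r) / fact n :: real)" by (simp add: fact_mono)
        show "1 / 2 \<le> real (n + k) / (real (n + k) + 1)" using k by (simp add: field_simps)
      qed auto
      ultimately show ?thesis by simp
    qed
    hence "1/2 * (cmod (taylor_coeff f (n + k)))\<^sup>2 \<le> fact n * fact k / fact (n + k + 1) * (fact (n + k) / fact n)\<^sup>2 * (cmod (taylor_coeff f (n + k)))\<^sup>2"
      by (intro mult_right_mono) auto
    hence "1/2 * (cmod (taylor_coeff f (n + k)))\<^sup>2 \<le> fact n * fact k / fact (n + k + 1) * (cmod (taylor_coeff F n))\<^sup>2"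
      unfolding co by (simp only: mult.assoc)
    thus "ennreal (1/2) * ennreal ((cmod (taylor_coeff f (n + k)))\<^sup>2) \<le> ennreal (fact n * fact k / fact (n + k + 1) * (cmod (taylor_coeff F n))\<^sup>2)"
      by (subst ennreal_mult'[symmetric]) (auto intro: ennreal_leI)
  qed auto
  hence "ennreal c * (ennreal (1/2) * (\<Sum>n. ennreal ((cmod (taylor_coeff f (n + k)))\<^sup>2))) \<le> ennreal c * bergman k F"
    by (rule mult_left_mono) simp
  also note 1
  also have "ennreal c * (ennreal (1/2) * (\<Sum>n. ennreal ((cmod (taylor_coeff f (n + k)))\<^sup>2)))
      = ennreal (1 / (8 * fact (k - 1) * fact k)) * (\<Sum>n. ennreal ((cmod (taylor_coeff f (n + k)))\<^sup>2))"
  proof -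
    have "ennreal (1 / (8 * fact (k - 1) * fact k)) = ennreal c * ennreal (1/2)"
      using c by (subst ennreal_mult'[symmetric]) (auto simp: c_def)
    thus ?thesis by (simp only: mult.assoc)
  qed
  finally show ?thesis .
qed

section \<open>Hilbert space structure and multiplication by the coordinate\<close>

lemma space_measure: "space \<mu> = closed_unit_disc"
  by (rule space_finite_borel_measure[OF \<mu>])

lemma emeasure_mu_finite: "emeasure \<mu> (space \<mu>) < \<infinity>"
  using finite_measure.emeasure_finite[OF finite_measure_of_borel[OF \<mu>]] by (simp add: less_top[symmetric])

lemma D_int_M_z_le:
  assumes f: "f holomorphic_on unit_disc"
  shows "D_int \<mu> k (M_z f) \<le> ennreal (real k + 2) * D_int \<mu> k f + ennreal 2 * emeasure \<mu> (space \<mu>) * hardy_norm_sq f"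
proof -
  have [measurable]: "(\<lambda>\<zeta>. local_dirichlet \<zeta> k f) \<in> borel_measurable \<mu>"
    by (rule D_int_eq_nn_integral_local_dirichlet(2)[OF \<mu> k f])
  have "D_int \<mu> k (M_z f) = (\<integral>\<^sup>+\<zeta>. local_dirichlet \<zeta> k (M_z f) \<partial>\<mu>)"
    by (rule D_int_eq_nn_integral_local_dirichlet(1)[OF \<mu> k M_z_holomorphic[OF f]])
  also have "\<dots> \<le> (\<integral>\<^sup>+\<zeta>. (ennreal (real k + 2) * local_dirichlet \<zeta> k f + ennreal (2 * (cmod (taylor_coeff f (k - 1)))\<^sup>2)) \<partial>\<mu>)"
    by (intro nn_integral_mono local_dirichlet_M_z_le k f) (simp add: space_measure)
  also have "\<dots> = ennreal (real k + 2) * D_int \<mu> k f + ennreal (2 * (cmod (taylor_coeff f (k - 1)))\<^sup>2) * emeasure \<mu> (space \<mu>)"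
    unfolding D_int_eq_nn_integral_local_dirichlet(1)[OF \<mu> k f]
    by (subst nn_integral_add) (auto simp: nn_integral_cmult)
  also have "ennreal (2 * (cmod (taylor_coeff f (k - 1)))\<^sup>2) \<le> ennreal 2 * hardy_norm_sq f"
  proof -
    have "ennreal ((cmod (taylor_coeff f (k - 1)))\<^sup>2) \<le> hardy_norm_sq f"
      unfolding hardy_norm_sq_eq_suminf[OF f] by (rule le_suminf_ennreal)
    thus ?thesis by (subst ennreal_mult') (auto intro: mult_left_mono)
  qed
  hence "ennreal (real k + 2) * D_int \<mu> k f + ennreal (2 * (cmod (taylor_coeff f (k - 1)))\<^sup>2) * emeasure \<mu> (space \<mu>)
     \<le> ennreal (real k + 2) * D_int \<mu> k f + ennreal 2 * hardy_norm_sq f * emeasure \<mu> (space \<mu>)"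
    by (intro add_left_mono mult_right_mono) auto
  finally show ?thesis by (simp add: mult_ac)
qed

lemma hardy_norm_sq_M_z:
  assumes f: "f holomorphic_on unit_disc"
  shows "hardy_norm_sq (M_z f) = hardy_norm_sq f"
proof -
  have "hardy_norm_sq (M_z f) = (\<Sum>n. ennreal ((cmod (taylor_coeff (M_z f) (n + 1)))\<^sup>2)) + (\<Sum>n<1. ennreal ((cmod (taylor_coeff (M_z f) n))\<^sup>2))"
    unfolding hardy_norm_sq_eq_suminf[OF M_z_holomorphic[OF f]] by (rule suminf_offset) simp
  thus ?thesis by (simp add: taylor_coeff_M_z[OF f] hardy_norm_sq_eq_suminf[OF f])
qed

context
  assumes nonzero: "emeasure \<mu> (space \<mu>) \<noteq> 0"
begin

text \<open>
  Integrating \<open>local_dirichlet_lower_bound\<close> over \<open>\<mu>\<close> bounds the Taylor coefficients from index \<open>k\<close> on, since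
  \<open>\<mu>\<close> has positive mass; finitely many coefficients remain.
\<close>

lemma hardy_norm_sq_finite:
  assumes "f \<in> dirichlet_space \<mu> k"
  shows "hardy_norm_sq f < \<infinity>"
proof -
  note f = dirichlet_spaceD[OF assms]
  define S where "S = (\<Sum>n. ennreal ((cmod (taylor_coeff f (n + k)))\<^sup>2))"
  define c where "c = ennreal (1 / (8 * fact (k - 1) * fact k))"
  have c: "c \<noteq> 0" by (simp add: c_def)
  have "c * S * emeasure \<mu> (space \<mu>) = (\<integral>\<^sup>+\<zeta>. c * S \<partial>\<mu>)" by simp
  also have "\<dots> \<le> (\<integral>\<^sup>+\<zeta>. local_dirichlet \<zeta> k f \<partial>\<mu>)"
    unfolding c_def S_def by (intro nn_integral_mono local_dirichlet_lower_bound f) (simp add: space_measure)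
  also have "\<dots> = D_int \<mu> k f"
    by (rule D_int_eq_nn_integral_local_dirichlet(1)[OF \<mu> k f(1), symmetric])
  also have "\<dots> < \<infinity>" by (rule f(3))
  finally have "S < \<infinity>" using c nonzero by (auto simp: ennreal_mult_less_top)
  moreover have "hardy_norm_sq f = S + (\<Sum>n<k. ennreal ((cmod (taylor_coeff f n))\<^sup>2))"
    unfolding hardy_norm_sq_eq_suminf[OF f(1)] S_def by (rule suminf_offset) simp
  ultimately show ?thesis by (simp add: ennreal_sum_less_top)
qed

lemma dirichlet_norm_sq:
  assumes f: "f \<in> dirichlet_space \<mu> k"
  shows "(dirichlet_norm \<mu> k f)\<^sup>2 = enn2real (hardy_norm_sq f) + enn2real (D_int \<mu> k f)"
  unfolding dirichlet_norm_def using hardy_norm_sq_finite[OF f] dirichlet_spaceD(3)[OF f]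
  by (simp add: enn2real_plus)

text \<open>
  The inner product of \<open>\<ell>\<^sup>2\<close> plus that of \<open>L\<^sup>2\<close> for \<open>weight_measure\<close>, pulled back along the embedding of
  \<open>f\<close> by its Taylor coefficients and its \<open>k\<close>-th derivative.
\<close>

definition energy_inner :: "(complex \<Rightarrow> complex) \<Rightarrow> (complex \<Rightarrow> complex) \<Rightarrow> complex" where
  "energy_inner f g = (\<integral>n. taylor_coeff f n * cnj (taylor_coeff g n) \<partial>count_space UNIV)
     + (\<integral>z. disc_deriv f z * cnj (disc_deriv g z) \<partial>weight_measure)"

lemma coeff_sq_integrable:
  assumes f: "f \<in> dirichlet_space \<mu> k"
  shows "(\<integral>\<^sup>+n. ennreal ((cmod (taylor_coeff f n))\<^sup>2) \<partial>count_space UNIV) < \<infinity>"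
    and "(\<integral>\<^sup>+z. ennreal ((cmod (disc_deriv f z))\<^sup>2) \<partial>weight_measure) < \<infinity>"
  using hardy_norm_sq_finite[OF f] dirichlet_spaceD(3)[OF f]
  unfolding hardy_eq_count[OF dirichlet_spaceD(1)[OF f]] D_int_eq_weight[OF dirichlet_spaceD(1)[OF f]] by auto

lemma measurable_count_space_coeff: "taylor_coeff f \<in> borel_measurable (count_space UNIV)"
  by simp

lemma energy_inner_integrable:
  assumes f: "f \<in> dirichlet_space \<mu> k" and g: "g \<in> dirichlet_space \<mu> k"
  shows "integrable (count_space UNIV) (\<lambda>n. taylor_coeff f n * cnj (taylor_coeff g n))"
    and "integrable weight_measure (\<lambda>z. disc_deriv f z * cnj (disc_deriv g z))"
  by (intro polarization_integral(1) coeff_sq_integrable f g measurable_disc_deriv dirichlet_spaceD(1)[OF f] dirichlet_spaceD(1)[OF g]; simp)+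

lemma inner_of_eq_energy_inner:
  assumes f: "f \<in> dirichlet_space \<mu> k" and g: "g \<in> dirichlet_space \<mu> k"
  shows "inner_of (dirichlet_norm \<mu> k) f g = energy_inner f g"
proof -
  note hf = dirichlet_spaceD(1)[OF f] and hg = dirichlet_spaceD(1)[OF g]
  have n: "complex_of_real ((dirichlet_norm \<mu> k (\<lambda>x. f x + c * g x))\<^sup>2)
     = complex_of_real (enn2real (\<integral>\<^sup>+n. ennreal ((cmod (taylor_coeff f n + c * taylor_coeff g n))\<^sup>2) \<partial>count_space UNIV))
     + complex_of_real (enn2real (\<integral>\<^sup>+z. ennreal ((cmod (disc_deriv f z + c * disc_deriv g z))\<^sup>2) \<partial>weight_measure))" for c
  proof -
    have h: "(\<lambda>x. f x + c * g x) holomorphic_on unit_disc" by (intro holomorphic_intros hf hg)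
    show ?thesis
      unfolding dirichlet_norm_sq[OF dirichlet_space_lin[OF f g]] hardy_eq_count[OF h] D_int_eq_weight[OF h]
        taylor_coeff_lin[OF hf hg] disc_deriv_lin[OF hf hg] by simp
  qed
  have "energy_inner f g = (\<Sum>j<4. \<i> ^ j * complex_of_real (enn2real (\<integral>\<^sup>+n. ennreal ((cmod (taylor_coeff f n + \<i> ^ j * taylor_coeff g n))\<^sup>2) \<partial>count_space UNIV))) / 4
     + (\<Sum>j<4. \<i> ^ j * complex_of_real (enn2real (\<integral>\<^sup>+z. ennreal ((cmod (disc_deriv f z + \<i> ^ j * disc_deriv g z))\<^sup>2) \<partial>weight_measure))) / 4"
    unfolding energy_inner_def
    unfolding polarization_integral(2)[OF measurable_count_space_coeff measurable_count_space_coeff coeff_sq_integrable(1)[OF f] coeff_sq_integrable(1)[OF g]]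
      polarization_integral(2)[OF measurable_disc_deriv[OF hf] measurable_disc_deriv[OF hg] coeff_sq_integrable(2)[OF f] coeff_sq_integrable(2)[OF g]] ..
  thus ?thesis unfolding inner_of_def n
    by (simp add: distrib_left sum.distrib add_divide_distrib)
qed

lemma energy_inner_self:
  assumes f: "f \<in> dirichlet_space \<mu> k"
  shows "energy_inner f f = complex_of_real ((dirichlet_norm \<mu> k f)\<^sup>2)"
  unfolding energy_inner_def dirichlet_norm_sq[OF f] hardy_eq_count[OF dirichlet_spaceD(1)[OF f]] D_int_eq_weight[OF dirichlet_spaceD(1)[OF f]]
  by (subst (1 2) integral_norm_sq) (auto intro: measurable_disc_deriv dirichlet_spaceD(1)[OF f])

lemma energy_inner_lin:
  assumes f: "f \<in> dirichlet_space \<mu> k" and g: "g \<in> dirichlet_space \<mu> k" and h: "h \<in> dirichlet_space \<mu> k"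
  shows "energy_inner (\<lambda>z. f z + c * g z) h = energy_inner f h + c * energy_inner g h"
proof -
  note hf = dirichlet_spaceD(1)[OF f] and hg = dirichlet_spaceD(1)[OF g]
  have "(\<integral>n. taylor_coeff (\<lambda>z. f z + c * g z) n * cnj (taylor_coeff h n) \<partial>count_space UNIV)
     = (\<integral>n. taylor_coeff f n * cnj (taylor_coeff h n) + c * (taylor_coeff g n * cnj (taylor_coeff h n)) \<partial>count_space UNIV)"
    unfolding taylor_coeff_lin[OF hf hg] by (simp add: algebra_simps)
  also have "\<dots> = (\<integral>n. taylor_coeff f n * cnj (taylor_coeff h n) \<partial>count_space UNIV) + c * (\<integral>n. taylor_coeff g n * cnj (taylor_coeff h n) \<partial>count_space UNIV)"
    by (subst Bochner_Integration.integral_add[OF energy_inner_integrable(1)[OF f h] integrable_mult_right[OF energy_inner_integrable(1)[OF g h]]]) simp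
  finally have 1: "(\<integral>n. taylor_coeff (\<lambda>z. f z + c * g z) n * cnj (taylor_coeff h n) \<partial>count_space UNIV)
     = (\<integral>n. taylor_coeff f n * cnj (taylor_coeff h n) \<partial>count_space UNIV) + c * (\<integral>n. taylor_coeff g n * cnj (taylor_coeff h n) \<partial>count_space UNIV)" .
  have "(\<integral>z. disc_deriv (\<lambda>z. f z + c * g z) z * cnj (disc_deriv h z) \<partial>weight_measure)
     = (\<integral>z. disc_deriv f z * cnj (disc_deriv h z) + c * (disc_deriv g z * cnj (disc_deriv h z)) \<partial>weight_measure)"
    unfolding disc_deriv_lin[OF hf hg] by (simp add: algebra_simps)
  also have "\<dots> = (\<integral>z. disc_deriv f z * cnj (disc_deriv h z) \<partial>weight_measure) + c * (\<integral>z. disc_deriv g z * cnj (disc_deriv h z) \<partial>weight_measure)"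
    by (subst Bochner_Integration.integral_add[OF energy_inner_integrable(2)[OF f h] integrable_mult_right[OF energy_inner_integrable(2)[OF g h]]]) simp
  finally show ?thesis unfolding energy_inner_def 1 by (simp add: algebra_simps)
qed

lemma energy_inner_cnj: "energy_inner g f = cnj (energy_inner f g)"
proof -
  have "cnj (\<integral>n. taylor_coeff f n * cnj (taylor_coeff g n) \<partial>count_space UNIV) = (\<integral>n. cnj (taylor_coeff f n * cnj (taylor_coeff g n)) \<partial>count_space UNIV)"
    by (rule Bochner_Integration.integral_cnj[symmetric])
  moreover have "cnj (\<integral>z. disc_deriv f z * cnj (disc_deriv g z) \<partial>weight_measure) = (\<integral>z. cnj (disc_deriv f z * cnj (disc_deriv g z)) \<partial>weight_measure)"
    by (rule Bochner_Integration.integral_cnj[symmetric])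
  ultimately show ?thesis unfolding energy_inner_def by (simp add: mult.commute)
qed

lemma dirichlet_norm_nonneg: "0 \<le> dirichlet_norm \<mu> k f"
  by (simp add: dirichlet_norm_def)

lemma dirichlet_norm_eq_0:
  assumes f: "f \<in> dirichlet_space \<mu> k" and z: "dirichlet_norm \<mu> k f = 0"
  shows "f = (\<lambda>z. 0)"
proof
  fix w
  note f' = dirichlet_spaceD[OF f]
  have "enn2real (hardy_norm_sq f) + enn2real (D_int \<mu> k f) = 0"
    using dirichlet_norm_sq[OF f] z by simp
  hence e: "enn2real (hardy_norm_sq f) = 0"
    using enn2real_nonneg[of "hardy_norm_sq f"] enn2real_nonneg[of "D_int \<mu> k f"] by linarith
  show "f w = 0"
  proof (cases "w \<in> unit_disc")
    case True
    hence "(cmod (f w))\<^sup>2 \<le> 0"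
      using hardy_point_bound[OF f'(1) hardy_norm_sq_finite[OF f], of w "cmod w"] by (simp add: e)
    thus ?thesis by simp
  qed (rule f'(2))
qed

lemma hardy_norm_sq_fatou:
  assumes hol: "\<And>m. F m holomorphic_on unit_disc" "G holomorphic_on unit_disc"
    and conv: "\<And>n z. z \<in> unit_disc \<Longrightarrow> (\<lambda>m. (deriv ^^ n) (F m) z) \<longlonglongrightarrow> (deriv ^^ n) G z"
    and bd: "eventually (\<lambda>m. hardy_norm_sq (F m) \<le> B) sequentially"
  shows "hardy_norm_sq G \<le> B"
proof -
  have "hardy_norm_sq G = (\<integral>\<^sup>+n. liminf (\<lambda>m. ennreal ((cmod (taylor_coeff (F m) n))\<^sup>2)) \<partial>count_space UNIV)"
    unfolding hardy_eq_count[OF hol(2)]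
  proof (intro nn_integral_cong)
    fix n
    have "(\<lambda>m. taylor_coeff (F m) n) \<longlonglongrightarrow> taylor_coeff G n"
      using conv[of 0 n] by (auto simp: fps_expansion_def intro!: tendsto_divide)
    hence "(\<lambda>m. ennreal ((cmod (taylor_coeff (F m) n))\<^sup>2)) \<longlonglongrightarrow> ennreal ((cmod (taylor_coeff G n))\<^sup>2)"
      by (intro tendsto_intros)
    from lim_imp_Liminf[OF _ this]
    show "ennreal ((cmod (taylor_coeff G n))\<^sup>2) = liminf (\<lambda>m. ennreal ((cmod (taylor_coeff (F m) n))\<^sup>2))" by simp
  qed
  also have "\<dots> \<le> liminf (\<lambda>m. \<integral>\<^sup>+n. ennreal ((cmod (taylor_coeff (F m) n))\<^sup>2) \<partial>count_space UNIV)"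
    by (rule nn_integral_liminf) simp
  also have "\<dots> = liminf (\<lambda>m. hardy_norm_sq (F m))"
    unfolding hardy_eq_count[OF hol(1)] ..
  also have "\<dots> \<le> B"
    using Liminf_le[OF _ bd] by simp
  finally show ?thesis .
qed

lemma D_int_fatou:
  assumes hol: "\<And>m. F m holomorphic_on unit_disc" "G holomorphic_on unit_disc"
    and conv: "\<And>n z. z \<in> unit_disc \<Longrightarrow> (\<lambda>m. (deriv ^^ n) (F m) z) \<longlonglongrightarrow> (deriv ^^ n) G z"
    and bd: "eventually (\<lambda>m. D_int \<mu> k (F m) \<le> B) sequentially"
  shows "D_int \<mu> k G \<le> B"
proof -
  have [measurable]: "disc_deriv (F m) \<in> borel_measurable weight_measure" for m
    by (rule measurable_disc_deriv[OF hol(1)])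
  have "D_int \<mu> k G = (\<integral>\<^sup>+z. liminf (\<lambda>m. ennreal ((cmod (disc_deriv (F m) z))\<^sup>2)) \<partial>weight_measure)"
    unfolding D_int_eq_weight[OF hol(2)]
  proof (intro nn_integral_cong)
    fix z
    have "(\<lambda>m. disc_deriv (F m) z) \<longlonglongrightarrow> disc_deriv G z"
      using conv[of z k] by (cases "z \<in> unit_disc") (auto simp: disc_deriv_def)
    hence "(\<lambda>m. ennreal ((cmod (disc_deriv (F m) z))\<^sup>2)) \<longlonglongrightarrow> ennreal ((cmod (disc_deriv G z))\<^sup>2)"
      by (intro tendsto_intros)
    from lim_imp_Liminf[OF _ this]
    show "ennreal ((cmod (disc_deriv G z))\<^sup>2) = liminf (\<lambda>m. ennreal ((cmod (disc_deriv (F m) z))\<^sup>2))" by simp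
  qed
  also have "\<dots> \<le> liminf (\<lambda>m. \<integral>\<^sup>+z. ennreal ((cmod (disc_deriv (F m) z))\<^sup>2) \<partial>weight_measure)"
    by (rule nn_integral_liminf) measurable
  also have "\<dots> = liminf (\<lambda>m. D_int \<mu> k (F m))"
    unfolding D_int_eq_weight[OF hol(1)] ..
  also have "\<dots> \<le> B"
    using Liminf_le[OF _ bd] by simp
  finally show ?thesis .
qed

lemma dirichlet_space_diff:
  "f \<in> dirichlet_space \<mu> k \<Longrightarrow> g \<in> dirichlet_space \<mu> k \<Longrightarrow> (\<lambda>z. f z - g z) \<in> dirichlet_space \<mu> k"
  using dirichlet_space_lin[of f g "-1"] by simp

text \<open>
  The Hardy norm controls values on compact subsets, so a Cauchy sequence converges locally uniformly,
  with all its derivatives. Fatou's lemma, applied to \<open>X n - X m\<close> as \<open>m\<close> tends to infinity, shows that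
  the limit is attained in norm as well.
\<close>

lemma dirichlet_space_complete:
  fixes X :: "nat \<Rightarrow> complex \<Rightarrow> complex"
  assumes X: "\<And>n. X n \<in> dirichlet_space \<mu> k"
    and Cauchy: "\<And>e. e > 0 \<Longrightarrow> \<exists>M. \<forall>m\<ge>M. \<forall>n\<ge>M. dirichlet_norm \<mu> k (\<lambda>x. X m x - X n x) < e"
  shows "\<exists>f\<in>dirichlet_space \<mu> k. (\<lambda>n. dirichlet_norm \<mu> k (\<lambda>x. X n x - f x)) \<longlonglongrightarrow> 0"
proof -
  note X' = dirichlet_spaceD[OF X]
  have uc: "uniformly_Cauchy_on (cball 0 \<rho>) X" if \<rho>: "0 \<le> \<rho>" "\<rho> < 1" for \<rho>
    unfolding uniformly_Cauchy_on_def
  proof (intro allI impI)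
    fix e :: real assume e: "e > 0"
    have \<rho>2: "1 - \<rho>\<^sup>2 > 0" using \<rho> by (simp add: abs_square_less_1)
    (* Compensates the constant of hardy_point_bound on the disc of radius rho. *)
    define d where "d = e * sqrt (1 - \<rho>\<^sup>2)"
    have d: "d > 0" using e \<rho>2 by (simp add: d_def)
    obtain M where M: "\<And>m n. m \<ge> M \<Longrightarrow> n \<ge> M \<Longrightarrow> dirichlet_norm \<mu> k (\<lambda>x. X m x - X n x) < d"
      using Cauchy[OF d] by blast
    have "dist (X m z) (X n z) < e" if z: "z \<in> cball 0 \<rho>" and mn: "m \<ge> M" "n \<ge> M" for z m n
    proof -
      have D: "(\<lambda>x. X m x - X n x) \<in> dirichlet_space \<mu> k" by (rule dirichlet_space_diff[OF X X])
      have "(cmod (X m z - X n z))\<^sup>2 \<le> enn2real (hardy_norm_sq (\<lambda>x. X m x - X n x)) / (1 - \<rho>\<^sup>2)"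
        using hardy_point_bound[OF dirichlet_spaceD(1)[OF D] hardy_norm_sq_finite[OF D], of z \<rho>] z \<rho> by simp
      also have "\<dots> \<le> (dirichlet_norm \<mu> k (\<lambda>x. X m x - X n x))\<^sup>2 / (1 - \<rho>\<^sup>2)"
        unfolding dirichlet_norm_sq[OF D] using \<rho>2 by (intro divide_right_mono) auto
      also have "\<dots> < d\<^sup>2 / (1 - \<rho>\<^sup>2)"
        using M[OF mn] \<rho>2 dirichlet_norm_nonneg by (intro divide_strict_right_mono power_strict_mono) auto
      also have "\<dots> = e\<^sup>2" using \<rho>2 by (simp add: d_def power_mult_distrib)
      finally show ?thesis using e by (simp add: dist_norm power_less_imp_less_base)
    qed
    thus "\<exists>M. \<forall>x\<in>cball 0 \<rho>. \<forall>m\<ge>M. \<forall>n\<ge>M. dist (X m x) (X n x) < e" by blast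
  qed
  define f where "f z = (if z \<in> unit_disc then lim (\<lambda>n. X n z) else 0)" for z
  have ul: "uniform_limit (cball 0 \<rho>) X f sequentially" if \<rho>: "0 \<le> \<rho>" "\<rho> < 1" for \<rho>
  proof -
    have "uniformly_convergent_on (cball 0 \<rho>) X"
      by (rule Cauchy_uniformly_convergent[OF uc[OF \<rho>]])
    hence "uniform_limit (cball 0 \<rho>) X (\<lambda>z. lim (\<lambda>n. X n z)) sequentially"
      by (simp add: uniformly_convergent_uniform_limit_iff)
    thus ?thesis by (rule uniform_limit_cong'[THEN iffD1, rotated -1]) (use \<rho> in \<open>auto simp: f_def\<close>)
  qed
  have between: "0 \<le> (1 + cmod z) / 2" "(1 + cmod z) / 2 < 1" "cmod z < (1 + cmod z) / 2" if "z \<in> unit_disc" for z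
    using that by (auto simp: add_nonneg_nonneg)
  have hf: "f holomorphic_on unit_disc"
  proof (rule holomorphic_uniform_sequence[OF _ X'(1)])
    fix z :: complex assume z: "z \<in> unit_disc"
    define d where "d = (1 - cmod z) / 2"
    have "cball z d \<subseteq> cball 0 ((1 + cmod z) / 2)"
    proof
      fix w assume "w \<in> cball z d"
      hence "cmod (w - z) \<le> d" by (simp add: dist_norm norm_minus_commute)
      moreover have "cmod w \<le> cmod (w - z) + cmod z" using norm_triangle_ineq[of "w - z" z] by simp
      ultimately show "w \<in> cball 0 ((1 + cmod z) / 2)" by (simp add: d_def field_simps)
    qed
    hence "uniform_limit (cball z d) X f sequentially" "cball z d \<subseteq> unit_disc"
      using uniform_limit_on_subset[OF ul[OF between(1,2)[OF z]]] between(2)[OF z] by (auto simp: subset_iff)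
    moreover have "d > 0" using z by (simp add: d_def)
    ultimately show "\<exists>d>0. cball z d \<subseteq> unit_disc \<and> uniform_limit (cball z d) X f sequentially" by blast
  qed simp
  have conv: "(\<lambda>m. (deriv ^^ n) (X m) z) \<longlonglongrightarrow> (deriv ^^ n) f z" if z: "z \<in> unit_disc" for n z
  proof (rule higher_deriv_complex_uniform_limit)
    show "uniform_limit (ball 0 ((1 + cmod z) / 2)) X f sequentially"
      by (rule uniform_limit_on_subset[OF ul[OF between(1,2)[OF z]]]) auto
    show "eventually (\<lambda>m. X m holomorphic_on ball 0 ((1 + cmod z) / 2)) sequentially"
      using between(2)[OF z] by (intro always_eventually allI holomorphic_on_subset[OF X'(1)]) auto
    show "z \<in> ball 0 ((1 + cmod z) / 2)" using between(3)[OF z] by simp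
  qed auto
  have est: "hardy_norm_sq (\<lambda>x. X n x - f x) \<le> ennreal (e\<^sup>2) \<and> D_int \<mu> k (\<lambda>x. X n x - f x) \<le> ennreal (e\<^sup>2)"
    if e: "e > 0" and M: "\<forall>m\<ge>M. \<forall>n\<ge>M. dirichlet_norm \<mu> k (\<lambda>x. X m x - X n x) < e" and n: "n \<ge> M" for e M n
  proof -
    have hol: "(\<lambda>x. X n x - X m x) holomorphic_on unit_disc" "(\<lambda>x. X n x - f x) holomorphic_on unit_disc" for m
      by (intro holomorphic_intros X' hf)+
    have cv: "(\<lambda>m. (deriv ^^ j) (\<lambda>x. X n x - X m x) z) \<longlonglongrightarrow> (deriv ^^ j) (\<lambda>x. X n x - f x) z" if z: "z \<in> unit_disc" for j z
    proof -
      have "(deriv ^^ j) (\<lambda>x. X n x - g x) z = (deriv ^^ j) (X n) z - (deriv ^^ j) g z" if "g holomorphic_on unit_disc" for g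
        by (rule higher_deriv_diff[OF X'(1) that _ z]) simp
      thus ?thesis using X'(1) hf by (simp add: tendsto_diff conv[OF z])
    qed
    have b: "hardy_norm_sq (\<lambda>x. X n x - X m x) \<le> ennreal (e\<^sup>2) \<and> D_int \<mu> k (\<lambda>x. X n x - X m x) \<le> ennreal (e\<^sup>2)" if m: "m \<ge> M" for m
    proof -
      have D: "(\<lambda>x. X n x - X m x) \<in> dirichlet_space \<mu> k" by (rule dirichlet_space_diff[OF X X])
      have "dirichlet_norm \<mu> k (\<lambda>x. X n x - X m x) \<le> e" using M n m by (simp add: less_imp_le)
      hence "(dirichlet_norm \<mu> k (\<lambda>x. X n x - X m x))\<^sup>2 \<le> e\<^sup>2"
        by (intro power_mono dirichlet_norm_nonneg)
      hence le: "enn2real (hardy_norm_sq (\<lambda>x. X n x - X m x)) \<le> e\<^sup>2" "enn2real (D_int \<mu> k (\<lambda>x. X n x - X m x)) \<le> e\<^sup>2"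
        unfolding dirichlet_norm_sq[OF D] using enn2real_nonneg by (smt (verit))+
      show ?thesis
        using le hardy_norm_sq_finite[OF D] dirichlet_spaceD(3)[OF D] by (auto intro: enn2real_le_imp_le_ennreal)
    qed
    have "eventually (\<lambda>m. m \<ge> M) sequentially" by (rule eventually_ge_at_top)
    hence "eventually (\<lambda>m. hardy_norm_sq (\<lambda>x. X n x - X m x) \<le> ennreal (e\<^sup>2)) sequentially"
      "eventually (\<lambda>m. D_int \<mu> k (\<lambda>x. X n x - X m x) \<le> ennreal (e\<^sup>2)) sequentially"
      by (rule eventually_mono; use b in blast)+
    thus ?thesis
      using hardy_norm_sq_fatou[OF hol cv] D_int_fatou[OF hol cv] by blast
  qed
  obtain M1 where M1: "\<forall>m\<ge>M1. \<forall>n\<ge>M1. dirichlet_norm \<mu> k (\<lambda>x. X m x - X n x) < 1"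
    using Cauchy[of 1] by auto
  have D1: "(\<lambda>x. X M1 x - f x) \<in> dirichlet_space \<mu> k"
  proof -
    have "D_int \<mu> k (\<lambda>x. X M1 x - f x) \<le> ennreal (1\<^sup>2)" using est[OF _ M1, of M1] by simp
    hence "D_int \<mu> k (\<lambda>x. X M1 x - f x) < \<infinity>" using ennreal_less_top order_le_less_trans by (metis infinity_ennreal_def)
    moreover have "(\<lambda>x. X M1 x - f x) holomorphic_on unit_disc" by (intro holomorphic_intros X' hf)
    ultimately show ?thesis using X'(2) by (simp add: dirichlet_space_def f_def)
  qed
  have f: "f \<in> dirichlet_space \<mu> k"
    using dirichlet_space_diff[OF X[of M1] D1] by simp
  have "(\<lambda>n. dirichlet_norm \<mu> k (\<lambda>x. X n x - f x)) \<longlonglongrightarrow> 0"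
  proof (rule LIMSEQ_I)
    fix e :: real assume e: "e > 0"
    obtain M where M: "\<forall>m\<ge>M. \<forall>n\<ge>M. dirichlet_norm \<mu> k (\<lambda>x. X m x - X n x) < e / 2"
      using Cauchy[of "e / 2"] e by auto
    have "norm (dirichlet_norm \<mu> k (\<lambda>x. X n x - f x) - 0) < e" if n: "n \<ge> M" for n
    proof -
      have D: "(\<lambda>x. X n x - f x) \<in> dirichlet_space \<mu> k" by (rule dirichlet_space_diff[OF X f])
      have "enn2real (hardy_norm_sq (\<lambda>x. X n x - f x)) \<le> (e / 2)\<^sup>2" "enn2real (D_int \<mu> k (\<lambda>x. X n x - f x)) \<le> (e / 2)\<^sup>2"
        using est[OF _ M n] e by (auto intro!: enn2real_leI)
      hence "(dirichlet_norm \<mu> k (\<lambda>x. X n x - f x))\<^sup>2 \<le> 2 * (e / 2)\<^sup>2"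
        unfolding dirichlet_norm_sq[OF D] by simp
      also have "\<dots> < e\<^sup>2" using e by (simp add: power2_eq_square)
      finally show ?thesis using e dirichlet_norm_nonneg by (simp add: power_less_imp_less_base)
    qed
    thus "\<exists>no. \<forall>n\<ge>no. norm (dirichlet_norm \<mu> k (\<lambda>x. X n x - f x) - 0) < e" by blast
  qed
  thus ?thesis using f by blast
qed

lemma dirichlet_hilbert: "hilbert_function_space (dirichlet_space \<mu> k) (dirichlet_norm \<mu> k)"
proof -
  have add: "(\<lambda>x. f x + g x) \<in> dirichlet_space \<mu> k" if "f \<in> dirichlet_space \<mu> k" "g \<in> dirichlet_space \<mu> k" for f g
    using dirichlet_space_lin[OF that, of 1] by simp
  have scale: "(\<lambda>x. c * f x) \<in> dirichlet_space \<mu> k" if "f \<in> dirichlet_space \<mu> k" for c f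
    using dirichlet_space_lin[OF zero_in_dirichlet_space that, of c] by simp
  have inner_zero: "energy_inner (\<lambda>z. 0) g = 0" if "g \<in> dirichlet_space \<mu> k" for g
    using energy_inner_lin[OF zero_in_dirichlet_space zero_in_dirichlet_space that, of "-1"] by simp
  have inner_add: "energy_inner (\<lambda>x. f x + g x) h = energy_inner f h + energy_inner g h"
    if "f \<in> dirichlet_space \<mu> k" "g \<in> dirichlet_space \<mu> k" "h \<in> dirichlet_space \<mu> k" for f g h
    using energy_inner_lin[OF that, of 1] by simp
  have inner_scale: "energy_inner (\<lambda>x. c * f x) g = c * energy_inner f g"
    if "f \<in> dirichlet_space \<mu> k" "g \<in> dirichlet_space \<mu> k" for c f g
    using energy_inner_lin[OF zero_in_dirichlet_space that, of c] inner_zero[OF that(2)] by simp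
  show ?thesis
    unfolding hilbert_function_space_def
    by (intro conjI ballI allI impI zero_in_dirichlet_space add scale dirichlet_norm_nonneg dirichlet_norm_eq_0)
       (auto simp: inner_of_eq_energy_inner add scale energy_inner_self inner_add inner_scale energy_inner_cnj[symmetric] intro!: dirichlet_space_complete)
qed

lemma M_z_bounded: "bounded_operator_on (dirichlet_space \<mu> k) (dirichlet_norm \<mu> k) M_z"
proof -
  define m where "m = enn2real (emeasure \<mu> (space \<mu>))"
  have m: "emeasure \<mu> (space \<mu>) = ennreal m"
    unfolding m_def using emeasure_mu_finite by (simp add: ennreal_enn2real less_top)
  have m0: "m \<ge> 0" by (simp add: m_def)
  have closed: "M_z f \<in> dirichlet_space \<mu> k" if f: "f \<in> dirichlet_space \<mu> k" for f
  proof -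
    note f' = dirichlet_spaceD[OF f]
    have "D_int \<mu> k (M_z f) < \<infinity>"
      by (rule order_le_less_trans[OF D_int_M_z_le[OF f'(1)]])
        (use f'(3) hardy_norm_sq_finite[OF f] emeasure_mu_finite in \<open>simp add: ennreal_mult_less_top\<close>)
    thus ?thesis using f'(2) M_z_holomorphic[OF f'(1)] by (simp add: dirichlet_space_def M_z_def)
  qed
  define C where "C = real k + 3 + 2 * m"
  have "dirichlet_norm \<mu> k (M_z f) \<le> sqrt C * dirichlet_norm \<mu> k f" if f: "f \<in> dirichlet_space \<mu> k" for f
  proof -
    note f' = dirichlet_spaceD[OF f]
    define h where "h = enn2real (hardy_norm_sq f)"
    define D where "D = enn2real (D_int \<mu> k f)"
    have h: "hardy_norm_sq f = ennreal h" "h \<ge> 0" unfolding h_def using hardy_norm_sq_finite[OF f] by (auto simp: ennreal_enn2real less_top)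
    have D: "D_int \<mu> k f = ennreal D" "D \<ge> 0" unfolding D_def using f'(3) by (auto simp: ennreal_enn2real less_top)
    have "D_int \<mu> k (M_z f) \<le> ennreal ((real k + 2) * D + 2 * m * h)"
    proof -
      have "ennreal ((real k + 2) * D + 2 * m * h) = ennreal (real k + 2) * ennreal D + ennreal 2 * ennreal m * ennreal h"
        using D(2) h(2) m0 by (subst ennreal_plus) (auto simp: ennreal_mult)
      thus ?thesis using D_int_M_z_le[OF f'(1)] unfolding h(1) D(1) m by simp
    qed
    hence "enn2real (D_int \<mu> k (M_z f)) \<le> (real k + 2) * D + 2 * m * h"
      using D(2) h(2) m0 by (intro enn2real_leI) auto
    hence "(dirichlet_norm \<mu> k (M_z f))\<^sup>2 \<le> h + ((real k + 2) * D + 2 * m * h)"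
      unfolding dirichlet_norm_sq[OF closed[OF f]] hardy_norm_sq_M_z[OF f'(1)] h_def by simp
    also have "\<dots> \<le> C * (h + D)"
    proof -
      have "0 \<le> (real k + 2) * h + (1 + 2 * m) * D" using D(2) h(2) m0 by (intro add_nonneg_nonneg mult_nonneg_nonneg) auto
      thus ?thesis by (simp add: C_def algebra_simps)
    qed
    also have "h + D = (dirichlet_norm \<mu> k f)\<^sup>2" unfolding dirichlet_norm_sq[OF f] h_def D_def ..
    also have "C * (dirichlet_norm \<mu> k f)\<^sup>2 = (sqrt C * dirichlet_norm \<mu> k f)\<^sup>2"
      using m0 by (simp add: C_def power_mult_distrib)
    finally show ?thesis
      by (rule power2_le_imp_le) (use m0 in \<open>simp add: C_def dirichlet_norm_nonneg\<close>)
  qed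
  thus ?thesis
    unfolding bounded_operator_on_def using closed by (auto simp: M_z_def algebra_simps)
qed

lemma M_z_pow_closed: "f \<in> dirichlet_space \<mu> k \<Longrightarrow> (M_z ^^ j) f \<in> dirichlet_space \<mu> k"
  using M_z_bounded by (induction j) (auto simp: bounded_operator_on_def)

text \<open>
  The contribution of the point \<open>\<zeta>\<close> to the defect form.
\<close>

definition local_defect :: "nat \<Rightarrow> (complex \<Rightarrow> complex) \<Rightarrow> complex \<Rightarrow> real" where
  "local_defect n f \<zeta> = (\<Sum>j\<le>n. (-1) ^ j * real (n choose j) * enn2real (local_dirichlet \<zeta> k ((M_z ^^ j) f)))"

text \<open>
  The Hardy norm drops out: \<open>M_z\<close> preserves it, and alternating sums of binomial coefficients vanish.
\<close>

lemma defect_eq_integral: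
  assumes f: "f \<in> dirichlet_space \<mu> k" and n: "n \<ge> 1"
  shows "integrable \<mu> (local_defect n f)"
    and "defect (dirichlet_norm \<mu> k) M_z n f = (\<integral>\<zeta>. local_defect n f \<zeta> \<partial>\<mu>)"
proof -
  note fj = M_z_pow_closed[OF f] and fjh = dirichlet_spaceD(1)[OF M_z_pow_closed[OF f]]
  have [measurable]: "(\<lambda>\<zeta>. local_dirichlet \<zeta> k ((M_z ^^ j) f)) \<in> borel_measurable \<mu>" for j
    by (rule D_int_eq_nn_integral_local_dirichlet(2)[OF \<mu> k fjh])
  have D: "D_int \<mu> k ((M_z ^^ j) f) = (\<integral>\<^sup>+\<zeta>. local_dirichlet \<zeta> k ((M_z ^^ j) f) \<partial>\<mu>)" for j
    by (rule D_int_eq_nn_integral_local_dirichlet(1)[OF \<mu> k fjh])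
  have fin: "AE \<zeta> in \<mu>. local_dirichlet \<zeta> k ((M_z ^^ j) f) \<noteq> \<infinity>" for j
    using dirichlet_spaceD(3)[OF fj[of j], unfolded D] by (intro nn_integral_PInf_AE) auto
  have nn: "(\<integral>\<^sup>+\<zeta>. ennreal (enn2real (local_dirichlet \<zeta> k ((M_z ^^ j) f))) \<partial>\<mu>) = D_int \<mu> k ((M_z ^^ j) f)" for j
    unfolding D by (rule nn_integral_cong_AE) (use fin[of j] in \<open>auto elim!: eventually_mono simp: ennreal_enn2real less_top\<close>)
  have int: "integrable \<mu> (\<lambda>\<zeta>. enn2real (local_dirichlet \<zeta> k ((M_z ^^ j) f)))" for j
    using dirichlet_spaceD(3)[OF fj] nn[of j] by (intro integrableI_bounded) auto
  have val: "(\<integral>\<zeta>. enn2real (local_dirichlet \<zeta> k ((M_z ^^ j) f)) \<partial>\<mu>) = enn2real (D_int \<mu> k ((M_z ^^ j) f))" for j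
    using nn[of j] by (subst integral_eq_nn_integral) auto
  show "integrable \<mu> (local_defect n f)"
    unfolding local_defect_def by (intro Bochner_Integration.integrable_sum integrable_mult_right int)
  have hardy: "hardy_norm_sq ((M_z ^^ j) f) = hardy_norm_sq f" for j
    using fjh by (induction j) (auto simp: hardy_norm_sq_M_z)
  have "defect (dirichlet_norm \<mu> k) M_z n f = (\<Sum>j\<le>n. (-1) ^ j * real (n choose j) * (enn2real (hardy_norm_sq f) + enn2real (D_int \<mu> k ((M_z ^^ j) f))))"
    unfolding defect_def[OF dirichlet_hilbert M_z_bounded] dirichlet_norm_sq[OF fj] hardy ..
  also have "\<dots> = (\<Sum>j\<le>n. (-1) ^ j * real (n choose j)) * enn2real (hardy_norm_sq f) + (\<Sum>j\<le>n. (-1) ^ j * real (n choose j) * enn2real (D_int \<mu> k ((M_z ^^ j) f)))"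
    by (simp add: distrib_left sum.distrib sum_distrib_right)
  also have "(\<Sum>j\<le>n. (-1) ^ j * real (n choose j)) = 0"
    using choose_alternating_sum[of n, where 'a=real] n by simp
  also have "0 * enn2real (hardy_norm_sq f) + (\<Sum>j\<le>n. (-1) ^ j * real (n choose j) * enn2real (D_int \<mu> k ((M_z ^^ j) f)))
      = (\<integral>\<zeta>. local_defect n f \<zeta> \<partial>\<mu>)"
    unfolding local_defect_def val[symmetric]
    by (subst Bochner_Integration.integral_sum) (auto intro!: integrable_mult_right int)
  finally show "defect (dirichlet_norm \<mu> k) M_z n f = (\<integral>\<zeta>. local_defect n f \<zeta> \<partial>\<mu>)" .
qed

text \<open>
  For almost every \<open>\<zeta>\<close> the local energy of \<open>f\<close> is finite, so that a tail sequence exists.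
\<close>

lemma AE_local_defect:
  assumes f: "f \<in> dirichlet_space \<mu> k" and n: "n \<ge> k"
  shows "AE \<zeta> in \<mu>. cmod \<zeta> \<le> 1 \<and> (\<exists>c\<ge>0. local_defect n f \<zeta> = (-1) ^ k * (1 - (cmod \<zeta>)\<^sup>2) ^ (n - k) * c)"
proof -
  note f' = dirichlet_spaceD[OF f]
  have [measurable]: "(\<lambda>\<zeta>. local_dirichlet \<zeta> k f) \<in> borel_measurable \<mu>"
    by (rule D_int_eq_nn_integral_local_dirichlet(2)[OF \<mu> k f'(1)])
  have "AE \<zeta> in \<mu>. local_dirichlet \<zeta> k f \<noteq> \<infinity>"
    using f'(3) unfolding D_int_eq_nn_integral_local_dirichlet(1)[OF \<mu> k f'(1)] by (intro nn_integral_PInf_AE) auto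
  moreover have "AE \<zeta> in \<mu>. \<zeta> \<in> space \<mu>" by (rule AE_space)
  ultimately show ?thesis
  proof eventually_elim
    case (elim \<zeta>)
    hence \<zeta>: "cmod \<zeta> \<le> 1" and "local_dirichlet \<zeta> k f < \<infinity>" by (auto simp: space_measure less_top)
    then obtain u where u: "tail_sequence \<zeta> f u" "summable (\<lambda>n. real (n choose (k - 1)) * (cmod (u (Suc n)))\<^sup>2)"
      using tail_sequence_exists[OF k _ f'(1)] by blast
    show ?case
      unfolding local_defect_def local_dirichlet_alternating_sum[OF k \<zeta> f'(1) u n] using \<zeta> by (auto intro!: exI[of _ "(cmod (u 0))\<^sup>2"])
  qed
qed

text \<open>
  The constant function one in the representation of the space; it detects mass inside the disc.
\<close>

definition disc_one :: "complex \<Rightarrow> complex" where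
  "disc_one z = (if z \<in> unit_disc then 1 else 0)"

lemma disc_one_holomorphic: "disc_one holomorphic_on unit_disc"
  by (rule holomorphic_transform[of "\<lambda>_. 1"]) (auto simp: disc_one_def)

lemma tail_sequence_disc_one: "tail_sequence \<zeta> disc_one (\<lambda>n. if n = 0 then 1 else 0)"
proof -
  have "fps_expansion disc_one 0 = fps_expansion (\<lambda>z. 1) 0"
    by (rule taylor_fps_cong) (simp add: disc_one_def)
  also have "\<dots> = 1" by (intro fps_expansion_eqI fps_expansion_intros)
  finally show ?thesis by (simp add: tail_sequence_def)
qed

lemma disc_one_in_dirichlet_space: "disc_one \<in> dirichlet_space \<mu> k"
proof -
  have "local_dirichlet \<zeta> k disc_one = 0" if "cmod \<zeta> \<le> 1" for \<zeta>
    using local_dirichlet_tail[OF k that disc_one_holomorphic tail_sequence_disc_one] by simp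
  hence "D_int \<mu> k disc_one = (\<integral>\<^sup>+\<zeta>. 0 \<partial>\<mu>)"
    unfolding D_int_eq_nn_integral_local_dirichlet(1)[OF \<mu> k disc_one_holomorphic]
    by (intro nn_integral_cong) (simp add: space_measure)
  thus ?thesis using disc_one_holomorphic by (simp add: dirichlet_space_def) (simp add: disc_one_def)
qed

text \<open>
  The defect form is an integral of terms with the sign of \<open>(-1) ^ k\<close>.
\<close>

lemma M_z_dirichlet_type: "dirichlet_type_operator (dirichlet_space \<mu> k) (dirichlet_norm \<mu> k) k M_z"
proof (rule dirichlet_type_operatorI[OF dirichlet_hilbert M_z_bounded])
  fix n f assume n: "n \<ge> k" and f: "f \<in> dirichlet_space \<mu> k"
  have "0 \<le> (\<integral>\<zeta>. (-1) ^ k * local_defect n f \<zeta> \<partial>\<mu>)"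
  proof (rule integral_nonneg_AE)
    show "AE \<zeta> in \<mu>. 0 \<le> (-1) ^ k * local_defect n f \<zeta>"
      using AE_local_defect[OF f n]
    proof eventually_elim
      case (elim \<zeta>)
      then obtain c where c: "c \<ge> 0" "local_defect n f \<zeta> = (-1) ^ k * (1 - (cmod \<zeta>)\<^sup>2) ^ (n - k) * c" by blast
      have "(-1) ^ k * ((-1) ^ k * x) = x" for x :: real by (simp add: mult.assoc[symmetric] power_mult_distrib[symmetric])
      hence "(-1) ^ k * local_defect n f \<zeta> = (1 - (cmod \<zeta>)\<^sup>2) ^ (n - k) * c" unfolding c(2) by (simp add: mult.assoc)
      thus ?case using c(1) elim by (simp add: power_le_one)
    qed
  qed
  thus "(-1) ^ k * defect (dirichlet_norm \<mu> k) M_z n f \<ge> 0"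
    using defect_eq_integral(2)[OF f, of n] n k by simp
qed

text \<open>
  For \<open>n = k + 1\<close> the local defect carries the factor \<open>1 - (cmod \<zeta>)\<^sup>2\<close>, which vanishes exactly on the circle.
  For \<open>f = 1\<close> the local defect is this factor itself, up to sign.
\<close>

lemma n_isometry_iff_supported:
  "n_isometry (dirichlet_space \<mu> k) (dirichlet_norm \<mu> k) (k + 1) M_z \<longleftrightarrow> supported_on \<mu> unit_circle"
proof
  assume "supported_on \<mu> unit_circle"
  hence "emeasure \<mu> (space \<mu> - unit_circle) = 0" by (simp add: supported_on_def)
  moreover have "space \<mu> - unit_circle \<in> sets \<mu>"
  proof -
    have "(\<lambda>x. indicator unit_circle x :: real) \<in> borel_measurable \<mu>"
      by (rule borel_measurable_of_borel[OF \<mu>]) simp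
    hence "(\<lambda>x. indicator unit_circle x :: real) -` {0} \<inter> space \<mu> \<in> sets \<mu>" by (rule measurable_sets) simp
    moreover have "(\<lambda>x. indicator unit_circle x :: real) -` {0} \<inter> space \<mu> = space \<mu> - unit_circle"
      by (auto simp: indicator_def)
    ultimately show ?thesis by simp
  qed
  ultimately have "AE \<zeta> in \<mu>. \<zeta> \<in> unit_circle" by (intro AE_I[of _ _ "space \<mu> - unit_circle"]) auto
  hence circle: "AE \<zeta> in \<mu>. cmod \<zeta> = 1" by eventually_elim simp
  have "defect (dirichlet_norm \<mu> k) M_z (k + 1) f = 0" if f: "f \<in> dirichlet_space \<mu> k" for f
  proof -
    have "AE \<zeta> in \<mu>. local_defect (k + 1) f \<zeta> = 0"
      using AE_local_defect[OF f le_add1[of k 1]] circle by eventually_elim auto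
    hence "(\<integral>\<zeta>. local_defect (k + 1) f \<zeta> \<partial>\<mu>) = 0" by (rule integral_eq_zero_AE)
    thus ?thesis using defect_eq_integral(2)[OF f, of "k + 1"] by simp
  qed
  thus "n_isometry (dirichlet_space \<mu> k) (dirichlet_norm \<mu> k) (k + 1) M_z"
    by (simp add: n_isometry_iff_defect[OF dirichlet_hilbert M_z_bounded])
next
  assume "n_isometry (dirichlet_space \<mu> k) (dirichlet_norm \<mu> k) (k + 1) M_z"
  hence zero: "defect (dirichlet_norm \<mu> k) M_z (k + 1) disc_one = 0"
    using disc_one_in_dirichlet_space by (simp add: n_isometry_iff_defect[OF dirichlet_hilbert M_z_bounded])
  have loc: "local_defect (k + 1) disc_one \<zeta> = (-1) ^ k * (1 - (cmod \<zeta>)\<^sup>2)" if "cmod \<zeta> \<le> 1" for \<zeta>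
    unfolding local_defect_def
    using local_dirichlet_alternating_sum[OF k that disc_one_holomorphic tail_sequence_disc_one, of "k + 1"] by simp
  have int: "integrable \<mu> (\<lambda>\<zeta>. 1 - (cmod \<zeta>)\<^sup>2)"
  proof (rule finite_measure.integrable_const_bound[OF finite_measure_of_borel[OF \<mu>], where B = 1])
    show "AE \<zeta> in \<mu>. norm (1 - (cmod \<zeta>)\<^sup>2) \<le> 1"
      using AE_space
    proof eventually_elim
      case (elim \<zeta>)
      hence "(cmod \<zeta>)\<^sup>2 \<le> 1" by (simp add: space_measure power_le_one)
      thus ?case by simp
    qed
    show "(\<lambda>\<zeta>. 1 - (cmod \<zeta>)\<^sup>2) \<in> borel_measurable \<mu>" by (rule borel_measurable_of_borel[OF \<mu>]) simp
  qed
  have "0 = (\<integral>\<zeta>. local_defect (k + 1) disc_one \<zeta> \<partial>\<mu>)"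
    using zero defect_eq_integral(2)[OF disc_one_in_dirichlet_space, of "k + 1"] by simp
  also have "\<dots> = (\<integral>\<zeta>. (-1) ^ k * (1 - (cmod \<zeta>)\<^sup>2) \<partial>\<mu>)"
    by (intro Bochner_Integration.integral_cong refl loc) (simp add: space_measure)
  finally have "(\<integral>\<zeta>. 1 - (cmod \<zeta>)\<^sup>2 \<partial>\<mu>) = 0" by simp
  moreover have "AE \<zeta> in \<mu>. 0 \<le> 1 - (cmod \<zeta>)\<^sup>2"
    using AE_space by eventually_elim (auto simp: space_measure power_le_one)
  ultimately have "AE \<zeta> in \<mu>. 1 - (cmod \<zeta>)\<^sup>2 = 0"
    using integral_nonneg_eq_0_iff_AE[OF int] by simp
  hence "AE \<zeta> in \<mu>. \<not> \<zeta> \<notin> unit_circle"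
  proof eventually_elim
    case (elim \<zeta>)
    hence "(cmod \<zeta>)\<^sup>2 = 1\<^sup>2" by simp
    hence "cmod \<zeta> = 1" by (rule power2_eq_imp_eq) auto
    thus ?case by simp
  qed
  hence "emeasure \<mu> {\<zeta> \<in> space \<mu>. \<zeta> \<notin> unit_circle} = 0" by (rule emeasure_eq_0_AE)
  moreover have "{\<zeta> \<in> space \<mu>. \<zeta> \<notin> unit_circle} = space \<mu> - unit_circle" by auto
  ultimately show "supported_on \<mu> unit_circle" by (simp add: supported_on_def)
qed

end

end

theorem proposition4p13:
  fixes k :: nat and \<mu> :: "complex measure"
  assumes "k \<ge> 1"
    and "\<mu> \<in> finite_borel_measures_on closed_unit_disc"
    and "emeasure \<mu> (space \<mu>) \<noteq> 0"
  shows "dirichlet_type_operator (dirichlet_space \<mu> k) (dirichlet_norm \<mu> k) k M_z \<and>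
         (n_isometry (dirichlet_space \<mu> k) (dirichlet_norm \<mu> k) (k + 1) M_z \<longleftrightarrow>
            supported_on \<mu> unit_circle)"
  using M_z_dirichlet_type[OF assms] n_isometry_iff_supported[OF assms] by blast

end
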